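(* For all $n \in \mathbb{N}_{>1}$ we have $$\|S^1\times S^{n-1}\|_{\mathbb{Z}} = 2 = \begin{cases} \|S^1\|_{\mathbb{Z}}\cdot\|S^{n-1}\|_{\mathbb{Z}} & \text{if } n \text{ is odd},\\ 2\cdot\|S^1\|_{\mathbb{Z}}\cdot\|S^{n-1}\|_{\mathbb{Z}} & \text{if } n \text{ is even}.\end{cases}$$
   Context: For a singular chain $c = \sum_j a_j\cdot\sigma_j$ with integer coefficients in reduced form put $|c|_1 := \sum_j|a_j|$. For an oriented closed connected $n$-manifold $M$, the integral simplicial volume is $\|M\|_{\mathbb{Z}} := \min\{|c|_1 \mid c \in C_n(M;\mathbb{Z}) \text{ is a singular cycle representing the integral fundamental class } [M]_{\mathbb{Z}}\}$. *)

theory Defs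
  imports "HOL-Homology.Homology"
begin

definition local_homology_group :: "nat \<Rightarrow> 'a topology \<Rightarrow> 'a \<Rightarrow> 'a chain set monoid"
  where "local_homology_group n X x =
           relative_homology_group (int n) X (topspace X - {x})"

text \<open>The map \<open>H_n(X, X - U) \<rightarrow> H_n(X, X - {x})\<close> induced by the identity, for \<open>x \<in> U\<close>.
  For \<open>U = topspace X\<close> its domain is the absolute group \<open>H_n(X)\<close>.\<close>

definition localize :: "nat \<Rightarrow> 'a topology \<Rightarrow> 'a set \<Rightarrow> 'a \<Rightarrow> 'a chain set \<Rightarrow> 'a chain set"
  where "localize n X U x =
           hom_induced (int n) X (topspace X - U) X (topspace X - {x}) id"

text \<open>An orientation of an \<open>n\<close>-manifold \<open>X\<close>, where \<open>H_n(X, X - {x})\<close> is infinite cyclic for every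
  \<open>x\<close>: a choice of generators of these groups that is locally induced by a single class.\<close>

definition orientation :: "nat \<Rightarrow> 'a topology \<Rightarrow> ('a \<Rightarrow> 'a chain set) \<Rightarrow> bool"
  where "orientation n X \<omega> \<longleftrightarrow>
    (\<forall>x \<in> topspace X.
       \<omega> x \<in> carrier (local_homology_group n X x) \<and>
       subgroup_generated (local_homology_group n X x) {\<omega> x} = local_homology_group n X x) \<and>
    (\<forall>x \<in> topspace X. \<exists>U. openin X U \<and> x \<in> U \<and>
       (\<exists>\<mu> \<in> carrier (relative_homology_group (int n) X (topspace X - U)).
          \<forall>y \<in> U. localize n X U y \<mu> = \<omega> y))"

text \<open>If \<open>(X, \<omega>)\<close> is an oriented closed connected \<open>n\<close>-manifold, exactly one class satisfies the
  following predicate.\<close>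

definition fundamental_class ::
    "nat \<Rightarrow> 'a topology \<Rightarrow> ('a \<Rightarrow> 'a chain set) \<Rightarrow> 'a chain set \<Rightarrow> bool"
  where "fundamental_class n X \<omega> a \<longleftrightarrow>
    a \<in> carrier (homology_group (int n) X) \<and>
    (\<forall>x \<in> topspace X. localize n X (topspace X) x a = \<omega> x)"

definition chain_norm :: "'a chain \<Rightarrow> nat"
  where "chain_norm c = (\<Sum>\<sigma> \<in> Poly_Mapping.keys c. nat \<bar>Poly_Mapping.lookup c \<sigma>\<bar>)"

definition integral_simplicial_volume ::
    "nat \<Rightarrow> 'a topology \<Rightarrow> ('a \<Rightarrow> 'a chain set) \<Rightarrow> nat"
  where "integral_simplicial_volume n X \<omega> =
    (LEAST m. \<exists>c. singular_relcycle n X {} c \<and>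
                  fundamental_class n X \<omega> (homologous_rel_set n X {} c) \<and>
                  m = chain_norm c)"

end

(*
Lower bound for S^1 x S^(n-1): a cycle of norm 1 is a simplex with vanishing boundary, so each of its
faces agrees with another one. Lift the S^1-component to the real line. Faces that agree in the circle have
lifts differing by a constant, and looking at vertices shows that all these constants are 0. Hence the simplex lifts
to a cycle of S^(n-1) x R, whose n-th homology vanishes. For an even-dimensional sphere, the augmentation of the
boundary of a single simplex is 1, so no such cycle exists.

Upper bound: identify S^(n-1) x R with the punctured space R^n - {0} and S^1 x S^(n-1) with its quotient by the
dilation by exp (2 pi) (a Hopf manifold). A chain c in the punctured space whose boundary is the difference of the
dilate of a cycle e and e itself projects to a cycle, and the latter represents a fundamental class if e generates
the homology of the punctured space. The cycle e is a simplex with boundary collapsed to a point minus a constant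
simplex; c is a difference of two simplices, which spiral around the origin.
*)

theory Submission
  imports Defs "HOL-Analysis.Complex_Transcendental"
begin

section \<open>Infinite cyclic homology groups and their generators\<close>

text \<open>A sign shapes the two simplices. In the boundary of an n-simplex the first face has sign
  1 and the last one (-1)^n, while the boundary wanted is a dilate minus the original. For odd n,
  faces 0 and n of one simplex can carry both copies of the nondegenerate simplex in e. For even n
  they must lie on different simplices, and each simplex carries one more copy on face 1, where the
  two cancel. Two copies on faces n and a of one simplex are parametrized differently, by a cyclic
  permutation of n - a coordinates; interpolating between them avoids the origin because n - a is
  odd. The logarithmic radius is 2 pi times the affine function with value i at vertex i, so the
  radii on the first face are exp (2 pi) times those on the last.

  No orientation sign is ever computed. To generate an infinite cyclic group is a property that
  isomorphisms preserve and reflect; the sign left open does no harm, since z and -z have the same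
  norm. All generators come from one: the affine p-simplex in R^p relative to the complement of its
  barycenter, treated by induction on p.\<close>

definition infinite_cyclic_generator :: "('a, 'b) monoid_scheme \<Rightarrow> 'a \<Rightarrow> bool"
  where "infinite_cyclic_generator G a \<longleftrightarrow>
    group G \<and> a \<in> carrier G \<and> ([^]\<^bsub>G\<^esub>) a \<in> iso integer_group G"

lemma infinite_cyclic_generator_iso:
  assumes "infinite_cyclic_generator G a" "h \<in> iso G H" "group H"
  shows "infinite_cyclic_generator H (h a)"
proof -
  have G: "group G" and a: "a \<in> carrier G" and i: "([^]\<^bsub>G\<^esub>) a \<in> iso integer_group G"
    using assms(1) by (auto simp: infinite_cyclic_generator_def)
  have hh: "h \<in> hom G H" using assms(2) by (simp add: iso_def)
  have "h \<circ> ([^]\<^bsub>G\<^esub>) a \<in> iso integer_group H"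
    using i assms(2) by (rule iso_set_trans)
  moreover have "h \<circ> ([^]\<^bsub>G\<^esub>) a = (([^]\<^bsub>H\<^esub>) (h a) :: int \<Rightarrow> _)"
    using hom_int_pow[OF hh a G assms(3)] by (intro ext) simp
  ultimately show ?thesis
    using hh a assms(3) by (auto simp: infinite_cyclic_generator_def hom_def)
qed

lemma infinite_cyclic_generator_iso_iff:
  assumes "h \<in> iso G H" "group G" "group H" "a \<in> carrier G"
  shows "infinite_cyclic_generator H (h a) \<longleftrightarrow> infinite_cyclic_generator G a"
proof
  assume *: "infinite_cyclic_generator H (h a)"
  have "inv_into (carrier G) h \<in> iso H G"
    using assms by (simp add: group.iso_set_sym)
  from infinite_cyclic_generator_iso[OF * this assms(2)]
  show "infinite_cyclic_generator G a"
    using assms by (simp add: iso_def bij_betw_def)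
qed (rule infinite_cyclic_generator_iso[OF _ assms(1,3)])

text \<open>The neutral element generates a one-element group. This excludes that an orientation
  takes the neutral element as a value, which a null-homologous fundamental class would
  force.\<close>

lemma infinite_cyclic_generator_nontrivial:
  fixes G (structure)
  assumes "infinite_cyclic_generator G a"
  shows "subgroup_generated G {\<one>} \<noteq> G"
proof
  assume *: "subgroup_generated G {\<one>} = G"
  interpret group G using assms by (simp add: infinite_cyclic_generator_def)
  have "carrier (subgroup_generated G {\<one>}) = range (\<lambda>n::int. \<one> [^] n)"
    by (rule carrier_subgroup_generated_by_singleton) simp
  then have "carrier G = {\<one>}"
    using * by auto
  moreover have "inj_on (\<lambda>k::int. a [^] k) UNIV" "(\<lambda>k::int. a [^] k) ` UNIV = carrier G"
    using assms by (auto simp: infinite_cyclic_generator_def iso_def bij_betw_def)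
  ultimately have "finite (UNIV::int set)"
    by (metis finite.emptyI finite.insertI finite_imageD)
  then show False by (simp add: infinite_UNIV_int)
qed

text \<open>Writing each element as a power of the other gives exponents with
  \<open>k * l = 1\<close>, and the only integer units are 1 and -1. Hence at every point an
  orientation has just two possible values.\<close>

lemma infinite_cyclic_generator_unique:
  fixes G (structure)
  assumes "infinite_cyclic_generator G a" "b \<in> carrier G" "subgroup_generated G {b} = G"
  shows "b = a \<or> b = inv a"
proof -
  interpret group G using assms by (simp add: infinite_cyclic_generator_def)
  have a: "a \<in> carrier G" using assms(1) by (simp add: infinite_cyclic_generator_def)
  have inj: "inj (\<lambda>k::int. a [^] k)" and im: "range (\<lambda>k::int. a [^] k) = carrier G"
    using assms(1) by (auto simp: infinite_cyclic_generator_def iso_def bij_betw_def)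
  obtain k :: int where k: "b = a [^] k" using im assms(2) by blast
  have "carrier G = range (\<lambda>k::int. b [^] k)"
    using carrier_subgroup_generated_by_singleton[OF assms(2)] assms(3) by auto
  then obtain l :: int where "a = b [^] l" using a by blast
  then have "a [^] (1::int) = a [^] (k * l)" using a by (simp add: k int_pow_pow)
  then have "k * l = 1" using inj by (metis injD)
  then have "k = 1 \<or> k = -1" by (metis zmult_eq_1_iff)
  then show ?thesis using k a by (auto simp: int_pow_neg)
qed

section \<open>Chains that represent generators, and their transfer along isomorphisms\<close>

definition generates :: "nat \<Rightarrow> 'a topology \<Rightarrow> 'a set \<Rightarrow> 'a chain \<Rightarrow> bool"
  where "generates p X S c \<longleftrightarrow> singular_relcycle p X S c \<and>
    infinite_cyclic_generator (relative_homology_group (int p) X S) (homologous_rel_set p X S c)"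

lemma homology_class_carrier:
  "singular_relcycle p X S c \<Longrightarrow>
    homologous_rel_set p X S c \<in> carrier (relative_homology_group (int p) X S)"
  by (auto simp: carrier_relative_homology_group)

lemma generates_homologous:
  assumes "generates p X S c" "homologous_rel p X S c c'"
  shows "generates p X S c'"
  using assms homologous_rel_set_eq homologous_rel_singular_relcycle
  by (metis generates_def)

lemma homologous_rel_mono:
  assumes "homologous_rel p X S a b" "S \<subseteq> T"
  shows "homologous_rel p X T a b"
  using assms singular_chain_mono unfolding homologous_rel_def singular_relboundary_alt by blast

lemma singular_relcycle_mono:
  assumes "singular_relcycle p X S c" "S \<subseteq> T"
  shows "singular_relcycle p X T c"
  using assms singular_chain_mono unfolding singular_relcycle by blast

text \<open>An isomorphism preserves and reflects generators, so the property can be moved in either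
  direction along excisions, homotopy equivalences and homeomorphisms.\<close>

lemma generates_hom_induced_iso:
  assumes "continuous_map X Y f" "f \<in> S \<rightarrow> T"
    "hom_induced (int p) X S Y T f \<in> iso (relative_homology_group (int p) X S) (relative_homology_group (int p) Y T)"
    "singular_relcycle p X S c"
  shows "generates p Y T (chain_map p f c) \<longleftrightarrow> generates p X S c"
  using infinite_cyclic_generator_iso_iff[OF assms(3) _ _ homology_class_carrier[OF assms(4)]]
    singular_relcycle_chain_map[OF assms(4,1,2)] assms(4)
  by (simp add: generates_def hom_induced_chain_map[OF assms(1,2,4)])

lemma generates_subspace_iso:
  assumes "hom_induced (int p) (subtopology X A) S X T id
      \<in> iso (relative_homology_group (int p) (subtopology X A) S) (relative_homology_group (int p) X T)"
    "S \<subseteq> T" "singular_relcycle p (subtopology X A) S c"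
  shows "generates p X T c \<longleftrightarrow> generates p (subtopology X A) S c"
proof -
  have "chain_map p id c = c"
    using assms(3) by (auto simp: singular_relcycle intro: chain_map_ident)
  then show ?thesis
    using generates_hom_induced_iso[OF _ _ assms(1,3)] assms(2)
    by (simp add: continuous_map_from_subtopology id_def Pi_def subset_iff)
qed

text \<open>In the long exact sequence of the triple \<open>X\<close>, \<open>S\<close>,
  \<open>T\<close> the groups of the pair \<open>X\<close>, \<open>T\<close> vanish, both spaces
  being contractible; so the connecting map is an isomorphism. It raises the degree in the induction
  for the explicit generators.\<close>

lemma generates_boundary_iff:
  assumes "contractible_space X" "contractible_space (subtopology X T)" "T \<subseteq> S"
    "topspace X \<inter> T \<noteq> {}" "singular_relcycle (Suc p) X S c"
  shows "generates p (subtopology X S) T (chain_boundary (Suc p) c) \<longleftrightarrow> generates (Suc p) X S c"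
proof -
  have bc: "singular_relcycle p (subtopology X S) {} (chain_boundary (Suc p) c)"
    using assms(5) by (auto simp: singular_relcycle dest: chain_boundary_boundary_alt)
  then have bc': "singular_relcycle p (subtopology X S) T (chain_boundary (Suc p) c)"
    by (rule singular_relcycle_mono) simp
  have id: "chain_map p id (chain_boundary (Suc p) c) = chain_boundary (Suc p) c"
    using bc by (auto simp: singular_relcycle intro: chain_map_ident)
  have e: "int (Suc p) - 1 = int p" by simp
  have "hom_relboundary (int (Suc p)) X S T (homologous_rel_set (Suc p) X S c)
      = homologous_rel_set p (subtopology X S) T (chain_boundary (Suc p) c)"
    using hom_boundary_chain_boundary[OF assms(5)] bc id
    by (simp add: hom_relboundary_def hom_induced_chain_map e del: of_nat_Suc)
  then show ?thesis
    using infinite_cyclic_generator_iso_iff[OF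
        iso_hom_relboundary_contractible[OF assms(1-4), of "int (Suc p)"] _ _ homology_class_carrier[OF assms(5)]]
      bc' assms(5)
    by (simp add: generates_def)
qed

lemma generates_boundary_absolute_iff:
  assumes "contractible_space X" "topspace X \<inter> S \<noteq> {}" "0 < p" "singular_relcycle (Suc p) X S c"
  shows "generates p (subtopology X S) {} (chain_boundary (Suc p) c) \<longleftrightarrow> generates (Suc p) X S c"
proof -
  have bc: "singular_relcycle p (subtopology X S) {} (chain_boundary (Suc p) c)"
    using assms(4) by (auto simp: singular_relcycle dest: chain_boundary_boundary_alt)
  have "hom_boundary (int (Suc p)) X S
      \<in> iso (relative_homology_group (int (Suc p)) X S) (homology_group (int p) (subtopology X S))"
    using iso_relative_homology_of_contractible[OF assms(1,2), of "int (Suc p)"] assms(3)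
    by (simp add: un_reduced_homology_group)
  from infinite_cyclic_generator_iso_iff[OF this _ _ homology_class_carrier[OF assms(4)]]
  show ?thesis
    using hom_boundary_chain_boundary[OF assms(4)] bc assms(4)
    by (simp add: generates_def)
qed

text \<open>The reduced homology of \<open>S\<close> vanishes, and in positive degree reduced and
  ordinary homology coincide. A relative generator that happens to be an absolute cycle is thus an
  absolute generator.\<close>

lemma generates_relative_to_contractible_iff:
  assumes "contractible_space (subtopology X S)" "topspace X \<inter> S \<noteq> {}" "0 < p" "singular_relcycle p X {} c"
  shows "generates p X S c \<longleftrightarrow> generates p X {} c"
proof -
  have "hom_induced p X {} X S id \<in> iso (homology_group p X) (relative_homology_group p X S)"
    using iso_reduced_homology_by_contractible[OF assms(1,2), of p] assms(3)
    by (simp add: un_reduced_homology_group)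
  moreover have "chain_map p id c = c"
    using assms(4) by (auto simp: singular_relcycle intro: chain_map_ident)
  ultimately show ?thesis
    using generates_hom_induced_iso[of X X id "{}" S p c] assms(4) by simp
qed

lemma trivial_homology_boundary:
  assumes "trivial_group (homology_group (int p) X)" "singular_relcycle p X {} c"
  obtains d where "singular_chain (Suc p) X d" "chain_boundary (Suc p) d = c"
proof -
  have "homologous_rel_set p X {} c = singular_relboundary_set p X {}"
    using homology_class_carrier[OF assms(2)] assms(1) by (auto simp: trivial_group_def)
  then have "singular_relboundary p X {} c"
    using homologous_rel_set_eq_relboundary by blast
  then show ?thesis using that by (auto simp: singular_boundary)
qed

section \<open>Punctured Euclidean spaces\<close>

lemma top_of_set_powertop: "subtopology (powertop_real UNIV) S = top_of_set S"
  by (simp add: euclidean_product_topology)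

lemma continuous_on_coordinatewise_iff:
  fixes f :: "'a::topological_space \<Rightarrow> nat \<Rightarrow> real"
  shows "continuous_on S f \<longleftrightarrow> (\<forall>i. continuous_on S (\<lambda>x. f x i))"
  by (auto intro: continuous_on_coordinatewise_then_product continuous_on_product_then_coordinatewise)

lemma continuous_on_if_const [continuous_intros]:
  "\<lbrakk>b \<Longrightarrow> continuous_on S f; \<not> b \<Longrightarrow> continuous_on S g\<rbrakk>
    \<Longrightarrow> continuous_on S (\<lambda>x. if b then f x else g x)"
  by (cases b) simp_all

text \<open>A homotopy of pairs: \<open>A\<close> has to stay in \<open>V\<close> throughout. Taking
  both sets empty gives the absolute case, whence the condition with two empty sets in later
  applications.\<close>

lemma homotopic_with_linear:
  fixes f g :: "'a::topological_space \<Rightarrow> nat \<Rightarrow> real"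
  assumes "continuous_on S f" "continuous_on S g"
    and "\<And>x t. \<lbrakk>x \<in> S; 0 \<le> t; t \<le> 1\<rbrakk> \<Longrightarrow> (\<lambda>i. (1 - t) * f x i + t * g x i) \<in> U"
    and "\<And>x t. \<lbrakk>x \<in> A; 0 \<le> t; t \<le> 1\<rbrakk> \<Longrightarrow> (\<lambda>i. (1 - t) * f x i + t * g x i) \<in> V"
  shows "homotopic_with (\<lambda>h. h \<in> A \<rightarrow> V) (top_of_set S) (top_of_set U) f g"
proof -
  define h where "h = (\<lambda>(t::real, x). (\<lambda>i. (1 - t) * f x i + t * g x i))"
  have f: "continuous_on S (\<lambda>x. f x i)" and g: "continuous_on S (\<lambda>x. g x i)" for i
    using assms(1,2) continuous_on_coordinatewise_iff by auto
  have "continuous_on ({0..1} \<times> S) h"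
    unfolding continuous_on_coordinatewise_iff h_def case_prod_unfold
    by (intro allI continuous_intros continuous_on_compose2[OF f] continuous_on_compose2[OF g]) auto
  moreover have "h ` ({0..1} \<times> S) \<subseteq> U"
    using assms(3) by (auto simp: h_def)
  ultimately have "continuous_map (prod_topology (top_of_set {0..1}) (top_of_set S)) (top_of_set U) h"
    by (simp add: prod_topology_subtopology_eu image_subset_iff_funcset)
  then show ?thesis
    unfolding homotopic_with_def
    by (intro exI[of _ h] conjI) (auto simp: h_def assms(4))
qed

lemma contractible_space_starlike:
  fixes a :: "nat \<Rightarrow> real"
  assumes "\<And>x t. \<lbrakk>x \<in> S; 0 \<le> t; t \<le> 1\<rbrakk> \<Longrightarrow> (\<lambda>i. (1 - t) * x i + t * a i) \<in> S"
  shows "contractible_space (top_of_set S)"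
proof -
  have "homotopic_with (\<lambda>h. h \<in> {} \<rightarrow> {}) (top_of_set S) (top_of_set S) id (\<lambda>x. a)"
    by (rule homotopic_with_linear) (use assms in auto)
  then show ?thesis
    unfolding contractible_space_def by (auto simp: Pi_def)
qed

text \<open>The excised set is \<open>S - A\<close>. The closed set \<open>C\<close> squeezed
  between it and the open set \<open>T\<close> provides the closure condition of the excision
  axiom.\<close>

lemma excision_top_of_set:
  assumes "A \<subseteq> S" "openin (top_of_set S) T" "S - A \<subseteq> C" "closedin (top_of_set S) C" "C \<subseteq> T"
  shows "hom_induced p (top_of_set A) (A \<inter> T) (top_of_set S) T id
    \<in> iso (relative_homology_group p (top_of_set A) (A \<inter> T)) (relative_homology_group p (top_of_set S) T)"
proof -
  have TS: "T \<subseteq> S" using assms(2) openin_imp_subset by blast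
  have "top_of_set S closure_of (S - A) \<subseteq> C"
    using assms(3,4) by (rule closure_of_minimal)
  then have "top_of_set S closure_of (S - A) \<subseteq> top_of_set S interior_of T"
    using assms(2,5) by (simp add: interior_of_openin)
  from homology_excision_axiom[OF this TS]
  have "hom_induced p (subtopology (top_of_set S) (S - (S - A))) (T - (S - A)) (subtopology (top_of_set S) S) T id
    \<in> iso (relative_homology_group p (subtopology (top_of_set S) (S - (S - A))) (T - (S - A)))
       (relative_homology_group p (subtopology (top_of_set S) S) T)" .
  moreover have "S - (S - A) = A" "T - (S - A) = A \<inter> T" using assms(1) TS by auto
  ultimately show ?thesis
    using assms(1) by (simp add: subtopology_subtopology inf.absorb2)
qed

lemma generates_excision_iff:
  assumes "A \<subseteq> S" "openin (top_of_set S) T" "S - A \<subseteq> C" "closedin (top_of_set S) C" "C \<subseteq> T"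
    and "singular_relcycle p (top_of_set A) (A \<inter> T) c"
  shows "generates p (top_of_set S) T c \<longleftrightarrow> generates p (top_of_set A) (A \<inter> T) c"
proof -
  have sub: "subtopology (top_of_set S) A = top_of_set A"
    using assms(1) by (simp add: subtopology_subtopology inf.absorb2)
  show ?thesis
    using generates_subspace_iso[of p "top_of_set S" A "A \<inter> T" T c]
      excision_top_of_set[OF assms(1-5), of "int p"] assms(6) by (simp add: sub)
qed

text \<open>R^n is placed inside the space of all sequences so that standard simplices and spheres
  are literally subsets of it; the standard p-simplex lies in
  \<open>vectors (Suc p)\<close>.\<close>

definition vectors :: "nat \<Rightarrow> (nat \<Rightarrow> real) set"
  where "vectors n = {v. \<forall>i\<ge>n. v i = 0}"

definition nonzero_vectors :: "nat \<Rightarrow> (nat \<Rightarrow> real) set"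
  where "nonzero_vectors n = {v \<in> vectors n. \<exists>i<n. v i \<noteq> 0}"

definition diag_vector :: "nat \<Rightarrow> real \<Rightarrow> nat \<Rightarrow> real"
  where "diag_vector n c = (\<lambda>i. if i < n then c else 0)"

text \<open>Together with \<open>off_negative_diag\<close> this plays the role of two hemispheres:
  each set is starlike, for positive \<open>n\<close> they cover the punctured space, and they
  intersect in the complement of the diagonal line. The diagonal is chosen because the standard
  simplex meets it only in its barycenter.\<close>

definition off_positive_diag :: "nat \<Rightarrow> (nat \<Rightarrow> real) set"
  where "off_positive_diag n = vectors n - diag_vector n ` {0..}"

definition off_negative_diag :: "nat \<Rightarrow> (nat \<Rightarrow> real) set"
  where "off_negative_diag n = vectors n - diag_vector n ` {..0}"

lemma nonzero_vectors_eq: "nonzero_vectors n = vectors n - {\<lambda>_. 0}"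
proof -
  have "(\<exists>i<n. v i \<noteq> 0) \<longleftrightarrow> v \<noteq> (\<lambda>_. 0)" if "v \<in> vectors n" for v
    using that by (auto simp: vectors_def fun_eq_iff) (metis not_le)
  then show ?thesis by (auto simp: nonzero_vectors_def)
qed

lemma diag_vector_eq_iff: "v \<in> vectors n \<Longrightarrow> v = diag_vector n c \<longleftrightarrow> (\<forall>i<n. v i = c)"
  by (auto simp: diag_vector_def vectors_def fun_eq_iff not_less)

lemma in_off_positive_diag:
  "v \<in> off_positive_diag n \<longleftrightarrow> v \<in> vectors n \<and> (\<forall>c\<ge>0. \<exists>i<n. v i \<noteq> c)"
  using diag_vector_eq_iff[of v n] unfolding off_positive_diag_def by blast

lemma in_off_negative_diag:
  "v \<in> off_negative_diag n \<longleftrightarrow> v \<in> vectors n \<and> (\<forall>c\<le>0. \<exists>i<n. v i \<noteq> c)"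
  using diag_vector_eq_iff[of v n] unfolding off_negative_diag_def by blast

lemma off_diag_subset:
  "off_positive_diag n \<subseteq> nonzero_vectors n" "off_negative_diag n \<subseteq> nonzero_vectors n"
  unfolding subset_iff in_off_positive_diag in_off_negative_diag nonzero_vectors_def by blast+

lemma nonzero_vectors_union_off_diag:
  assumes "0 < n"
  shows "off_positive_diag n \<union> off_negative_diag n = nonzero_vectors n"
proof
  show "nonzero_vectors n \<subseteq> off_positive_diag n \<union> off_negative_diag n"
  proof
    fix v assume v: "v \<in> nonzero_vectors n"
    show "v \<in> off_positive_diag n \<union> off_negative_diag n"
    proof (rule ccontr)
      assume neg: "\<not> ?thesis"
      from v have "v \<in> vectors n" by (simp add: nonzero_vectors_def)
      with neg obtain c where c: "c \<ge> 0" "\<And>i. i < n \<Longrightarrow> v i = c"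
        unfolding Un_iff in_off_positive_diag by blast
      from neg \<open>v \<in> vectors n\<close> obtain d where d: "d \<le> 0" "\<And>i. i < n \<Longrightarrow> v i = d"
        unfolding Un_iff in_off_negative_diag by blast
      have "v i = 0" if "i < n" for i
        using c(1) c(2)[OF that] d(1) d(2)[OF that] by linarith
      then show False using v unfolding nonzero_vectors_def by blast
    qed
  qed
qed (use off_diag_subset in simp)

lemma continuous_on_coordinate [continuous_intros]: "continuous_on S (\<lambda>x::nat \<Rightarrow> real. x i)"
  using continuous_on_product_then_coordinatewise[OF continuous_on_id] .

lemma closed_vectors: "closed (vectors n)"
proof -
  have "vectors n = (\<Inter>i\<in>{n..}. {v. v i = 0})"
    by (auto simp: vectors_def)
  moreover have "closed {v::nat \<Rightarrow> real. v i = 0}" for i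
    by (rule closed_Collect_eq) (intro continuous_intros)+
  ultimately show ?thesis by auto
qed

lemma closed_diag_ray:
  assumes "0 < n" "closed R"
  shows "closed (diag_vector n ` R)"
proof -
  have "diag_vector n ` R = vectors n \<inter> (\<Inter>i\<in>{..<n}. {v. v i = v 0}) \<inter> {v. v 0 \<in> R}"
  proof (intro equalityI subsetI)
    fix v assume v: "v \<in> vectors n \<inter> (\<Inter>i\<in>{..<n}. {v. v i = v 0}) \<inter> {v. v 0 \<in> R}"
    then have "v \<in> vectors n" "\<And>i. i < n \<Longrightarrow> v i = v 0" by blast+
    then have "v = diag_vector n (v 0)" using diag_vector_eq_iff by blast
    then show "v \<in> diag_vector n ` R" using v by blast
  next
    fix v assume "v \<in> diag_vector n ` R"
    then show "v \<in> vectors n \<inter> (\<Inter>i\<in>{..<n}. {v. v i = v 0}) \<inter> {v. v 0 \<in> R}"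
      using assms(1) by (auto simp: diag_vector_def vectors_def)
  qed
  moreover have "closed ((\<lambda>v::nat\<Rightarrow>real. v 0) -` R)"
    by (rule closed_vimage[OF assms(2)]) (intro continuous_intros)
  moreover have "closed {v::nat \<Rightarrow> real. v i = v 0}" for i
    by (rule closed_Collect_eq) (intro continuous_intros)+
  ultimately show ?thesis
    using closed_vectors by (simp add: closed_Int closed_INT vimage_def)
qed

lemma contractible_vectors: "contractible_space (top_of_set (vectors n))"
  by (rule contractible_space_starlike[where a = "\<lambda>_. 0"]) (auto simp: vectors_def)

lemma contractible_off_positive_diag: "contractible_space (top_of_set (off_positive_diag n))"
proof (rule contractible_space_starlike[where a = "diag_vector n (-1)"])
  fix x and t :: real assume x: "x \<in> off_positive_diag n" and t: "0 \<le> t" "t \<le> 1"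
  have "\<exists>i<n. (1 - t) * x i + t * diag_vector n (-1) i \<noteq> c" if "c \<ge> 0" for c
  proof (cases "t = 1")
    case True
    have "0 < n" using x by (auto simp: in_off_positive_diag)
    then show ?thesis using True that by (intro exI[of _ 0]) (auto simp: diag_vector_def)
  next
    case False
    then have "(c + t) / (1 - t) \<ge> 0" using t that by auto
    then obtain i where i: "i < n" "x i \<noteq> (c + t) / (1 - t)"
      using x unfolding in_off_positive_diag by blast
    then show ?thesis using False
      by (intro exI[of _ i]) (auto simp: diag_vector_def field_simps)
  qed
  then show "(\<lambda>i. (1 - t) * x i + t * diag_vector n (-1) i) \<in> off_positive_diag n"
    using x by (auto simp: in_off_positive_diag vectors_def diag_vector_def)
qed

lemma contractible_off_negative_diag: "contractible_space (top_of_set (off_negative_diag n))"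
proof (rule contractible_space_starlike[where a = "diag_vector n 1"])
  fix x and t :: real assume x: "x \<in> off_negative_diag n" and t: "0 \<le> t" "t \<le> 1"
  have "\<exists>i<n. (1 - t) * x i + t * diag_vector n 1 i \<noteq> c" if "c \<le> 0" for c
  proof (cases "t = 1")
    case True
    have "0 < n" using x by (auto simp: in_off_negative_diag)
    then show ?thesis using True that by (intro exI[of _ 0]) (auto simp: diag_vector_def)
  next
    case False
    then have "(c - t) / (1 - t) \<le> 0" using t that by (auto simp: divide_le_0_iff)
    then obtain i where i: "i < n" "x i \<noteq> (c - t) / (1 - t)"
      using x unfolding in_off_negative_diag by blast
    then show ?thesis using False
      by (intro exI[of _ i]) (auto simp: diag_vector_def field_simps)
  qed
  then show "(\<lambda>i. (1 - t) * x i + t * diag_vector n 1 i) \<in> off_negative_diag n"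
    using x by (auto simp: in_off_negative_diag vectors_def diag_vector_def)
qed

text \<open>The quotient map of R^(k+1) by its diagonal, in coordinates. On the standard k-simplex
  it is an affine embedding into R^k which puts the barycenter at the origin.\<close>

definition edge_differences :: "nat \<Rightarrow> (nat \<Rightarrow> real) \<Rightarrow> nat \<Rightarrow> real"
  where "edge_differences k x = (\<lambda>i. if i < k then x (Suc i) - x 0 else 0)"

text \<open>Excising the open negative ray reduces the punctured space to
  \<open>off_negative_diag\<close>. There the projection along the diagonal is a homotopy
  equivalence of pairs onto R^k and its punctured subspace.\<close>

lemma generates_off_diag_iff:
  assumes "singular_relcycle p (top_of_set (off_negative_diag (Suc k)))
      (off_negative_diag (Suc k) \<inter> off_positive_diag (Suc k)) c"
  shows "generates p (top_of_set (nonzero_vectors (Suc k))) (off_positive_diag (Suc k)) c \<longleftrightarrow>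
    generates p (top_of_set (vectors k)) (nonzero_vectors k) (chain_map p (edge_differences k) c)"
proof -
  let ?V = "off_negative_diag (Suc k)" and ?W = "off_positive_diag (Suc k)"
  let ?E = "nonzero_vectors (Suc k)"
  have un: "?W \<union> ?V = ?E" by (rule nonzero_vectors_union_off_diag) simp
  have opn: "openin (top_of_set ?E) ?W"
  proof -
    have "?W = ?E \<inter> - diag_vector (Suc k) ` {0..}"
      using off_diag_subset by (auto simp: off_positive_diag_def nonzero_vectors_def)
    then show ?thesis by (metis closed_diag_ray closed_atLeast open_Compl openin_open zero_less_Suc)
  qed
  have cl: "closedin (top_of_set ?E) (?E - ?V)"
  proof -
    have "?E - ?V = ?E \<inter> diag_vector (Suc k) ` {..0}"
      using off_diag_subset by (auto simp: off_negative_diag_def nonzero_vectors_def)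
    then show ?thesis by (metis closed_diag_ray closed_atMost closedin_closed zero_less_Suc)
  qed
  have 1: "generates p (top_of_set ?E) ?W c \<longleftrightarrow> generates p (top_of_set ?V) (?V \<inter> ?W) c"
    using generates_excision_iff[OF _ opn _ cl _ assms] un by auto
  \<comment> \<open>A section of the projection. The first coordinate 1 keeps its values away from
    the ray of nonpositive multiples of the diagonal.\<close>
  define s where "s = (\<lambda>w::nat\<Rightarrow>real. \<lambda>i. if i = 0 then 1 else if i \<le> k then w (i - 1) + 1 else 0)"
  have c1: "continuous_on ?V (edge_differences k)"
    unfolding continuous_on_coordinatewise_iff edge_differences_def
    by (auto intro!: continuous_intros)
  have c2: "continuous_on (vectors k) s"
    unfolding continuous_on_coordinatewise_iff s_def
    by (auto intro!: continuous_intros)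
  have diagV: "v \<in> ?V \<inter> ?W \<longleftrightarrow> edge_differences k v \<in> nonzero_vectors k" if v: "v \<in> vectors (Suc k)" for v
  proof
    assume "v \<in> ?V \<inter> ?W"
    then have "\<forall>c. \<exists>i<Suc k. v i \<noteq> c"
      by (auto simp: in_off_negative_diag in_off_positive_diag) (meson nle_le)
    then obtain i where i: "i < Suc k" "v i \<noteq> v 0" by blast
    then obtain j where "i = Suc j" by (cases i) auto
    with i show "edge_differences k v \<in> nonzero_vectors k"
      by (auto simp: edge_differences_def nonzero_vectors_def vectors_def intro!: exI[of _ j])
  next
    assume "edge_differences k v \<in> nonzero_vectors k"
    then obtain i where "i < k" "v (Suc i) \<noteq> v 0"
      by (auto simp: edge_differences_def nonzero_vectors_def)
    then show "v \<in> ?V \<inter> ?W"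
      using v by (auto simp: in_off_negative_diag in_off_positive_diag; metis Suc_mono zero_less_Suc)
  qed
  have Vsub: "?V \<subseteq> vectors (Suc k)" by (auto simp: in_off_negative_diag)
  have sw: "s w \<in> vectors (Suc k)" "edge_differences k (s w) = w" if "w \<in> vectors k" for w
    using that by (auto simp: s_def vectors_def edge_differences_def fun_eq_iff)
  have sV: "s w \<in> ?V" if "w \<in> vectors k" for w
    using sw[OF that] by (auto simp: in_off_negative_diag s_def intro!: exI[of _ 0])
  have fV: "edge_differences k v \<in> vectors k" for v
    by (simp add: edge_differences_def vectors_def)
  have fVW: "edge_differences k v \<in> nonzero_vectors k" if "v \<in> ?V \<and> v \<in> ?W" for v
    using diagV[of v] that Vsub by blast
  have sNZ: "s w \<in> ?V \<and> s w \<in> ?W" if "w \<in> nonzero_vectors k" for w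
    using diagV[OF sw(1)[of w]] sw(2)[of w] that by (simp add: nonzero_vectors_def)
  have homV: "homotopic_with (\<lambda>h. h \<in> (?V \<inter> ?W) \<rightarrow> (?V \<inter> ?W)) (top_of_set ?V) (top_of_set ?V)
     (s \<circ> edge_differences k) id"
  proof (rule homotopic_with_linear)
    show "continuous_on ?V (s \<circ> edge_differences k)"
      by (rule continuous_on_compose[OF c1 continuous_on_subset[OF c2]])
        (auto simp: edge_differences_def vectors_def)
    fix x and t :: real assume t: "0 \<le> t" "t \<le> 1"
    let ?y = "\<lambda>i. (1 - t) * (s \<circ> edge_differences k) x i + t * id x i"
    \<comment> \<open>Points move parallel to the diagonal only, so coordinate differences, and with
      them membership in the complement of the diagonal, stay the same.\<close>
    have y: "?y i = x i + (1 - t) * (1 - x 0)" if "i < Suc k" for i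
      using that by (cases i) (auto simp: s_def edge_differences_def algebra_simps)
    have *: "?y \<in> vectors (Suc k)" if "x \<in> vectors (Suc k)"
      using that by (auto simp: vectors_def s_def)
    have d: "edge_differences k ?y = edge_differences k x"
      using y by (auto simp: edge_differences_def)
    show VW: "?y \<in> ?V \<inter> ?W" if "x \<in> ?V \<inter> ?W"
      using diagV[of x] diagV[OF *] that Vsub d by auto
    show "?y \<in> ?V" if x: "x \<in> ?V"
    proof (cases "x \<in> ?W")
      case True then show ?thesis using VW that by blast
    next
      case False
      \<comment> \<open>The remaining points lie on the positive half of the diagonal and slide
        along that half.\<close>
      then obtain c where c: "c \<ge> 0" "\<forall>i<Suc k. x i = c" using x Vsub by (auto simp: in_off_positive_diag)
      have "c > 0" using x c by (auto simp: in_off_negative_diag; metis le_less_linear)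
      have "?y 0 = x 0 + (1 - t) * (1 - x 0)" by (rule y) simp
      also have "\<dots> = t * c + (1 - t)" using c(2) by (simp add: algebra_simps)
      also have "\<dots> > 0"
        using \<open>c > 0\<close> t by (cases "t = 0") (auto intro: add_pos_nonneg)
      finally have "?y 0 > 0" .
      then show ?thesis using * x Vsub by (auto simp: in_off_negative_diag intro!: exI[of _ 0])
    qed
  qed auto
  have homE: "homotopic_with (\<lambda>h. h \<in> nonzero_vectors k \<rightarrow> nonzero_vectors k) (top_of_set (vectors k)) (top_of_set (vectors k))
     (edge_differences k \<circ> s) id"
  proof (rule homotopic_with_equal)
    show "continuous_map (top_of_set (vectors k)) (top_of_set (vectors k)) (edge_differences k \<circ> s)"
      using sw(2) by (auto intro: continuous_on_eq[OF continuous_on_id])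
  qed (use sw(2) in \<open>auto simp: nonzero_vectors_def\<close>)
  have "hom_induced (int p) (top_of_set ?V) (?V \<inter> ?W) (top_of_set (vectors k)) (nonzero_vectors k) (edge_differences k)
    \<in> iso (relative_homology_group p (top_of_set ?V) (?V \<inter> ?W))
        (relative_homology_group p (top_of_set (vectors k)) (nonzero_vectors k))"
    by (rule homotopy_equivalence_relative_homology_group_isomorphism[where g = s])
      (use c1 c2 sV fV homV homE fVW sNZ in \<open>simp_all add: Pi_def\<close>)
  then have 2: "generates p (top_of_set (vectors k)) (nonzero_vectors k) (chain_map p (edge_differences k) c)
     \<longleftrightarrow> generates p (top_of_set ?V) (?V \<inter> ?W) c"
    by (rule generates_hom_induced_iso[rotated 2])
      (use c1 assms fV fVW in \<open>simp_all add: Pi_def\<close>)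
  show ?thesis using 1 2 by simp
qed

section \<open>Explicit generators for the homology of punctured Euclidean spaces\<close>

definition simplex_boundary :: "nat \<Rightarrow> (nat \<Rightarrow> real) set"
  where "simplex_boundary p = {x \<in> standard_simplex p. \<exists>i\<le>p. x i = 0}"

lemma standard_simplexD:
  assumes "x \<in> standard_simplex p"
  shows "0 \<le> x i" "x i \<le> 1" "(\<Sum>i\<le>p. x i) = 1" "x \<in> vectors (Suc p)"
  using assms by (auto simp: standard_simplex_def vectors_def)

lemma standard_simplex_not_zero:
  assumes "x \<in> standard_simplex p"
  shows "\<exists>i\<le>p. 0 < x i"
proof (rule ccontr)
  assume "\<not> ?thesis"
  then have "(\<Sum>i\<le>p. x i) \<le> 0" by (intro sum_nonpos) (auto simp: not_less)
  then show False using standard_simplexD(3)[OF assms] by simp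
qed

lemma simplical_face_in_simplex_boundary:
  assumes "0 < p" "k \<le> p" "x \<in> standard_simplex (p - 1)"
  shows "simplical_face k x \<in> simplex_boundary p"
  using simplical_face_in_standard_simplex[of p k x] assms
  by (auto simp: simplex_boundary_def simplical_face_def)

lemma singular_simplex_restrictI:
  assumes "continuous_on (standard_simplex p) f" "\<And>x. x \<in> standard_simplex p \<Longrightarrow> f x \<in> S"
  shows "singular_simplex p (top_of_set S) (restrict f (standard_simplex p))"
  unfolding singular_simplex_def top_of_set_powertop
  using assms by (auto intro: continuous_on_eq)

lemma singular_simplex_top_of_set:
  "singular_simplex p (top_of_set S) f \<longleftrightarrow>
    continuous_on (standard_simplex p) f \<and> (\<forall>x\<in>standard_simplex p. f x \<in> S) \<and> f \<in> extensional (standard_simplex p)"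
  unfolding singular_simplex_def top_of_set_powertop by auto

lemma singular_relcycle_frag_of:
  assumes "singular_simplex p X f" "\<And>x. x \<in> simplex_boundary p \<Longrightarrow> f x \<in> S"
  shows "singular_relcycle p X S (frag_of f)"
proof -
  have "singular_chain (p - 1) (subtopology X S) (chain_boundary p (frag_of f))"
  proof (cases "p = 0")
    case False
    have "singular_simplex (p - 1) (subtopology X S) (singular_face p k f)" if "k \<le> p" for k
      using singular_simplex_singular_face[OF assms(1)] assms(2) False that
        simplical_face_in_simplex_boundary[of p k]
      by (auto simp: singular_simplex_subtopology singular_face_def)
    then show ?thesis
      by (auto simp: chain_boundary_of False intro!: singular_chain_sum singular_chain_cmul simp: singular_chain_of)
  qed (simp add: chain_boundary_def)
  then show ?thesis
    using assms(1) by (simp add: singular_relcycle singular_chain_of)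
qed

lemma chain_boundary_frag_of_cong:
  assumes "\<And>x. x \<in> simplex_boundary p \<Longrightarrow> f x = g x"
  shows "chain_boundary p (frag_of f) = chain_boundary p (frag_of g)"
proof (cases "p = 0")
  case False
  have "singular_face p k f = singular_face p k g" if "k \<le> p" for k
    using simplical_face_in_simplex_boundary[of p k] that False assms
    by (auto simp: singular_face_def fun_eq_iff restrict_def)
  then show ?thesis using False by (simp add: chain_boundary_of)
qed (simp add: chain_boundary_def)

lemma simplex_map_restrict:
  "simplex_map p f (restrict g (standard_simplex p)) = restrict (f \<circ> g) (standard_simplex p)"
  by (auto simp: simplex_map_def fun_eq_iff)

lemma simplex_off_diag:
  assumes "x \<in> standard_simplex p"
  shows "x \<in> off_negative_diag (Suc p)" "x \<in> simplex_boundary p \<Longrightarrow> x \<in> off_positive_diag (Suc p)"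
proof -
  obtain i where i: "i \<le> p" "0 < x i" using standard_simplex_not_zero assms by blast
  then have "\<exists>i<Suc p. x i \<noteq> c" if "c \<le> 0" for c
    using that by (intro exI[of _ i]) auto
  then show "x \<in> off_negative_diag (Suc p)"
    using standard_simplexD(4)[OF assms] by (simp add: in_off_negative_diag)
  assume "x \<in> simplex_boundary p"
  then obtain j where "j \<le> p" "x j = 0" by (auto simp: simplex_boundary_def)
  then have "\<exists>i<Suc p. x i \<noteq> c" for c using i by (metis le_imp_less_Suc less_irrefl)
  then show "x \<in> off_positive_diag (Suc p)"
    using standard_simplexD(4)[OF assms] by (simp add: in_off_positive_diag)
qed

definition inclusion_simplex :: "nat \<Rightarrow> (nat \<Rightarrow> real) \<Rightarrow> nat \<Rightarrow> real"
  where "inclusion_simplex p = restrict id (standard_simplex p)"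

lemma edge_differences_simplex_boundary:
  assumes "x \<in> simplex_boundary p"
  shows "edge_differences p x \<in> nonzero_vectors p"
proof -
  have x: "x \<in> standard_simplex p" using assms by (simp add: simplex_boundary_def)
  obtain j where j: "j \<le> p" "x j = 0" using assms by (auto simp: simplex_boundary_def)
  have "\<exists>i<p. x (Suc i) \<noteq> x 0"
  proof (rule ccontr)
    assume "\<not> ?thesis"
    then have *: "x i = x 0" if "i \<le> p" for i
      using that by (cases i) auto
    have "x i = 0" if "i \<le> p" for i
      using *[OF that] *[OF j(1)] j(2) by simp
    then show False using standard_simplex_not_zero[OF x] by auto
  qed
  then show ?thesis by (auto simp: edge_differences_def nonzero_vectors_def vectors_def)
qed

lemma continuous_on_edge_differences: "continuous_on S (edge_differences k)"
  unfolding continuous_on_coordinatewise_iff edge_differences_def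
  by (auto intro!: continuous_intros)

lemma singular_simplex_edge_differences:
  "singular_simplex p (top_of_set (vectors p)) (simplex_map p (edge_differences p) (inclusion_simplex p))"
  unfolding inclusion_simplex_def simplex_map_restrict
  by (rule singular_simplex_restrictI)
    (auto simp: edge_differences_def vectors_def intro: continuous_on_edge_differences[unfolded edge_differences_def])

lemma generates_inclusion_simplex_if_edge_differences:
  assumes "generates p (top_of_set (vectors p)) (nonzero_vectors p)
    (frag_of (simplex_map p (edge_differences p) (inclusion_simplex p)))"
  shows "generates p (top_of_set (nonzero_vectors (Suc p))) (off_positive_diag (Suc p)) (frag_of (inclusion_simplex p))"
proof (subst generates_off_diag_iff)
  show "singular_relcycle p (top_of_set (off_negative_diag (Suc p)))
     (off_negative_diag (Suc p) \<inter> off_positive_diag (Suc p)) (frag_of (inclusion_simplex p))"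
  proof (rule singular_relcycle_frag_of)
    show "singular_simplex p (top_of_set (off_negative_diag (Suc p))) (inclusion_simplex p)"
      unfolding inclusion_simplex_def using simplex_off_diag(1)
      by (auto intro!: singular_simplex_restrictI)
  qed (use simplex_off_diag in \<open>auto simp: inclusion_simplex_def simplex_boundary_def\<close>)
qed (use assms in simp)

text \<open>Face 0 of the simplex of edge differences is the inclusion simplex of one dimension
  less, and all other faces miss the positive diagonal ray. So its boundary is homologous to the
  inclusion simplex modulo \<open>off_positive_diag\<close>, and the connecting map of a triple
  concludes.\<close>

lemma generates_edge_differences_Suc:
  assumes "generates p (top_of_set (nonzero_vectors (Suc p))) (off_positive_diag (Suc p)) (frag_of (inclusion_simplex p))"
  shows "generates (Suc p) (top_of_set (vectors (Suc p))) (nonzero_vectors (Suc p))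
    (frag_of (simplex_map (Suc p) (edge_differences (Suc p)) (inclusion_simplex (Suc p))))"
proof -
  let ?E = "vectors (Suc p)" and ?N = "nonzero_vectors (Suc p)" and ?W = "off_positive_diag (Suc p)"
  define \<tau> where "\<tau> = simplex_map (Suc p) (edge_differences (Suc p)) (inclusion_simplex (Suc p))"
  have \<tau>: "singular_simplex (Suc p) (top_of_set ?E) \<tau>"
    unfolding \<tau>_def by (rule singular_simplex_edge_differences)
  have \<tau>_eq: "\<tau> x = edge_differences (Suc p) x" if "x \<in> standard_simplex (Suc p)" for x
    using that by (simp add: \<tau>_def simplex_map_def inclusion_simplex_def)
  have cyc: "singular_relcycle (Suc p) (top_of_set ?E) ?N (frag_of \<tau>)"
    using singular_relcycle_frag_of[OF \<tau>] edge_differences_simplex_boundary[of _ "Suc p"] \<tau>_eq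
    by (auto simp: simplex_boundary_def)
  have sub: "subtopology (top_of_set ?E) ?N = top_of_set ?N" "subtopology (top_of_set ?E) ?W = top_of_set ?W"
    using off_diag_subset by (auto simp: subtopology_subtopology nonzero_vectors_def off_positive_diag_def inf.absorb2)
  have sub': "subtopology (top_of_set ?N) ?W = top_of_set ?W"
    using off_diag_subset by (auto simp: subtopology_subtopology inf.absorb2)
  \<comment> \<open>On face 0 the coordinate with index 0 vanishes, so the differences are the other
    coordinates themselves.\<close>
  have face0: "singular_face (Suc p) 0 \<tau> = inclusion_simplex p"
  proof
    fix x show "singular_face (Suc p) 0 \<tau> x = inclusion_simplex p x"
    proof (cases "x \<in> standard_simplex p")
      case True
      then have "simplical_face 0 x \<in> standard_simplex (Suc p)"
        using simplical_face_in_standard_simplex[of "Suc p" 0 x] by simp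
      then show ?thesis
        using True standard_simplexD(4)[OF True]
        by (auto simp: singular_face_def \<tau>_eq inclusion_simplex_def edge_differences_def simplical_face_def vectors_def)
    qed (simp add: singular_face_def inclusion_simplex_def)
  qed
  have facek: "singular_simplex p (top_of_set ?W) (singular_face (Suc p) k \<tau>)" if k: "k \<le> Suc p" "k \<noteq> 0" for k
  proof -
    have "edge_differences (Suc p) (simplical_face k x) \<in> ?W" if x: "x \<in> standard_simplex p" for x
    proof -
      let ?y = "simplical_face k x"
      have y: "?y \<in> standard_simplex (Suc p)"
        using simplical_face_in_standard_simplex[of "Suc p" k x] x k by simp
      have yk: "?y k = 0" by (simp add: simplical_face_def)
      have "\<exists>i<Suc p. ?y (Suc i) - ?y 0 \<noteq> c" if "c \<ge> 0" for c
      proof (rule ccontr)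
        assume "\<not> ?thesis"
        then have *: "?y (Suc i) = c + ?y 0" if "i < Suc p" for i using that by (simp add: algebra_simps)
        \<comment> \<open>Coordinate \<open>k\<close> vanishes on face \<open>k\<close>. Being the
          sum of the nonnegative numbers \<open>c\<close> and \<open>?y 0\<close>, it forces both to
          be 0, and then every coordinate is 0.\<close>
        have "c + ?y 0 = 0" using *[of "k - 1"] k yk by simp
        then have "?y 0 = 0" "c = 0" using standard_simplexD(1)[OF y, of 0] that by auto
        then have "?y i = 0" if "i \<le> Suc p" for i using * that by (cases i) auto
        then show False using standard_simplex_not_zero[OF y] by auto
      qed
      then show ?thesis
        unfolding in_off_positive_diag by (auto simp: edge_differences_def vectors_def)
    qed
    moreover have "singular_simplex p (top_of_set ?E) (singular_face (Suc p) k \<tau>)"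
      using singular_simplex_singular_face[OF \<tau>] k by simp
    moreover have "singular_face (Suc p) k \<tau> ` standard_simplex p \<subseteq> ?W"
      using calculation(1) \<tau>_eq simplical_face_in_standard_simplex[of "Suc p" k] k
      by (auto simp: singular_face_def)
    ultimately show ?thesis
      by (metis singular_simplex_subtopology sub(2))
  qed
  define r where "r = (\<Sum>k\<in>{1..Suc p}. frag_cmul ((-1)^k) (frag_of (singular_face (Suc p) k \<tau>)))"
  have bd: "chain_boundary (Suc p) (frag_of \<tau>) = frag_of (inclusion_simplex p) + r"
    unfolding chain_boundary_of r_def
    by (simp add: atMost_atLeast0 sum.atLeast_Suc_atMost[of 0 "Suc p"] face0 del: sum.cl_ivl_Suc)
  have "singular_chain p (top_of_set ?W) r"
    unfolding r_def by (intro singular_chain_sum singular_chain_cmul) (use facek in \<open>auto simp: singular_chain_of\<close>)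
  then have "homologous_rel p (top_of_set ?N) ?W (frag_of (inclusion_simplex p)) (chain_boundary (Suc p) (frag_of \<tau>))"
    unfolding bd homologous_rel_def by (simp add: singular_relboundary_minus singular_chain_imp_relboundary sub')
  with assms have g: "generates p (top_of_set ?N) ?W (chain_boundary (Suc p) (frag_of \<tau>))"
    by (rule generates_homologous)
  have "diag_vector (Suc p) (-1) \<in> ?W"
    by (auto simp: in_off_positive_diag diag_vector_def vectors_def)
  moreover have WE: "?W \<subseteq> ?E" by (auto simp: off_positive_diag_def)
  ultimately have "topspace (top_of_set ?E) \<inter> ?W \<noteq> {}" by auto
  then have "generates (Suc p) (top_of_set ?E) ?N (frag_of \<tau>)"
    using generates_boundary_iff[OF contractible_vectors _ _ _ cyc, of ?W]
      off_diag_subset(1)[of "Suc p"] g contractible_off_positive_diag[of "Suc p"]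
    by (simp only: sub simp_thms)
  then show ?thesis by (simp add: \<tau>_def)
qed

text \<open>The induction starts with the zeroth homology of a point, as \<open>vectors 0\<close> is
  a singleton and \<open>nonzero_vectors 0\<close> is empty. Each step passes through the inclusion
  simplex in the punctured space of dimension p + 1.\<close>

lemma generates_edge_differences:
  "generates p (top_of_set (vectors p)) (nonzero_vectors p)
    (frag_of (simplex_map p (edge_differences p) (inclusion_simplex p)))"
proof (induction p)
  case 0
  have s: "singular_simplex 0 (top_of_set (vectors 0)) (simplex_map 0 (edge_differences 0) (inclusion_simplex 0))"
    by (rule singular_simplex_edge_differences)
  have e: "nonzero_vectors 0 = {}" by (simp add: nonzero_vectors_def)
  have v: "vectors 0 = {\<lambda>_. 0}" by (auto simp: vectors_def)
  have "path_connected_space (top_of_set (vectors 0))"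
    by (intro contractible_imp_path_connected_space contractible_vectors)
  from iso_integer_zeroth_homology_group[OF this s] show ?case
    using s by (auto simp: generates_def e infinite_cyclic_generator_def singular_cycle singular_chain_of
        chain_boundary_def carrier_relative_homology_group_0)
next
  case (Suc p)
  then show ?case by (intro generates_edge_differences_Suc generates_inclusion_simplex_if_edge_differences)
qed

lemma generates_inclusion_simplex:
  "generates p (top_of_set (nonzero_vectors (Suc p))) (off_positive_diag (Suc p)) (frag_of (inclusion_simplex p))"
  by (intro generates_inclusion_simplex_if_edge_differences generates_edge_differences)

text \<open>With P the product of the coordinates, this is P times the offset from the barycenter
  plus a multiple of (1,...,1). On the simplex, P vanishes exactly on the boundary, which goes to
  -(1,...,1). The factor n^n makes n^n P equal to 1 at the barycenter, which therefore goes to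
  (1,...,1). The simplex gets wrapped around the origin.\<close>

definition collapse :: "nat \<Rightarrow> (nat \<Rightarrow> real) \<Rightarrow> nat \<Rightarrow> real"
  where "collapse n y = (\<lambda>i. if i < n
    then (\<Prod>j<n. y j) * (y i - 1 / n) + (2 * real n ^ n * (\<Prod>j<n. y j) - 1) else 0)"

definition scale :: "real \<Rightarrow> (nat \<Rightarrow> real) \<Rightarrow> nat \<Rightarrow> real"
  where "scale c v = (\<lambda>i. c * v i)"

lemma scale_nonzero: "c \<noteq> 0 \<Longrightarrow> scale c v \<in> nonzero_vectors n \<longleftrightarrow> v \<in> nonzero_vectors n"
  by (auto simp: scale_def nonzero_vectors_def vectors_def)

lemma continuous_on_scale [continuous_intros]:
  assumes "continuous_on S c" "continuous_on S v"
  shows "continuous_on S (\<lambda>x. scale (c x) (v x))"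
  using assms(2) unfolding continuous_on_coordinatewise_iff scale_def
  by (intro allI continuous_intros assms(1)) blast

lemma continuous_on_collapse: "continuous_on S (collapse n)"
  unfolding continuous_on_coordinatewise_iff collapse_def
  by (intro allI continuous_intros)

lemma collapse_boundary:
  assumes "y \<in> simplex_boundary m"
  shows "collapse (Suc m) y = diag_vector (Suc m) (-1)"
proof -
  obtain i where "i < Suc m" "y i = 0"
    using assms unfolding simplex_boundary_def less_Suc_eq_le by blast
  then have P: "(\<Prod>j<Suc m. y j) = 0" by (intro prod_zero) auto
  show ?thesis unfolding collapse_def diag_vector_def P by auto
qed

lemma diag_vector_nonzero: "0 < n \<Longrightarrow> c \<noteq> 0 \<Longrightarrow> diag_vector n c \<in> nonzero_vectors n"
  by (auto simp: nonzero_vectors_def vectors_def diag_vector_def)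

text \<open>Modulo the diagonal, the straight line from the inclusion to a positive multiple of the
  collapse only rescales the offset from the barycenter.\<close>

lemma collapse_homotopy:
  assumes y: "y \<in> standard_simplex m" and t: "0 \<le> t" "t \<le> 1" and s: "0 < s"
  defines "w \<equiv> \<lambda>i. (1 - t) * y i + t * scale s (collapse (Suc m) y) i"
  shows "w \<in> nonzero_vectors (Suc m)" "y \<in> simplex_boundary m \<Longrightarrow> w \<in> off_positive_diag (Suc m)"
proof -
  define n where "n = Suc m"
  define P where "P = (\<Prod>j<n. y j)"
  have n: "0 < n" by (simp add: n_def)
  have P: "0 \<le> P" unfolding P_def by (intro prod_nonneg) (use standard_simplexD(1)[OF y] in auto)
  have wv: "w \<in> vectors n"
    using standard_simplexD(4)[OF y] by (auto simp: w_def vectors_def scale_def collapse_def n_def)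
  define A where "A = 1 - t + t * s * P"
  define B where "B = (1 - t) / n + t * s * (2 * real n ^ n * P - 1)"
  have w: "w i = A * (y i - 1 / n) + B" if "i < n" for i
  proof -
    define u where "u = 1 / real n"
    define K where "K = 2 * real n ^ n * P - 1"
    have "w i = (1 - t) * y i + t * (s * (P * (y i - u) + K))"
      using that by (simp add: w_def scale_def collapse_def n_def[symmetric] P_def[symmetric] u_def K_def)
    also have "\<dots> = (1 - t + t * s * P) * (y i - u) + ((1 - t) * u + t * s * K)"
      by argo
    finally show ?thesis unfolding A_def B_def u_def K_def by (simp only: times_divide_eq_right mult_1_right)
  qed
  have sumy: "(\<Sum>i<n. y i) = 1" using standard_simplexD(3)[OF y] by (simp add: n_def lessThan_Suc_atMost)
  \<comment> \<open>These are the only encounters of \<open>w\<close> with the diagonal: on its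
    negative half, at the end of the homotopy and over the boundary; on its positive half, over
    interior points. Both claims can be read off.\<close>
  have key: "(t = 1 \<and> P = 0 \<and> c < 0) \<or> (P \<noteq> 0 \<and> c > 0)" if c: "\<And>i. i < n \<Longrightarrow> w i = c" for c
  proof (cases "A = 0")
    case True
    have "0 \<le> t * s * P" using t s P by simp
    with True t have "t = 1" "t * s * P = 0" unfolding A_def by linarith+
    then have "t = 1" "P = 0" using s by auto
    moreover have "B = c" using c[OF n] w[OF n] True by simp
    ultimately show ?thesis using s by (simp add: B_def)
  next
    case False
    \<comment> \<open>A nonzero multiple of the offset is constant, so \<open>y\<close> is the
      barycenter. There the coefficient \<open>c\<close> is a convex combination of
      \<open>1 / n\<close> and \<open>s\<close>, hence positive.\<close>
    have eq: "y i = y 0" if "i < n" for i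
    proof -
      have "A * (y i - 1 / n) = A * (y 0 - 1 / n)"
        using c[OF that] c[OF n] w[OF that] w[OF n] by linarith
      then have "y i - 1 / n = y 0 - 1 / n" using mult_left_cancel[OF False] by blast
      then show ?thesis by simp
    qed
    have "(\<Sum>i<n. y i) = (\<Sum>i<n. y 0)" by (intro sum.cong refl eq) simp
    then have y0: "y 0 = 1 / n" using sumy n by (simp add: field_simps)
    have "P = (\<Prod>j<n. y 0)" unfolding P_def by (intro prod.cong refl eq) simp
    then have P1: "real n ^ n * P = 1" using y0 n by (simp add: power_divide)
    then have "P \<noteq> 0" by auto
    have "w 0 = B" using w[OF n] y0 by simp
    then have "c = (1 - t) / n + t * s" using c[OF n] P1 by (simp add: B_def mult.assoc)
    moreover have "(1 - t) / n + t * s > 0"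
      using t s n by (cases "t = 0") (auto intro: add_nonneg_pos)
    ultimately show ?thesis using \<open>P \<noteq> 0\<close> by simp
  qed
  show "w \<in> nonzero_vectors (Suc m)"
  proof (rule ccontr)
    assume "\<not> ?thesis"
    then have "w i = 0" if "i < n" for i
      using wv that unfolding nonzero_vectors_def n_def[symmetric] by blast
    from key[OF this] show False by simp
  qed
  assume "y \<in> simplex_boundary m"
  then obtain i where "i < n" "y i = 0"
    unfolding simplex_boundary_def n_def less_Suc_eq_le by blast
  then have "P = 0" unfolding P_def by (intro prod_zero) auto
  show "w \<in> off_positive_diag (Suc m)"
  proof (rule ccontr)
    assume "w \<notin> off_positive_diag (Suc m)"
    then obtain c where c: "0 \<le> c" "\<And>i. i < n \<Longrightarrow> w i = c"
      using wv unfolding in_off_positive_diag n_def[symmetric] by blast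
    from key[OF c(2)] c(1) \<open>P = 0\<close> show False by simp
  qed
qed

lemma collapse_nonzero: "y \<in> standard_simplex m \<Longrightarrow> collapse (Suc m) y \<in> nonzero_vectors (Suc m)"
  using collapse_homotopy(1)[of y m 1 1] by (simp add: scale_def)

text \<open>Two discs glued along their boundary, the second one being degenerate.\<close>

definition bubble :: "nat \<Rightarrow> ((nat \<Rightarrow> real) \<Rightarrow> real) \<Rightarrow> (nat \<Rightarrow> real) chain"
  where "bubble m s = frag_of (restrict (\<lambda>y. scale (s y) (collapse (Suc m) y)) (standard_simplex m))
    - frag_of (restrict (\<lambda>y. scale (s y) (diag_vector (Suc m) (-1))) (standard_simplex m))"

lemma singular_simplex_scaled:
  assumes "continuous_on (standard_simplex p) s" "\<And>y. y \<in> standard_simplex p \<Longrightarrow> 0 < s y"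
    "continuous_on (standard_simplex p) f" "\<And>y. y \<in> standard_simplex p \<Longrightarrow> f y \<in> nonzero_vectors n"
  shows "singular_simplex p (top_of_set (nonzero_vectors n)) (restrict (\<lambda>y. scale (s y) (f y)) (standard_simplex p))"
  using assms by (intro singular_simplex_restrictI continuous_on_scale) (auto simp: scale_nonzero less_imp_neq[THEN not_sym])

text \<open>Modulo \<open>off_positive_diag\<close> the degenerate simplex vanishes and the other
  one is homotopic to the inclusion simplex. The bubble being an absolute cycle and
  \<open>off_positive_diag\<close> contractible, the relative statement implies the absolute one.
  The freedom in \<open>s\<close> lets the radius vary over the simplex later on.\<close>

lemma generates_bubble:
  assumes "0 < m" and s: "continuous_on (standard_simplex m) s" "\<And>y. y \<in> standard_simplex m \<Longrightarrow> 0 < s y"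
  shows "generates m (top_of_set (nonzero_vectors (Suc m))) {} (bubble m s)"
proof -
  let ?N = "nonzero_vectors (Suc m)" and ?W = "off_positive_diag (Suc m)"
  define Q where "Q = (\<lambda>y. scale (s y) (collapse (Suc m) y))"
  define P where "P = (\<lambda>y. scale (s y) (diag_vector (Suc m) (-1)))"
  let ?Q = "restrict Q (standard_simplex m)" and ?P = "restrict P (standard_simplex m)"
  have Q: "singular_simplex m (top_of_set ?N) ?Q"
    unfolding Q_def using s by (intro singular_simplex_scaled continuous_on_collapse collapse_nonzero)
  have PW: "P y \<in> ?W" if "y \<in> standard_simplex m" for y
  proof -
    have "\<exists>i<Suc m. P y i \<noteq> c" if "c \<ge> 0" for c
      using s(2)[OF \<open>y \<in> _\<close>] that by (intro exI[of _ 0]) (auto simp: P_def scale_def diag_vector_def)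
    then show ?thesis by (auto simp: in_off_positive_diag P_def scale_def diag_vector_def vectors_def)
  qed
  have contP: "continuous_on (standard_simplex m) P"
    unfolding P_def using s by (intro continuous_intros)
  have P: "singular_simplex m (top_of_set ?W) ?P"
    using PW contP by (intro singular_simplex_restrictI)
  have PN: "singular_simplex m (top_of_set ?N) ?P"
    using PW contP off_diag_subset(1) by (intro singular_simplex_restrictI) auto
  have sub: "subtopology (top_of_set ?N) ?W = top_of_set ?W"
    using off_diag_subset by (simp add: subtopology_subtopology inf.absorb2)
  have bub: "bubble m s = frag_of ?Q - frag_of ?P" by (simp add: bubble_def Q_def P_def)
  have "chain_boundary m (frag_of ?Q) = chain_boundary m (frag_of ?P)"
    by (intro chain_boundary_frag_of_cong) (auto simp: Q_def P_def collapse_boundary simplex_boundary_def)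
  then have cyc: "singular_relcycle m (top_of_set ?N) {} (bubble m s)"
    using Q PN by (simp add: singular_cycle bub chain_boundary_diff singular_chain_diff singular_chain_of)
  have hom: "homotopic_with (\<lambda>h. h \<in> simplex_boundary m \<rightarrow> ?W) (top_of_set (standard_simplex m)) (top_of_set ?N) id Q"
  proof (rule homotopic_with_linear)
    show "continuous_on (standard_simplex m) Q"
      unfolding Q_def using s by (intro continuous_intros continuous_on_collapse)
  qed (use collapse_homotopy s(2) in \<open>auto simp: Q_def simplex_boundary_def\<close>)
  have "singular_relcycle m (top_of_set (standard_simplex m)) (simplex_boundary m) (frag_of (inclusion_simplex m))"
  proof (rule singular_relcycle_frag_of)
    show "singular_simplex m (top_of_set (standard_simplex m)) (inclusion_simplex m)"
      unfolding inclusion_simplex_def by (rule singular_simplex_restrictI) auto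
  qed (auto simp: inclusion_simplex_def simplex_boundary_def)
  from homotopic_imp_homologous_rel_chain_maps[OF hom this]
  have "homologous_rel m (top_of_set ?N) ?W (frag_of (inclusion_simplex m)) (frag_of ?Q)"
    by (simp add: inclusion_simplex_def simplex_map_restrict)
  moreover have "homologous_rel m (top_of_set ?N) ?W (frag_of ?Q) (bubble m s)"
    using P by (simp add: bub homologous_rel_def singular_chain_imp_relboundary sub singular_chain_of)
  ultimately have "homologous_rel m (top_of_set ?N) ?W (frag_of (inclusion_simplex m)) (bubble m s)"
    by (meson homologous_rel_trans)
  with generates_inclusion_simplex have "generates m (top_of_set ?N) ?W (bubble m s)"
    by (rule generates_homologous)
  moreover have "diag_vector (Suc m) (-1) \<in> ?W"
    by (auto simp: in_off_positive_diag diag_vector_def vectors_def)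
  ultimately show ?thesis
    using generates_relative_to_contractible_iff[of "top_of_set ?N" ?W m "bubble m s"] cyc assms(1)
      contractible_off_positive_diag[of "Suc m"] off_diag_subset(1)[of "Suc m"]
    by (auto simp: sub)
qed

section \<open>Fundamental classes and integral simplicial volume\<close>

lemma localize_class:
  assumes "singular_relcycle n X (topspace X - U) d" "x \<in> U"
  shows "localize n X U x (homologous_rel_set n X (topspace X - U) d) = homologous_rel_set n X (topspace X - {x}) d"
proof -
  have "chain_map n id d = d" using assms(1) by (auto simp: singular_relcycle intro: chain_map_ident)
  moreover have "id \<in> (topspace X - U) \<rightarrow> topspace X - {x}" using assms(2) by auto
  ultimately show ?thesis
    using hom_induced_chain_map[of X X id "topspace X - U" "topspace X - {x}" n d] assms(1)
    by (simp add: localize_def)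
qed

lemma localize_absolute_class:
  assumes "singular_relcycle n X {} z" "x \<in> topspace X"
  shows "localize n X (topspace X) x (homologous_rel_set n X {} z) = homologous_rel_set n X (topspace X - {x}) z"
  using localize_class[of n X "topspace X" z x] assms by simp

text \<open>The relation is witnessed by a chain \<open>e\<close> in the complement of
  \<open>x\<close>. Its finitely many simplices have compact images, and the complement of their
  union is the neighbourhood.\<close>

lemma homologous_rel_point_complement_open:
  assumes "Hausdorff_space X" "x \<in> topspace X" "homologous_rel n X (topspace X - {x}) a b"
  obtains V where "openin X V" "x \<in> V" "\<And>y. y \<in> V \<Longrightarrow> homologous_rel n X (topspace X - {y}) a b"
proof -
  obtain d e where d: "singular_chain (Suc n) X d"
    and e: "singular_chain n (subtopology X (topspace X - {x})) e"
    and eq: "chain_boundary (Suc n) d = (a - b) + e"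
    using assms(3) unfolding homologous_rel_def singular_relboundary_alt by blast
  define K where "K = (\<Union>\<sigma>\<in>Poly_Mapping.keys e. \<sigma> ` standard_simplex n)"
  have ss: "singular_simplex n X \<sigma> \<and> \<sigma> ` standard_simplex n \<subseteq> topspace X - {x}" if "\<sigma> \<in> Poly_Mapping.keys e" for \<sigma>
  proof -
    have "singular_simplex n (subtopology X (topspace X - {x})) \<sigma>"
      using e that unfolding singular_chain_def by blast
    then show ?thesis unfolding singular_simplex_subtopology .
  qed
  have "compactin X (\<sigma> ` standard_simplex n)" if "\<sigma> \<in> Poly_Mapping.keys e" for \<sigma>
  proof (rule image_compactin)
    show "compactin (subtopology (powertop_real UNIV) (standard_simplex n)) (standard_simplex n)"
      by (simp add: compactin_subtopology compactin_standard_simplex)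
    show "continuous_map (subtopology (powertop_real UNIV) (standard_simplex n)) X \<sigma>"
      using ss[OF that] by (simp add: singular_simplex_def)
  qed
  then have "compactin X K"
    unfolding K_def by (intro compactin_Union) auto
  then have "closedin X K" using assms(1) compactin_imp_closedin by blast
  then have "openin X (topspace X - K)" by blast
  moreover have "x \<in> topspace X - K" using ss assms(2) by (auto simp: K_def)
  moreover have "homologous_rel n X (topspace X - {y}) a b" if y: "y \<in> topspace X - K" for y
  proof -
    have "singular_simplex n (subtopology X (topspace X - {y})) \<sigma>" if "\<sigma> \<in> Poly_Mapping.keys e" for \<sigma>
      using ss[OF that] y that unfolding singular_simplex_subtopology K_def by auto
    then have "singular_chain n (subtopology X (topspace X - {y})) e"
      by (auto simp: singular_chain_def)
    then show ?thesis
      unfolding homologous_rel_def singular_relboundary_alt using d eq by blast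
  qed
  ultimately show ?thesis using that by blast
qed

text \<open>Near a point the orientation is induced by a single relative cycle. If this cycle is
  homologous to \<open>z\<close> locally at the point, then also locally at all nearby
  points.\<close>

lemma openin_orientation_agrees:
  assumes "Hausdorff_space X" "orientation n X \<omega>"
  shows "openin X {x \<in> topspace X. \<omega> x = homologous_rel_set n X (topspace X - {x}) z}" (is "openin X ?A")
proof -
  have "\<exists>T. openin X T \<and> x \<in> T \<and> T \<subseteq> ?A" if xA: "x \<in> ?A" for x
  proof -
    have x: "x \<in> topspace X" "\<omega> x = homologous_rel_set n X (topspace X - {x}) z" using xA by simp_all
    obtain U \<mu> where U: "openin X U" "x \<in> U"
      and \<mu>: "\<mu> \<in> carrier (relative_homology_group (int n) X (topspace X - U))"
      and loc: "\<And>y. y \<in> U \<Longrightarrow> localize n X U y \<mu> = \<omega> y"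
    proof -
      have "\<exists>U. openin X U \<and> x \<in> U \<and> (\<exists>\<mu>\<in>carrier (relative_homology_group (int n) X (topspace X - U)).
          \<forall>y\<in>U. localize n X U y \<mu> = \<omega> y)"
        using conjunct2[OF assms(2)[unfolded orientation_def]] x(1) by (rule bspec)
      then show ?thesis using that by (elim exE conjE bexE) simp
    qed
    obtain d where d: "singular_relcycle n X (topspace X - U) d" "\<mu> = homologous_rel_set n X (topspace X - U) d"
      using \<mu> unfolding carrier_relative_homology_group by (elim imageE) simp
    have \<omega>: "\<omega> y = homologous_rel_set n X (topspace X - {y}) d" if "y \<in> U" for y
      using loc[OF that] localize_class[OF d(1) that] d(2) by simp
    have "homologous_rel_set n X (topspace X - {x}) d = homologous_rel_set n X (topspace X - {x}) z"
      using x(2) \<omega>[OF U(2)] by (rule trans[OF sym, rotated])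
    then have "homologous_rel n X (topspace X - {x}) d z" by (simp only: homologous_rel_set_eq)
    from homologous_rel_point_complement_open[OF assms(1) x(1) this]
    obtain V where V: "openin X V" "x \<in> V" "\<And>y. y \<in> V \<Longrightarrow> homologous_rel n X (topspace X - {y}) d z"
      by blast
    have "\<omega> y = homologous_rel_set n X (topspace X - {y}) z" if "y \<in> U" "y \<in> V" for y
      unfolding \<omega>[OF that(1)] homologous_rel_set_eq using that(2) by (rule V(3))
    moreover have "U \<subseteq> topspace X" using U(1) by (rule openin_subset)
    ultimately have "U \<inter> V \<subseteq> ?A" by blast
    moreover have "openin X (U \<inter> V)" using U(1) V(1) by (rule openin_Int)
    moreover have "x \<in> U \<inter> V" using U(2) V(2) by (rule IntI)
    ultimately show ?thesis by blast
  qed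
  then show ?thesis by (subst openin_subopen) blast
qed

lemma inv_homology_class:
  assumes "singular_relcycle n X S z"
  shows "inv\<^bsub>relative_homology_group (int n) X S\<^esub> (homologous_rel_set n X S z) = homologous_rel_set n X S (- z)"
proof -
  have "uminus ` homologous_rel_set n X S z = homologous_rel_set n X S (- z)"
  proof -
    have *: "homologous_rel n X S (- z) b \<longleftrightarrow> homologous_rel n X S z (- b)" for b
    proof -
      have "z - (- b) = - (- z - b)" by simp
      then show ?thesis unfolding homologous_rel_def by (simp only: singular_relboundary_minus)
    qed
    show ?thesis
    proof (intro equalityI subsetI)
      fix b assume "b \<in> homologous_rel_set n X S (- z)"
      then have "- b \<in> homologous_rel_set n X S z" by (simp only: mem_Collect_eq *)
      then have "- (- b) \<in> uminus ` homologous_rel_set n X S z" by (rule imageI)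
      then show "b \<in> uminus ` homologous_rel_set n X S z" by (simp only: add.inverse_inverse)
    next
      fix b assume "b \<in> uminus ` homologous_rel_set n X S z"
      then obtain a where "b = - a" "homologous_rel n X S z a" by blast
      then show "b \<in> homologous_rel_set n X S (- z)"
        by (simp only: mem_Collect_eq * add.inverse_inverse)
    qed
  qed
  then show ?thesis
    using inv_relative_homology_group[OF homology_class_carrier[OF assms]] by simp
qed

lemma infinite_cyclic_generator_neq_inv:
  fixes G (structure)
  assumes "infinite_cyclic_generator G a"
  shows "a \<noteq> inv a"
proof
  assume *: "a = inv a"
  interpret group G using assms by (simp add: infinite_cyclic_generator_def)
  have a: "a \<in> carrier G" and inj: "inj (\<lambda>k::int. a [^] k)"
    using assms by (auto simp: infinite_cyclic_generator_def iso_def bij_betw_def)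
  have "a [^] (1::int) = a [^] (-1::int)" using * a by (simp add: int_pow_neg)
  then have "(1::int) = -1" by (rule injD[OF inj])
  then show False by simp
qed

text \<open>At each point the orientation is the local class of \<open>z\<close> or its inverse, the
  local class of \<open>-z\<close>. The two cases define disjoint open sets covering the connected
  space, so one of them is empty.\<close>

lemma fundamental_class_up_to_sign:
  assumes X: "Hausdorff_space X" "connected_space X" and \<omega>: "orientation n X \<omega>"
    and z: "singular_relcycle n X {} z"
    and gen: "\<And>x. x \<in> topspace X \<Longrightarrow> generates n X (topspace X - {x}) z"
  shows "fundamental_class n X \<omega> (homologous_rel_set n X {} z) \<or> fundamental_class n X \<omega> (homologous_rel_set n X {} (- z))"
proof -
  have z': "singular_relcycle n X {} (- z)" using z by (simp add: singular_relcycle_minus)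
  define A where "A = (\<lambda>z. {x \<in> topspace X. \<omega> x = homologous_rel_set n X (topspace X - {x}) z})"
  have op: "openin X (A z)" "openin X (A (- z))"
    unfolding A_def using openin_orientation_agrees[OF X(1) \<omega>] by blast+
  have inv: "homologous_rel_set n X (topspace X - {x}) (- z)
      = inv\<^bsub>local_homology_group n X x\<^esub> (homologous_rel_set n X (topspace X - {x}) z)"
    if "x \<in> topspace X" for x
    using inv_homology_class[of n X "topspace X - {x}" z] gen[OF that]
    by (simp add: local_homology_group_def generates_def)
  have icg: "infinite_cyclic_generator (local_homology_group n X x) (homologous_rel_set n X (topspace X - {x}) z)"
    if "x \<in> topspace X" for x
    using gen[OF that] by (simp add: generates_def local_homology_group_def)
  have cover: "topspace X \<subseteq> A z \<union> A (- z)"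
  proof
    fix x assume x: "x \<in> topspace X"
    then show "x \<in> A z \<union> A (- z)"
      using infinite_cyclic_generator_unique[OF icg[OF x], of "\<omega> x"] \<omega> inv[OF x]
      by (auto simp: orientation_def A_def)
  qed
  have disj: "A z \<inter> A (- z) = {}"
  proof -
    have False if "x \<in> A z" "x \<in> A (- z)" for x
      using infinite_cyclic_generator_neq_inv[OF icg[of x]] inv[of x] that by (simp add: A_def)
    then show ?thesis by blast
  qed
  have "A z = {} \<or> A (- z) = {}"
    using X(2) op cover disj unfolding connected_space_def by blast
  then have "topspace X \<subseteq> A z \<or> topspace X \<subseteq> A (- z)" using cover by blast
  then show ?thesis
    using z z' homology_class_carrier[OF z] homology_class_carrier[OF z']
    by (auto simp: fundamental_class_def localize_absolute_class A_def)
qed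

text \<open>A boundary localizes to the neutral element, which cannot generate an infinite cyclic
  group; the chain \<open>z\<close> certifies that the local group at \<open>x\<close> is infinite
  cyclic.\<close>

lemma fundamental_class_not_boundary:
  assumes "orientation n X \<omega>" "fundamental_class n X \<omega> (homologous_rel_set n X {} c)"
    and "x \<in> topspace X" "generates n X (topspace X - {x}) z"
  shows "\<not> singular_relboundary n X {} c"
proof
  assume b: "singular_relboundary n X {} c"
  then have cyc: "singular_relcycle n X {} c" by (rule singular_relboundary_imp_relcycle)
  have "singular_relboundary n X (topspace X - {x}) c"
    using homologous_rel_mono[of n X "{}" c 0] b by (simp add: homologous_rel_def)
  then have "homologous_rel_set n X (topspace X - {x}) c = \<one>\<^bsub>local_homology_group n X x\<^esub>"
    unfolding local_homology_group_def one_relative_homology_group homologous_rel_set_eq_relboundary .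
  then have "\<omega> x = \<one>\<^bsub>local_homology_group n X x\<^esub>"
    using assms(2,3) localize_absolute_class[OF cyc assms(3)] by (simp add: fundamental_class_def)
  moreover have "infinite_cyclic_generator (local_homology_group n X x) (homologous_rel_set n X (topspace X - {x}) z)"
    using assms(4) by (simp add: generates_def local_homology_group_def)
  ultimately show False
    using assms(1,3) infinite_cyclic_generator_nontrivial by (fastforce simp: orientation_def)
qed

section \<open>Norms of chains and a criterion for the value of the volume\<close>

lemma chain_norm_minus [simp]: "chain_norm (- c) = chain_norm c"
  by (simp add: chain_norm_def)

lemma chain_norm_frag_of [simp]: "chain_norm (frag_of \<sigma>) = 1"
  by (simp add: chain_norm_def)

lemma chain_norm_eq_0_iff: "chain_norm c = 0 \<longleftrightarrow> c = 0"
proof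
  assume "chain_norm c = 0"
  then have "Poly_Mapping.lookup c \<sigma> = 0" if "\<sigma> \<in> Poly_Mapping.keys c" for \<sigma>
    using that by (simp add: chain_norm_def)
  then show "c = 0" by (metis in_keys_iff poly_mapping_eqI lookup_zero)
qed (simp add: chain_norm_def)

lemma chain_norm_frag_of_diff: "chain_norm (frag_of \<sigma> - frag_of \<tau>) \<le> 2"
proof -
  have k: "Poly_Mapping.keys (frag_of \<sigma> - frag_of \<tau>) \<subseteq> {\<sigma>, \<tau>}"
    using keys_diff[of "frag_of \<sigma>" "frag_of \<tau>"] by auto
  have "chain_norm (frag_of \<sigma> - frag_of \<tau>)
      \<le> (\<Sum>\<rho>\<in>{\<sigma>, \<tau>}. nat \<bar>Poly_Mapping.lookup (frag_of \<sigma> - frag_of \<tau>) \<rho>\<bar>)"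
    unfolding chain_norm_def by (rule sum_mono2) (use k in auto)
  also have "\<dots> \<le> 2"
    by (cases "\<sigma> = \<tau>") (auto simp: lookup_minus lookup_single)
  finally show ?thesis .
qed

lemma chain_norm_eq_1E:
  assumes "chain_norm c = 1"
  obtains \<sigma> where "c = frag_of \<sigma> \<or> c = - frag_of \<sigma>"
proof -
  have "c \<noteq> 0" using assms chain_norm_eq_0_iff[of c] by auto
  then obtain \<sigma> where \<sigma>: "\<sigma> \<in> Poly_Mapping.keys c" by (metis equals0I keys_eq_empty)
  let ?n = "\<lambda>\<rho>. nat \<bar>Poly_Mapping.lookup c \<rho>\<bar>"
  have pos: "?n \<rho> \<ge> 1" if "\<rho> \<in> Poly_Mapping.keys c" for \<rho>
    using that by (simp add: in_keys_iff)
  have split: "?n \<sigma> + (\<Sum>\<rho>\<in>Poly_Mapping.keys c - {\<sigma>}. ?n \<rho>) = 1"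
    using assms \<sigma> by (simp add: chain_norm_def sum.remove)
  have zero: "(\<Sum>\<rho>\<in>Poly_Mapping.keys c - {\<sigma>}. ?n \<rho>) = 0" and one: "?n \<sigma> = 1"
    using split pos[OF \<sigma>] by linarith+
  have keys: "Poly_Mapping.keys c = {\<sigma>}"
  proof -
    have "?n \<rho> = 0" if "\<rho> \<in> Poly_Mapping.keys c - {\<sigma>}" for \<rho>
      using zero that by simp
    then show ?thesis using pos \<sigma> by fastforce
  qed
  have "c = frag_cmul (Poly_Mapping.lookup c \<sigma>) (frag_of \<sigma>)"
  proof (rule poly_mapping_eqI)
    fix \<rho>
    show "Poly_Mapping.lookup c \<rho> = Poly_Mapping.lookup (frag_cmul (Poly_Mapping.lookup c \<sigma>) (frag_of \<sigma>)) \<rho>"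
    proof (cases "\<rho> = \<sigma>")
      case False
      then have "\<rho> \<notin> Poly_Mapping.keys c" by (simp add: keys)
      with False show ?thesis by (simp add: in_keys_iff)
    qed simp
  qed
  moreover have "Poly_Mapping.lookup c \<sigma> = 1 \<or> Poly_Mapping.lookup c \<sigma> = -1"
    using one by linarith
  ultimately obtain k where k: "c = frag_cmul k (frag_of \<sigma>)" "k = 1 \<or> k = -1" by blast
  from k(2) have "c = frag_of \<sigma> \<or> c = - frag_of \<sigma>"
    by (rule disjE) (simp_all add: k(1))
  then show ?thesis using that by blast
qed

lemma integral_simplicial_volume_eqI:
  assumes "singular_relcycle n X {} z" "fundamental_class n X \<omega> (homologous_rel_set n X {} z)" "chain_norm z \<le> v"
    and "\<And>c. \<lbrakk>singular_relcycle n X {} c; fundamental_class n X \<omega> (homologous_rel_set n X {} c)\<rbrakk> \<Longrightarrow> v \<le> chain_norm c"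
  shows "integral_simplicial_volume n X \<omega> = v"
  unfolding integral_simplicial_volume_def
proof (rule Least_equality)
  have "chain_norm z = v" using assms by (meson le_antisym)
  then show "\<exists>c. singular_relcycle n X {} c \<and> fundamental_class n X \<omega> (homologous_rel_set n X {} c) \<and> v = chain_norm c"
    using assms by blast
qed (use assms(4) in blast)

lemma singular_simplex_of_cycle:
  assumes "singular_relcycle n X {} c" "c = frag_of \<sigma> \<or> c = - frag_of \<sigma>"
  shows "singular_simplex n X \<sigma>" "chain_boundary n (frag_of \<sigma>) = 0" "singular_relcycle n X {} (frag_of \<sigma>)"
  using assms by (auto simp: singular_cycle singular_chain_of singular_chain_minus chain_boundary_minus)

text \<open>The augmentation of the boundary of an even-dimensional simplex is 1.\<close>

lemma chain_boundary_even_simplex: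
  assumes "even n" "0 < n"
  shows "chain_boundary n (frag_of \<sigma>) \<noteq> 0"
proof
  define aug where "aug = frag_extend (\<lambda>_::(nat\<Rightarrow>real)\<Rightarrow>'a. frag_of ())"
  assume "chain_boundary n (frag_of \<sigma>) = 0"
  then have "0 = aug (\<Sum>k\<le>n. frag_cmul ((-1) ^ k) (frag_of (singular_face n k \<sigma>)))"
    using assms(2) by (simp add: chain_boundary_of aug_def)
  also have "\<dots> = (\<Sum>k\<le>n. frag_cmul ((-1) ^ k) (frag_of ()))"
    unfolding aug_def by (simp add: frag_extend_sum frag_extend_cmul o_def)
  also have "\<dots> = frag_of ()" using assms(1) by (induction n rule: nat_induct2) auto
  finally show False by simp
qed

text \<open>For values up to 2 the competitors can be listed: norm 0 is the zero chain, norm 1 is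
  plus or minus a simplex, itself a cycle. A fundamental cycle is not a boundary, so it is enough
  that these chains are boundaries. The minimum is attained by \<open>z\<close> or
  \<open>-z\<close>, depending on the orientation.\<close>

lemma integral_simplicial_volume_eq:
  assumes X: "Hausdorff_space X" "connected_space X" "topspace X \<noteq> {}" and \<omega>: "orientation n X \<omega>"
    and z: "singular_relcycle n X {} z" and gen: "\<And>x. x \<in> topspace X \<Longrightarrow> generates n X (topspace X - {x}) z"
    and v: "chain_norm z \<le> v" "v \<le> 2"
    and no: "\<And>\<sigma>. \<lbrakk>v = 2; singular_simplex n X \<sigma>; chain_boundary n (frag_of \<sigma>) = 0\<rbrakk> \<Longrightarrow> singular_relboundary n X {} (frag_of \<sigma>)"
  shows "integral_simplicial_volume n X \<omega> = v"
proof -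
  have lower: "v \<le> chain_norm c"
    if c: "singular_relcycle n X {} c" "fundamental_class n X \<omega> (homologous_rel_set n X {} c)" for c
  proof (rule ccontr)
    assume "\<not> ?thesis"
    then have "chain_norm c = 0 \<or> (chain_norm c = 1 \<and> v = 2)" using v(2) by linarith
    moreover have nb: "\<not> singular_relboundary n X {} c"
      using fundamental_class_not_boundary[OF \<omega> c(2)] gen X(3) by blast
    moreover have "singular_relboundary n X {} c" if n1: "chain_norm c = 1" "v = 2"
    proof -
      obtain \<sigma> where \<sigma>: "c = frag_of \<sigma> \<or> c = - frag_of \<sigma>" using chain_norm_eq_1E n1 by blast
      have "singular_relboundary n X {} (frag_of \<sigma>)"
        using no n1 singular_simplex_of_cycle[OF c(1) \<sigma>] by blast
      then show ?thesis using \<sigma> singular_relboundary_minus by blast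
    qed
    ultimately show False using chain_norm_eq_0_iff singular_relboundary_0 by metis
  qed
  have z': "singular_relcycle n X {} (- z)" using z by (simp add: singular_relcycle_minus)
  from fundamental_class_up_to_sign[OF X(1,2) \<omega> z gen] show ?thesis
    using integral_simplicial_volume_eqI[OF z _ v(1)] integral_simplicial_volume_eqI[OF z', of \<omega> v] v(1) lower
    by auto
qed

section \<open>Spheres\<close>

definition vnorm :: "nat \<Rightarrow> (nat \<Rightarrow> real) \<Rightarrow> real"
  where "vnorm n v = sqrt (\<Sum>i<n. (v i)\<^sup>2)"

definition unit_vectors :: "nat \<Rightarrow> (nat \<Rightarrow> real) set"
  where "unit_vectors n = {v \<in> vectors n. vnorm n v = 1}"

definition normalize_vector :: "nat \<Rightarrow> (nat \<Rightarrow> real) \<Rightarrow> nat \<Rightarrow> real"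
  where "normalize_vector n v = scale (1 / vnorm n v) v"

lemma nsphere_eq: "nsphere m = top_of_set (unit_vectors (Suc m))"
proof -
  have "{x. (\<Sum>i\<le>m. (x i)\<^sup>2) = 1 \<and> (\<forall>i>m. x i = 0)} = unit_vectors (Suc m)"
    by (auto simp: unit_vectors_def vectors_def vnorm_def lessThan_Suc_atMost Suc_le_eq)
  then show ?thesis by (simp add: nsphere top_of_set_powertop)
qed

lemma vnorm_nonneg: "0 \<le> vnorm n v"
  by (simp add: vnorm_def sum_nonneg)

lemma vnorm_scale: "vnorm n (scale c v) = \<bar>c\<bar> * vnorm n v"
  by (simp add: vnorm_def scale_def power_mult_distrib sum_distrib_left[symmetric] real_sqrt_mult)

lemma vnorm_pos_iff: "v \<in> vectors n \<Longrightarrow> 0 < vnorm n v \<longleftrightarrow> v \<in> nonzero_vectors n"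
proof -
  assume v: "v \<in> vectors n"
  have "(\<Sum>i<n. (v i)\<^sup>2) = 0 \<longleftrightarrow> (\<forall>i<n. v i = 0)"
    by (subst sum_nonneg_eq_0_iff) auto
  moreover have "0 < vnorm n v \<longleftrightarrow> (\<Sum>i<n. (v i)\<^sup>2) \<noteq> 0"
    using sum_nonneg[of "{..<n}" "\<lambda>i. (v i)\<^sup>2"] by (simp add: vnorm_def order.strict_iff_order)
  ultimately show ?thesis using v by (simp add: nonzero_vectors_def)
qed

lemma nonzero_vectors_subset: "nonzero_vectors n \<subseteq> vectors n"
  by (simp add: nonzero_vectors_def)

lemma vnorm_pos: "v \<in> nonzero_vectors n \<Longrightarrow> 0 < vnorm n v"
  using vnorm_pos_iff nonzero_vectors_subset by blast

lemma unit_vectors_subset: "unit_vectors n \<subseteq> nonzero_vectors n"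
  using vnorm_pos_iff by (fastforce simp: unit_vectors_def)

lemma continuous_on_vnorm [continuous_intros]:
  assumes "continuous_on S f"
  shows "continuous_on S (\<lambda>x. vnorm n (f x))"
proof -
  have "continuous_on S (\<lambda>x. f x i)" for i
    using assms continuous_on_coordinatewise_iff by blast
  then show ?thesis unfolding vnorm_def by (intro continuous_intros)
qed

lemma continuous_on_normalize_vector [continuous_intros]:
  assumes "continuous_on S f" "\<And>x. x \<in> S \<Longrightarrow> f x \<in> nonzero_vectors n"
  shows "continuous_on S (\<lambda>x. normalize_vector n (f x))"
  unfolding normalize_vector_def
  by (intro continuous_intros assms) (use assms(2) vnorm_pos in fastforce)

lemma normalize_vector_unit: "v \<in> nonzero_vectors n \<Longrightarrow> normalize_vector n v \<in> unit_vectors n"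
proof -
  assume v: "v \<in> nonzero_vectors n"
  then have "vnorm n (normalize_vector n v) = 1"
    using vnorm_pos[of v n] by (simp add: normalize_vector_def vnorm_scale)
  moreover have "normalize_vector n v \<in> vectors n"
    using v by (simp add: normalize_vector_def scale_def nonzero_vectors_def vectors_def)
  ultimately show ?thesis by (simp add: unit_vectors_def)
qed

lemma normalize_vector_id: "v \<in> unit_vectors n \<Longrightarrow> normalize_vector n v = v"
  by (simp add: unit_vectors_def normalize_vector_def scale_def)

lemma scale_scale: "scale a (scale b v) = scale (a * b) v"
  by (simp add: scale_def mult.assoc)

lemma scale_one [simp]: "scale 1 v = v"
  by (simp add: scale_def)

lemma normalize_vector_scale:
  assumes "0 < c"
  shows "normalize_vector n (scale c v) = normalize_vector n v"
  using assms by (simp add: normalize_vector_def vnorm_scale scale_scale)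

lemma scale_normalize_vector: "v \<in> nonzero_vectors n \<Longrightarrow> scale (vnorm n v) (normalize_vector n v) = v"
  using vnorm_pos[of v n] by (simp add: normalize_vector_def scale_scale)

lemma homotopic_with_scale:
  fixes a b :: "(nat \<Rightarrow> real) \<Rightarrow> real"
  assumes "continuous_on S a" "continuous_on S b"
    and "\<And>v t. \<lbrakk>v \<in> S; 0 \<le> t; t \<le> 1\<rbrakk> \<Longrightarrow> scale ((1 - t) * a v + t * b v) v \<in> U"
  shows "homotopic_with (\<lambda>_. True) (top_of_set S) (top_of_set U) (\<lambda>v. scale (a v) v) (\<lambda>v. scale (b v) v)"
proof -
  have e: "(\<lambda>i. (1 - t) * scale (a v) v i + t * scale (b v) v i) = scale ((1 - t) * a v + t * b v) v" for v t
    by (simp add: scale_def algebra_simps)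
  have "homotopic_with (\<lambda>h. h \<in> {} \<rightarrow> {}) (top_of_set S) (top_of_set U) (\<lambda>v. scale (a v) v) (\<lambda>v. scale (b v) v)"
    by (rule homotopic_with_linear; (unfold e)?)
      (use assms in \<open>auto intro: continuous_on_scale[OF _ continuous_on_id, unfolded id_def]\<close>)
  then show ?thesis by simp
qed

lemma convex_combination_pos:
  fixes a b :: real
  assumes "0 < a" "0 < b" "0 \<le> t" "t \<le> 1"
  shows "0 < (1 - t) * a + t * b"
  using assms by (cases "t = 0") (auto intro: add_nonneg_pos)

lemma iso_normalize_vector:
  "hom_induced p (top_of_set (nonzero_vectors n)) {} (top_of_set (unit_vectors n)) {} (normalize_vector n)
    \<in> iso (homology_group p (top_of_set (nonzero_vectors n))) (homology_group p (top_of_set (unit_vectors n)))"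
proof (rule homotopy_equivalence_homology_group_isomorphism[where g = id])
  show "continuous_map (top_of_set (nonzero_vectors n)) (top_of_set (unit_vectors n)) (normalize_vector n)"
    using normalize_vector_unit by (auto intro: continuous_on_normalize_vector[OF continuous_on_id])
  show "continuous_map (top_of_set (unit_vectors n)) (top_of_set (nonzero_vectors n)) id"
    using unit_vectors_subset[of n] by auto
  have "homotopic_with (\<lambda>_. True) (top_of_set (nonzero_vectors n)) (top_of_set (nonzero_vectors n))
      (\<lambda>v. scale (1 / vnorm n v) v) (\<lambda>v. scale 1 v)"
  proof (rule homotopic_with_scale)
    have "vnorm n v \<noteq> 0" if "v \<in> nonzero_vectors n" for v using vnorm_pos[OF that] by simp
    then show "continuous_on (nonzero_vectors n) (\<lambda>v. 1 / vnorm n v)"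
      by (intro continuous_intros) auto
    fix v and t :: real assume v: "v \<in> nonzero_vectors n" and t: "0 \<le> t" "t \<le> 1"
    have "0 < (1 - t) * (1 / vnorm n v) + t * 1"
      by (rule convex_combination_pos) (use vnorm_pos[OF v] t in auto)
    then show "scale ((1 - t) * (1 / vnorm n v) + t * 1) v \<in> nonzero_vectors n"
      using v by (metis less_irrefl scale_nonzero)
  qed (rule continuous_on_const)
  then show "homotopic_with (\<lambda>h. True) (top_of_set (nonzero_vectors n)) (top_of_set (nonzero_vectors n))
      (id \<circ> normalize_vector n) id"
    by (simp add: normalize_vector_def[abs_def] id_def comp_def)
  show "homotopic_with (\<lambda>k. True) (top_of_set (unit_vectors n)) (top_of_set (unit_vectors n)) (normalize_vector n \<circ> id) id"
    by (rule homotopic_with_equal)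
      (auto simp: normalize_vector_id continuous_on_normalize_vector intro: continuous_on_eq[OF continuous_on_id])
qed

lemma generates_normalize:
  assumes "generates p (top_of_set (nonzero_vectors n)) {} c"
  shows "generates p (top_of_set (unit_vectors n)) {} (chain_map p (normalize_vector n) c)"
proof (subst generates_hom_induced_iso[OF _ _ iso_normalize_vector])
  show "continuous_map (top_of_set (nonzero_vectors n)) (top_of_set (unit_vectors n)) (normalize_vector n)"
    using normalize_vector_unit by (auto intro: continuous_on_normalize_vector[OF continuous_on_id])
qed (use assms in \<open>auto simp: generates_def\<close>)

text \<open>The punctured space has the homology of the m-sphere. The degree that matters later is m
  + 1, the dimension of the product of circle and sphere: cycles of that degree bound after being
  lifted.\<close>

lemma trivial_homology_nonzero_vectors:
  assumes "p \<noteq> 0" "p \<noteq> m"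
  shows "trivial_group (homology_group (int p) (top_of_set (nonzero_vectors (Suc m))))"
proof -
  have "trivial_group (homology_group (int p) (top_of_set (unit_vectors (Suc m))))"
    using reduced_homology_group_nsphere(2)[of "int p" m] assms
    by (simp add: un_reduced_homology_group nsphere_eq)
  then show ?thesis
    using iso_normalize_vector[of "int p" "Suc m"] isomorphic_group_triviality is_isoI
    by (metis group_relative_homology_group)
qed

lemma antipode_unit: "x \<in> unit_vectors n \<Longrightarrow> scale (-1) x \<in> unit_vectors n"
  by (auto simp: unit_vectors_def vnorm_scale) (auto simp: vectors_def scale_def)

lemma antipode_neq:
  assumes "x \<in> unit_vectors n"
  shows "scale (-1) x \<noteq> x"
proof
  assume eq: "scale (-1) x = x"
  have "x i = 0" for i
    using fun_cong[OF eq, of i] by (simp add: scale_def)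
  moreover have "x \<in> nonzero_vectors n" using assms unit_vectors_subset by blast
  ultimately show False by (simp add: nonzero_vectors_def)
qed

lemma unit_vectors_scale_eq:
  assumes "x \<in> unit_vectors n" "y \<in> unit_vectors n" "0 \<le> a" "0 < b" "scale a x = scale b y"
  shows "x = y"
proof -
  have "vnorm n (scale a x) = vnorm n (scale b y)" using assms(5) by simp
  then have ab: "a = b" using assms(1-4) by (simp add: vnorm_scale unit_vectors_def)
  have "a * x i = b * y i" for i using fun_cong[OF assms(5), of i] by (simp add: scale_def)
  then have "x i = y i" for i using ab assms(4) by simp
  then show ?thesis by (rule ext)
qed

text \<open>The segment from \<open>y\<close> to the antipode of \<open>x\<close> never meets the
  closed ray from the origin through \<open>x\<close>; projecting it radially contracts the
  punctured sphere to the antipode.\<close>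

lemma contractible_punctured_sphere:
  assumes x: "x \<in> unit_vectors n"
  shows "contractible_space (top_of_set (unit_vectors n - {x}))"
proof -
  let ?S = "unit_vectors n - {x}"
  define R where "R = {v \<in> nonzero_vectors n. normalize_vector n v \<noteq> x}"
  have "homotopic_with (\<lambda>h. h \<in> {} \<rightarrow> {}) (top_of_set ?S) (top_of_set R) id (\<lambda>_. scale (-1) x)"
  proof (rule homotopic_with_linear)
    fix y and t :: real assume y: "y \<in> ?S" and t: "0 \<le> t" "t \<le> 1"
    let ?w = "\<lambda>i. (1 - t) * id y i + t * scale (-1) x i"
    have wv: "?w \<in> vectors n" using x y by (auto simp: unit_vectors_def vectors_def scale_def)
    \<comment> \<open>The case \<open>c = 0\<close> excludes the origin. Comparing norms in the
      rearranged equation gives \<open>1 - t = c + t\<close>, which is positive, and then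
      \<open>y = x\<close>.\<close>
    have no: False if "0 \<le> c" "?w = scale c x" for c
    proof -
      have "(1 - t) * y i = (c + t) * x i" for i
        using fun_cong[OF that(2), of i] by (simp add: scale_def algebra_simps)
      then have e: "scale (1 - t) y = scale (c + t) x" by (simp add: scale_def)
      have "vnorm n (scale (1 - t) y) = vnorm n (scale (c + t) x)" using e by simp
      then have "1 - t = c + t" using x y t that(1) by (simp add: vnorm_scale unit_vectors_def)
      then have "0 < c + t" using t that(1) by linarith
      then have "y = x" using unit_vectors_scale_eq[of y n x "1 - t" "c + t"] e x y t by auto
      then show False using y by simp
    qed
    have w0: "?w \<in> nonzero_vectors n"
    proof (rule ccontr)
      assume "\<not> ?thesis"
      then have "?w = (\<lambda>_. 0)" using wv by (simp add: nonzero_vectors_eq)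
      then show False using no[of 0] by (simp add: scale_def)
    qed
    moreover have "normalize_vector n ?w \<noteq> x"
      using no[of "vnorm n ?w"] scale_normalize_vector[OF w0] vnorm_nonneg by metis
    ultimately show "?w \<in> R" unfolding R_def by blast
  qed auto
  then have "homotopic_with (\<lambda>_. True) (top_of_set ?S) (top_of_set R) id (\<lambda>_. scale (-1) x)" by simp
  moreover have "continuous_map (top_of_set R) (top_of_set ?S) (normalize_vector n)"
    using normalize_vector_unit by (auto simp: R_def intro!: continuous_on_normalize_vector continuous_on_id)
  ultimately have "homotopic_with (\<lambda>_. True) (top_of_set ?S) (top_of_set ?S)
      (normalize_vector n \<circ> id) (normalize_vector n \<circ> (\<lambda>_. scale (-1) x))"
    by (rule homotopic_with_compose_continuous_map_left) simp
  then have "homotopic_with (\<lambda>_. True) (top_of_set ?S) (top_of_set ?S) id (\<lambda>_. normalize_vector n (scale (-1) x))"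
    by (rule homotopic_with_eq) (auto simp: normalize_vector_id)
  then show ?thesis unfolding contractible_space_def by blast
qed

lemma generates_punctured_sphere:
  assumes "0 < m" "generates m (nsphere m) {} z" "x \<in> topspace (nsphere m)"
  shows "generates m (nsphere m) (topspace (nsphere m) - {x}) z"
proof -
  let ?S = "unit_vectors (Suc m)"
  have x: "x \<in> ?S" using assms(3) by (simp add: nsphere_eq)
  have "subtopology (top_of_set ?S) (?S - {x}) = top_of_set (?S - {x})"
    by (simp add: subtopology_subtopology inf.absorb2)
  moreover have "scale (-1) x \<in> ?S - {x}" using antipode_unit[OF x] antipode_neq[OF x] by blast
  ultimately show ?thesis
    using generates_relative_to_contractible_iff[of "nsphere m" "?S - {x}" m z] assms(1,2)
      contractible_punctured_sphere[OF x]
    by (auto simp: nsphere_eq generates_def)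
qed

text \<open>Both hemisphere-like sets are contractible, and from dimension 2 on the first basis
  vector is off the diagonal and so belongs to both.\<close>

lemma connected_nonzero_vectors:
  assumes "2 \<le> n"
  shows "connected (nonzero_vectors n)"
proof -
  have "connected_space (top_of_set (off_positive_diag n))" "connected_space (top_of_set (off_negative_diag n))"
    by (intro contractible_imp_connected_space contractible_off_positive_diag contractible_off_negative_diag)+
  then have "connected (off_positive_diag n)" "connected (off_negative_diag n)"
    using connectedin_iff_connected[of "off_positive_diag n"] connectedin_iff_connected[of "off_negative_diag n"]
    unfolding connectedin_def by simp_all
  moreover have "(\<lambda>i. if i = 0 then 1 else 0) \<in> off_positive_diag n \<inter> off_negative_diag n"
  proof -
    have "\<exists>i<n. (if i = 0 then 1 else 0) \<noteq> c" for c :: real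
    proof (cases "c = 1")
      case True then show ?thesis using assms by (intro exI[of _ 1]) simp
    next
      case False then show ?thesis using assms by (intro exI[of _ 0]) simp
    qed
    then show ?thesis using assms by (auto simp: in_off_positive_diag in_off_negative_diag vectors_def)
  qed
  ultimately have "connected (off_positive_diag n \<union> off_negative_diag n)"
    by (intro connected_Un) auto
  then show ?thesis using nonzero_vectors_union_off_diag[of n] assms by simp
qed

lemma connected_unit_vectors:
  assumes "2 \<le> n"
  shows "connected (unit_vectors n)"
proof -
  have "unit_vectors n = normalize_vector n ` nonzero_vectors n"
  proof (intro equalityI subsetI)
    fix v assume v: "v \<in> unit_vectors n"
    then have "v \<in> nonzero_vectors n" using unit_vectors_subset by blast
    then show "v \<in> normalize_vector n ` nonzero_vectors n"
      using normalize_vector_id[OF v] image_eqI by metis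
  qed (use normalize_vector_unit in blast)
  moreover have "continuous_on (nonzero_vectors n) (normalize_vector n)"
    by (intro continuous_on_normalize_vector continuous_on_id)
  ultimately show ?thesis
    using connected_continuous_image[OF _ connected_nonzero_vectors[OF assms]] by metis
qed

section \<open>The product of a circle and a sphere as a Hopf manifold\<close>

definition plane_vector :: "complex \<Rightarrow> nat \<Rightarrow> real"
  where "plane_vector z = (\<lambda>i. if i = 0 then Re z else if i = 1 then Im z else 0)"

definition as_complex :: "(nat \<Rightarrow> real) \<Rightarrow> complex"
  where "as_complex u = Complex (u 0) (u 1)"

text \<open>The logarithm of the radius is the coordinate on the real line, wrapped around the
  circle by \<open>cis\<close>. The fibres are therefore the orbits of the dilation by
  \<open>exp (2 * pi)\<close>.\<close>

definition hopf :: "nat \<Rightarrow> (nat \<Rightarrow> real) \<Rightarrow> (nat \<Rightarrow> real) \<times> (nat \<Rightarrow> real)"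
  where "hopf n v = (plane_vector (cis (ln (vnorm n v))), normalize_vector n v)"

definition circle_sphere :: "nat \<Rightarrow> ((nat \<Rightarrow> real) \<times> (nat \<Rightarrow> real)) set"
  where "circle_sphere n = unit_vectors 2 \<times> unit_vectors n"

lemma prod_nsphere_eq: "prod_topology (nsphere 1) (nsphere m) = top_of_set (circle_sphere (Suc m))"
  by (simp add: nsphere_eq circle_sphere_def prod_topology_subtopology_eu numeral_2_eq_2)

lemma as_complex_plane_vector [simp]: "as_complex (plane_vector z) = z"
  by (simp add: as_complex_def plane_vector_def complex_eq_iff)

lemma plane_vector_as_complex: "u \<in> vectors 2 \<Longrightarrow> plane_vector (as_complex u) = u"
  by (auto simp: as_complex_def plane_vector_def vectors_def fun_eq_iff)

lemma vnorm_2: "vnorm 2 u = cmod (as_complex u)"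
  by (simp add: vnorm_def as_complex_def cmod_def numeral_2_eq_2)

lemma cmod_as_complex: "u \<in> unit_vectors 2 \<Longrightarrow> cmod (as_complex u) = 1"
  by (simp add: unit_vectors_def vnorm_2)

lemma plane_vector_unit: "plane_vector (cis \<theta>) \<in> unit_vectors 2"
  unfolding unit_vectors_def vnorm_2 by (simp add: vectors_def) (simp add: plane_vector_def)

lemma continuous_on_plane_vector [continuous_intros]:
  "continuous_on S f \<Longrightarrow> continuous_on S (\<lambda>x. plane_vector (f x))"
  unfolding continuous_on_coordinatewise_iff plane_vector_def
  by (intro allI continuous_intros)

lemma continuous_on_as_complex [continuous_intros]:
  assumes "continuous_on S f"
  shows "continuous_on S (\<lambda>x. as_complex (f x))"
proof -
  have "continuous_on S (\<lambda>x. f x i)" for i using assms continuous_on_coordinatewise_iff by blast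
  then show ?thesis unfolding as_complex_def Complex_eq by (intro continuous_intros)
qed

lemma continuous_on_hopf: "continuous_on (nonzero_vectors n) (hopf n)"
proof -
  have "vnorm n v \<noteq> 0" if "v \<in> nonzero_vectors n" for v using vnorm_pos[OF that] by simp
  then show ?thesis unfolding hopf_def by (intro continuous_intros) auto
qed

lemma hopf_in: "v \<in> nonzero_vectors n \<Longrightarrow> hopf n v \<in> circle_sphere n"
  by (simp add: hopf_def circle_sphere_def plane_vector_unit normalize_vector_unit)

lemma hopf_scale_exp:
  assumes "w \<in> unit_vectors n"
  shows "hopf n (scale (exp t) w) = (plane_vector (cis t), w)"
  using assms normalize_vector_id[OF assms]
  by (simp add: hopf_def vnorm_scale normalize_vector_scale unit_vectors_def)

lemma hopf_periodic:
  assumes "v \<in> nonzero_vectors n"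
  shows "hopf n (scale (exp (2 * pi)) v) = hopf n v"
proof -
  have "cis (2 * pi + ln (vnorm n v)) = cis (ln (vnorm n v))"
    by (simp add: cis_mult[symmetric])
  then show ?thesis
    using vnorm_pos[OF assms] by (simp add: hopf_def vnorm_scale normalize_vector_scale ln_mult)
qed

lemma hopf_surj:
  assumes "x \<in> circle_sphere n"
  obtains v where "v \<in> nonzero_vectors n" "hopf n v = x"
proof -
  obtain u w where x: "x = (u, w)" "u \<in> unit_vectors 2" "w \<in> unit_vectors n"
    using assms by (auto simp: circle_sphere_def)
  define t where "t = Arg (as_complex u)"
  have "as_complex u \<noteq> 0" using cmod_as_complex[OF x(2)] by force
  then have "cis t = as_complex u"
    unfolding t_def using cis_Arg cmod_as_complex[OF x(2)] by (simp add: sgn_eq)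
  then have "plane_vector (cis t) = u"
    using plane_vector_as_complex x(2) by (simp add: unit_vectors_def)
  then have "hopf n (scale (exp t) w) = x" using hopf_scale_exp[OF x(3)] x(1) by simp
  moreover have "scale (exp t) w \<in> nonzero_vectors n"
    using x(3) unit_vectors_subset scale_nonzero[of "exp t" w n] by auto
  ultimately show ?thesis using that by blast
qed

lemma cis_eq_1_imp_zero:
  assumes "cis \<phi> = 1" "\<bar>\<phi>\<bar> \<le> pi"
  shows "\<phi> = 0"
proof (rule ccontr)
  assume "\<phi> \<noteq> 0"
  then have "cos \<bar>\<phi>\<bar> < cos 0" using assms(2) by (intro cos_monotone_0_pi) auto
  moreover have "cos \<phi> = 1" using assms(1) by (metis cis.sel(1) one_complex.sel(1))
  ultimately show False by simp
qed

text \<open>Logarithmic radii in one fibre differ by multiples of 2 pi, so a difference of at most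
  pi must be 0.\<close>

lemma hopf_inj:
  assumes "v \<in> nonzero_vectors n" "w \<in> nonzero_vectors n" "hopf n v = hopf n w"
    and "\<bar>ln (vnorm n v) - ln (vnorm n w)\<bar> \<le> pi"
  shows "v = w"
proof -
  have "cis (ln (vnorm n v)) = cis (ln (vnorm n w))"
    using assms(3) as_complex_plane_vector by (metis hopf_def fst_conv)
  then have "cis (ln (vnorm n v) - ln (vnorm n w)) = 1"
    by (simp add: cis_divide[symmetric])
  then have "ln (vnorm n v) = ln (vnorm n w)" using cis_eq_1_imp_zero assms(4) by fastforce
  then have "vnorm n v = vnorm n w" using vnorm_pos assms(1,2) by simp
  moreover have "normalize_vector n v = normalize_vector n w"
    using assms(3) by (simp add: hopf_def)
  ultimately show ?thesis using scale_normalize_vector assms(1,2) by metis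
qed

section \<open>Annuli of logarithmic width 2 pi as charts of the product\<close>

definition open_annulus :: "nat \<Rightarrow> real \<Rightarrow> (nat \<Rightarrow> real) set"
  where "open_annulus n a = {v \<in> nonzero_vectors n. \<bar>ln (vnorm n v) - a\<bar> < pi}"

definition closed_annulus :: "nat \<Rightarrow> real \<Rightarrow> (nat \<Rightarrow> real) set"
  where "closed_annulus n a = {v \<in> nonzero_vectors n. \<bar>ln (vnorm n v) - a\<bar> \<le> pi}"

text \<open>The product without the slice over the antipode of \<open>cis a\<close>: a unit complex
  number lies on the closed negative real axis, the branch cut of \<open>Arg\<close>, only if it is
  -1.\<close>

definition cut_circle_sphere :: "nat \<Rightarrow> real \<Rightarrow> ((nat \<Rightarrow> real) \<times> (nat \<Rightarrow> real)) set"
  where "cut_circle_sphere n a = {x \<in> circle_sphere n. as_complex (fst x) * cis (- a) \<notin> \<real>\<^sub>\<le>\<^sub>0}"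

lemma cis_notin_nonpos_Reals:
  assumes "\<bar>\<phi>\<bar> < pi"
  shows "cis \<phi> \<notin> \<real>\<^sub>\<le>\<^sub>0"
proof
  assume "cis \<phi> \<in> \<real>\<^sub>\<le>\<^sub>0"
  then have "cos \<phi> \<le> 0" "sin \<phi> = 0" by (simp_all add: complex_nonpos_Reals_iff)
  moreover have "cis \<phi> \<noteq> 0" by simp
  ultimately have "Arg (cis \<phi>) = pi" using sin_cos_squared_add[of \<phi>] by (auto simp: Arg_eq_pi power2_eq_1_iff)
  moreover have "- pi < \<phi>" "\<phi> < pi" using assms by linarith+
  ultimately show False using Arg_cis[of \<phi>] by simp
qed

text \<open>The inverse recovers the logarithmic radius as \<open>a\<close> plus the principal
  argument of the circle component turned back by \<open>a\<close>; off the branch cut this is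
  continuous.\<close>

lemma homeomorphic_map_hopf_annulus:
  "homeomorphic_map (top_of_set (open_annulus n a)) (top_of_set (cut_circle_sphere n a)) (hopf n)"
proof -
  let ?N = "open_annulus n a" and ?V = "cut_circle_sphere n a"
  define ang where "ang = (\<lambda>x::(nat\<Rightarrow>real)\<times>(nat\<Rightarrow>real). a + Arg (as_complex (fst x) * cis (- a)))"
  define g where "g = (\<lambda>x. scale (exp (ang x)) (snd x))"
  have NV: "hopf n v \<in> ?V" and gh: "g (hopf n v) = v" if v: "v \<in> ?N" for v
  proof -
    have vN: "v \<in> nonzero_vectors n" and \<phi>: "\<bar>ln (vnorm n v) - a\<bar> < pi" using v by (auto simp: open_annulus_def)
    have z: "as_complex (fst (hopf n v)) * cis (- a) = cis (ln (vnorm n v) - a)"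
      by (simp add: hopf_def cis_mult)
    show "hopf n v \<in> ?V"
      unfolding cut_circle_sphere_def using hopf_in[OF vN] cis_notin_nonpos_Reals[OF \<phi>] z by simp
    have "ang (hopf n v) = ln (vnorm n v)"
    proof -
      have "- pi < ln (vnorm n v) - a" "ln (vnorm n v) - a \<le> pi" using \<phi> by linarith+
      then show ?thesis unfolding ang_def z using Arg_cis[of "ln (vnorm n v) - a"] by simp
    qed
    then have "g (hopf n v) = scale (vnorm n v) (normalize_vector n v)"
      using vnorm_pos[OF vN] unfolding g_def by (simp add: hopf_def)
    then show "g (hopf n v) = v" using scale_normalize_vector[OF vN] by simp
  qed
  have VN: "g x \<in> ?N" and hg: "hopf n (g x) = x" if x: "x \<in> ?V" for x
  proof -
    obtain u w where uw: "x = (u, w)" "u \<in> unit_vectors 2" "w \<in> unit_vectors n"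
      using x by (auto simp: circle_sphere_def cut_circle_sphere_def)
    let ?z = "as_complex u * cis (- a)"
    have z: "?z \<notin> \<real>\<^sub>\<le>\<^sub>0" using x uw by (simp add: cut_circle_sphere_def)
    have z1: "cmod ?z = 1" using cmod_as_complex[OF uw(2)] by (simp add: norm_mult)
    then have z0: "?z \<noteq> 0" by force
    have "Arg ?z \<noteq> pi" using z by (auto simp: Arg_eq_pi complex_nonpos_Reals_iff)
    then have A: "\<bar>Arg ?z\<bar> < pi" using Arg_bounded[of ?z] by auto
    have ang: "ang x = a + Arg ?z" by (simp add: ang_def uw)
    have "cis (ang x) = cis a * cis (Arg ?z)" by (simp add: ang cis_mult)
    also have "\<dots> = as_complex u * (cis a * cis (- a))"
      using cis_Arg[OF z0] z1 by (simp add: sgn_eq)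
    also have "\<dots> = as_complex u" by (simp add: cis_mult)
    finally have "plane_vector (cis (ang x)) = u"
      using plane_vector_as_complex uw(2) by (simp add: unit_vectors_def)
    then show "hopf n (g x) = x" using hopf_scale_exp[OF uw(3)] uw(1) by (simp add: g_def)
    have "w \<in> nonzero_vectors n" using uw(3) unit_vectors_subset by blast
    then have "g x \<in> nonzero_vectors n" using scale_nonzero[of "exp (ang x)" w n] by (simp add: g_def uw)
    moreover have "ln (vnorm n (g x)) = ang x"
      using uw(3) by (simp add: g_def uw vnorm_scale unit_vectors_def)
    ultimately show "g x \<in> ?N" using A by (simp add: open_annulus_def ang)
  qed
  have cg: "continuous_on ?V g"
    unfolding g_def ang_def by (intro continuous_intros) (auto simp: cut_circle_sphere_def)
  have "homeomorphic_maps (top_of_set ?N) (top_of_set ?V) (hopf n) g"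
    unfolding homeomorphic_maps_def using NV VN hg gh cg
      continuous_on_subset[OF continuous_on_hopf, of ?N n]
    by (auto simp: open_annulus_def)
  then show ?thesis using homeomorphic_maps_map by blast
qed

lemma iso_cancel_right:
  assumes "i \<in> iso G H" "h \<in> hom H K" "h \<circ> i \<in> iso G K"
  shows "h \<in> iso H K"
  using assms bij_betw_comp_iff[of i "carrier G" "carrier H" h "carrier K"] by (simp add: iso_def)

lemma openin_cut_circle_sphere: "openin (top_of_set (circle_sphere n)) (cut_circle_sphere n a)"
proof -
  have "continuous_on (circle_sphere n) (\<lambda>x. as_complex (fst x) * cis (- a))"
    by (intro continuous_intros)
  then have "openin (top_of_set (circle_sphere n))
      (circle_sphere n \<inter> (\<lambda>x. as_complex (fst x) * cis (- a)) -` (- \<real>\<^sub>\<le>\<^sub>0))"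
    by (rule continuous_openin_preimage_gen) auto
  moreover have "circle_sphere n \<inter> (\<lambda>x. as_complex (fst x) * cis (- a)) -` (- \<real>\<^sub>\<le>\<^sub>0) = cut_circle_sphere n a"
    by (auto simp: cut_circle_sphere_def)
  ultimately show ?thesis by simp
qed

lemma openin_delete_point: "openin (top_of_set S) (S - {x::'a::t1_space})"
  by (metis Diff_eq closed_singleton open_Compl openin_open)

lemma openin_open_annulus: "openin (top_of_set (closed_annulus n a)) (open_annulus n a)"
proof -
  have "vnorm n v \<noteq> 0" if "v \<in> closed_annulus n a" for v
    using vnorm_pos that by (fastforce simp: closed_annulus_def)
  then have "continuous_on (closed_annulus n a) (\<lambda>v. \<bar>ln (vnorm n v) - a\<bar>)"
    by (intro continuous_intros) auto
  then have "openin (top_of_set (closed_annulus n a)) (closed_annulus n a \<inter> (\<lambda>v. \<bar>ln (vnorm n v) - a\<bar>) -` {..<pi})"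
    by (rule continuous_openin_preimage_gen) auto
  moreover have "closed_annulus n a \<inter> (\<lambda>v. \<bar>ln (vnorm n v) - a\<bar>) -` {..<pi} = open_annulus n a"
    by (auto simp: closed_annulus_def open_annulus_def)
  ultimately show ?thesis by simp
qed

text \<open>Excision relates the open annulus to the closed one and the cut product to the whole
  product, and \<open>hopf n\<close> is a homeomorphism in between. The closed annulus is the
  convenient domain for chains bounded by its two boundary spheres, and \<open>y\<close>, being in
  its middle, is the only point in it over \<open>hopf n y\<close>.\<close>

lemma generates_hopf_iff:
  fixes y :: "nat \<Rightarrow> real"
  assumes y: "y \<in> nonzero_vectors n" and a: "a = ln (vnorm n y)"
    and c: "singular_relcycle p (top_of_set (closed_annulus n a)) (closed_annulus n a - {y}) c"
  shows "generates p (top_of_set (circle_sphere n)) (circle_sphere n - {hopf n y}) (chain_map p (hopf n) c)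
    \<longleftrightarrow> generates p (top_of_set (closed_annulus n a)) (closed_annulus n a - {y}) c"
proof -
  let ?N = "open_annulus n a" and ?A = "closed_annulus n a" and ?V = "cut_circle_sphere n a" and ?X = "circle_sphere n"
  let ?x = "hopf n y"
  have yN: "y \<in> ?N" using y a by (simp add: open_annulus_def)
  have NA: "?N \<subseteq> ?A" by (auto simp: open_annulus_def closed_annulus_def)
  have VX: "?V \<subseteq> ?X" by (auto simp: cut_circle_sphere_def)
  have homeo: "homeomorphic_map (top_of_set ?N) (top_of_set ?V) (hopf n)"
    by (rule homeomorphic_map_hopf_annulus)
  then have im: "hopf n ` ?N = ?V" and inj: "inj_on (hopf n) ?N"
    by (auto simp: homeomorphic_eq_everything_map)
  have xV: "?x \<in> ?V" using im yN by blast
  have hA: "hopf n v \<noteq> ?x" if "v \<in> ?A - {y}" for v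
    using hopf_inj[of v n y] that y a by (auto simp: closed_annulus_def)
  have cA: "continuous_map (top_of_set ?A) (top_of_set ?X) (hopf n)"
    using continuous_on_subset[OF continuous_on_hopf, of ?A n] hopf_in by (auto simp: closed_annulus_def)
  have hAX: "hopf n \<in> ?A - {y} \<rightarrow> ?X - {?x}"
    using hA hopf_in by (auto simp: closed_annulus_def)
  have i1: "hom_induced p (top_of_set ?N) (?N - {y}) (top_of_set ?A) (?A - {y}) id
      \<in> iso (relative_homology_group p (top_of_set ?N) (?N - {y})) (relative_homology_group p (top_of_set ?A) (?A - {y}))"
  proof -
    have e: "?N \<inter> (?A - {y}) = ?N - {y}" using NA by blast
    show ?thesis
      using excision_top_of_set[OF NA openin_delete_point[of ?A y], where C = "?A - ?N" and p = p]
        openin_open_annulus[of n a] NA yN unfolding e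
      by (auto simp: closedin_def double_diff)
  qed
  have i2: "hom_induced p (top_of_set ?N) (?N - {y}) (top_of_set ?V) (?V - {?x}) (hopf n)
      \<in> iso (relative_homology_group p (top_of_set ?N) (?N - {y})) (relative_homology_group p (top_of_set ?V) (?V - {?x}))"
  proof (rule homeomorphic_map_relative_homology_iso[OF homeo])
    show "hopf n ` (?N - {y}) = ?V - {?x}"
      using inj_on_image_set_diff[OF inj, of ?N "{y}"] yN im by simp
  qed auto
  have i3: "hom_induced p (top_of_set ?V) (?V - {?x}) (top_of_set ?X) (?X - {?x}) id
      \<in> iso (relative_homology_group p (top_of_set ?V) (?V - {?x})) (relative_homology_group p (top_of_set ?X) (?X - {?x}))"
  proof -
    have e: "?V \<inter> (?X - {?x}) = ?V - {?x}" using VX by blast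
    show ?thesis
      using excision_top_of_set[OF VX openin_delete_point[of ?X ?x], where C = "?X - ?V" and p = p]
        openin_cut_circle_sphere[of n a] VX xV unfolding e
      by (auto simp: closedin_def double_diff)
  qed
  have cN: "continuous_map (top_of_set ?N) (top_of_set ?V) (hopf n)"
    using homeo homeomorphic_imp_continuous_map by blast
  \<comment> \<open>Both ways around a commuting square are induced by \<open>hopf n\<close> on the
    open annulus. Cancelling the isomorphism \<open>i1\<close> leaves the map on the closed
    annulus.\<close>
  have "hom_induced p (top_of_set ?A) (?A - {y}) (top_of_set ?X) (?X - {?x}) (hopf n)
       \<circ> hom_induced p (top_of_set ?N) (?N - {y}) (top_of_set ?A) (?A - {y}) id
     = hom_induced p (top_of_set ?N) (?N - {y}) (top_of_set ?X) (?X - {?x}) (hopf n \<circ> id)"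
    by (rule hom_induced_compose[symmetric]) (use NA cA hAX in auto)
  also have "hopf n \<circ> id = id \<circ> hopf n" by simp
  also have "hom_induced p (top_of_set ?N) (?N - {y}) (top_of_set ?X) (?X - {?x}) (id \<circ> hopf n)
     = hom_induced p (top_of_set ?V) (?V - {?x}) (top_of_set ?X) (?X - {?x}) id
       \<circ> hom_induced p (top_of_set ?N) (?N - {y}) (top_of_set ?V) (?V - {?x}) (hopf n)"
  proof (rule hom_induced_compose)
    show "hopf n \<in> ?N - {y} \<rightarrow> ?V - {?x}" using im hA NA by auto
  qed (use VX cN in auto)
  also have "\<dots> \<in> iso (relative_homology_group p (top_of_set ?N) (?N - {y})) (relative_homology_group p (top_of_set ?X) (?X - {?x}))"
    using i2 i3 by (rule iso_set_trans)
  finally have "hom_induced p (top_of_set ?A) (?A - {y}) (top_of_set ?X) (?X - {?x}) (hopf n)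
     \<in> iso (relative_homology_group p (top_of_set ?A) (?A - {y})) (relative_homology_group p (top_of_set ?X) (?X - {?x}))"
    by (rule iso_cancel_right[OF i1 hom_induced_hom])
  then show ?thesis
    by (rule generates_hom_induced_iso[OF cA hAX _ c])
qed

lemma trivial_homology_contractible:
  assumes "contractible_space X" "0 < p"
  shows "trivial_group (homology_group (int p) X)"
  using trivial_reduced_homology_group_contractible_space[OF assms(1), of "int p"] assms(2)
  by (simp add: un_reduced_homology_group)

lemma continuous_map_nonzero_scale:
  assumes "continuous_on S f" "S \<subseteq> nonzero_vectors n" "\<And>v. v \<in> S \<Longrightarrow> scale (f v) v \<in> T"
  shows "continuous_map (top_of_set S) (top_of_set T) (\<lambda>v. scale (f v) v)"
  using assms by (auto intro!: continuous_on_scale continuous_on_id)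

lemma homologous_rel_boundary:
  assumes "singular_chain (Suc p) X d" "chain_boundary (Suc p) d = a - b"
  shows "homologous_rel p X S a b"
  using assms unfolding homologous_rel_def singular_relboundary_alt
  by (intro exI[of _ d] exI[of _ 0]) simp

lemma singular_chain_superset:
  assumes "singular_chain p (top_of_set S) c" "S \<subseteq> T"
  shows "singular_chain p (top_of_set T) c"
  using assms unfolding singular_chain_def subset_iff mem_Collect_eq singular_simplex_top_of_set by blast

text \<open>Let \<open>c\<close> be a chain whose boundary is the difference of the dilate of a cycle \<open>e\<close> and \<open>e\<close>
  itself. The class of its image under \<open>hopf\<close> depends only on the class of \<open>e\<close>. Moving \<open>e\<close> to a sphere and
  \<open>c\<close> to the fundamental annulus around a lift of a given point reduces the local claim to Euclidean space.\<close>

lemma generates_hopf_annulus: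
  assumes m: "0 < m" and y: "y \<in> nonzero_vectors (Suc m)"
    and e: "generates m (top_of_set (nonzero_vectors (Suc m))) {} e"
    and r: "r = vnorm (Suc m) y * exp (- pi)" and R: "R = exp (2 * pi) * r" and a: "a = ln (vnorm (Suc m) y)"
    and c: "singular_chain (Suc m) (top_of_set (closed_annulus (Suc m) a)) c"
    and e': "e' = chain_map m (\<lambda>v. scale (r / vnorm (Suc m) v) v) e"
    and bc: "chain_boundary (Suc m) c = chain_map m (scale (exp (2 * pi))) e' - e'"
  shows "generates (Suc m) (top_of_set (closed_annulus (Suc m) a)) (closed_annulus (Suc m) a - {y}) c"
proof -
  let ?n = "Suc m"
  let ?N = "nonzero_vectors ?n" and ?E = "vectors ?n" and ?A = "closed_annulus ?n a"
  let ?T = "scale (exp (2 * pi))" and ?\<rho> = "\<lambda>v. scale (r / vnorm ?n v) v"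
  define b where "b = vnorm ?n y"
  have b: "0 < b" using vnorm_pos[OF y] by (simp add: b_def)
  have r0: "0 < r" and rb: "r < b" using b by (simp_all add: r flip: b_def)
  have Rb: "R = b * exp pi" by (simp add: R r b_def exp_add[symmetric] flip: mult.assoc) 
  have bR: "b < R" using b by (simp add: Rb)
  have ann: "?A = {v \<in> ?N. r \<le> vnorm ?n v \<and> vnorm ?n v \<le> R}"
  proof -
    have "\<bar>ln (vnorm ?n v) - a\<bar> \<le> pi \<longleftrightarrow> r \<le> vnorm ?n v \<and> vnorm ?n v \<le> R" if v: "v \<in> ?N" for v
    proof -
      have v0: "0 < vnorm ?n v" using vnorm_pos[OF v] .
      have lr: "ln r = a - pi" "ln R = a + pi"
        using b by (simp_all add: r Rb a ln_mult flip: b_def)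
      have "\<bar>ln (vnorm ?n v) - a\<bar> \<le> pi \<longleftrightarrow> ln r \<le> ln (vnorm ?n v) \<and> ln (vnorm ?n v) \<le> ln R"
        unfolding lr by linarith
      then show ?thesis using v0 r0 bR b by simp
    qed
    then show ?thesis unfolding closed_annulus_def by blast
  qed
  have vn0: "vnorm ?n v \<noteq> 0" if "v \<in> ?N" for v using vnorm_pos[OF that] by simp
  have ecyc: "singular_relcycle m (top_of_set ?N) {} e" using e by (simp add: generates_def)
  define Sr where "Sr = {v \<in> ?N. vnorm ?n v = r}"
  have \<rho>Sr: "?\<rho> v \<in> Sr" if "v \<in> ?N" for v
    using that r0 vnorm_pos[OF that] by (simp add: Sr_def scale_nonzero vnorm_scale)
  have cont\<rho>: "continuous_on ?N (\<lambda>v. r / vnorm ?n v)"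
    using vn0 by (intro continuous_intros) auto
  have "continuous_map (top_of_set ?N) (top_of_set Sr) ?\<rho>"
    by (rule continuous_map_nonzero_scale[OF cont\<rho>]) (use \<rho>Sr in auto)
  then have e'cyc: "singular_relcycle m (top_of_set Sr) {} e'"
    unfolding e' by (intro singular_relcycle_chain_map[OF ecyc]) auto
  have SrN: "Sr \<subseteq> ?N" by (auto simp: Sr_def)
  have yE: "y \<in> ?E" using y nonzero_vectors_subset by blast
  have AE: "?A \<subseteq> ?E" unfolding ann using nonzero_vectors_subset by blast
  define Ey where "Ey = ?E - {y}"
  have TSr: "?T v \<in> Ey" if "v \<in> Sr" for v
  proof -
    have "vnorm ?n (?T v) = R" using that by (simp add: Sr_def vnorm_scale R)
    moreover have "?T v \<in> ?E" using that SrN nonzero_vectors_subset scale_nonzero[of "exp (2*pi)" v ?n] by auto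
    ultimately show ?thesis using bR by (auto simp: Ey_def b_def)
  qed
  have SrEy: "Sr \<subseteq> Ey" using rb SrN nonzero_vectors_subset by (auto simp: Ey_def Sr_def b_def)
  have contT: "continuous_map (top_of_set Sr) (top_of_set Ey) ?T"
    using continuous_map_nonzero_scale[of Sr "\<lambda>_. exp (2*pi)" ?n Ey] SrN TSr by auto
  have Te'cyc: "singular_relcycle m (top_of_set Ey) {} (chain_map m ?T e')"
    by (rule singular_relcycle_chain_map[OF e'cyc contT]) simp
  have e'cycEy: "singular_relcycle m (top_of_set Ey) {} e'"
    using e'cyc SrEy by (auto simp: singular_cycle intro: singular_chain_superset)
  have bccyc: "singular_relcycle m (top_of_set Ey) {} (chain_map m ?T e' - e')"
    using Te'cyc e'cycEy by (rule singular_relcycle_diff)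
  \<comment> \<open>The translation taking \<open>y\<close> to the origin compares the complement of
    \<open>y\<close> with the punctured space, where \<open>e\<close> is known to generate.\<close>
  define \<tau> where "\<tau> = (\<lambda>v::nat\<Rightarrow>real. \<lambda>i. v i - y i)"
  have \<tau>N: "\<tau> v \<in> ?N \<longleftrightarrow> v \<noteq> y" if "v \<in> ?E" for v
  proof -
    have "\<tau> v \<in> ?E" using that yE by (simp add: \<tau>_def vectors_def)
    moreover have "\<tau> v = (\<lambda>_. 0) \<longleftrightarrow> v = y" by (auto simp: \<tau>_def fun_eq_iff)
    ultimately show ?thesis by (simp add: nonzero_vectors_eq)
  qed
  have homeo: "homeomorphic_map (top_of_set Ey) (top_of_set ?N) \<tau>"
  proof -
    define g where "g = (\<lambda>v::nat\<Rightarrow>real. \<lambda>i. v i + y i)"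
    have g: "g v \<in> Ey" if "v \<in> ?N" for v
    proof -
      have "g v \<in> ?E" using that yE by (simp add: g_def vectors_def nonzero_vectors_def)
      moreover have "\<tau> (g v) = v" by (simp add: \<tau>_def g_def)
      ultimately show ?thesis using \<tau>N[of "g v"] that by (simp add: Ey_def)
    qed
    have "continuous_on Ey \<tau>" "continuous_on ?N g"
      unfolding continuous_on_coordinatewise_iff \<tau>_def g_def by (intro allI continuous_intros)+
    then have "homeomorphic_maps (top_of_set Ey) (top_of_set ?N) \<tau> g"
      unfolding homeomorphic_maps_def using g \<tau>N by (auto simp: Ey_def \<tau>_def g_def)
    then show ?thesis using homeomorphic_maps_map by blast
  qed
  have cont\<tau>: "continuous_map (top_of_set Ey) (top_of_set ?N) \<tau>"
    using homeo homeomorphic_imp_continuous_map by blast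
  \<comment> \<open>The dilate of \<open>e'\<close> lies on the sphere of radius \<open>R\<close>,
    which encloses \<open>y\<close>, so around \<open>y\<close> it is the same class as
    \<open>e\<close> around the origin.\<close>
  have "homologous_rel m (top_of_set ?N) {} e (chain_map m \<tau> (chain_map m ?T e'))"
  proof -
    have "homotopic_with (\<lambda>h. h \<in> {} \<rightarrow> {}) (top_of_set ?N) (top_of_set ?N) id (\<tau> \<circ> (?T \<circ> ?\<rho>))"
    proof (rule homotopic_with_linear)
      have "continuous_map (top_of_set ?N) (top_of_set Ey) (?T \<circ> ?\<rho>)"
        using \<open>continuous_map (top_of_set ?N) (top_of_set Sr) ?\<rho>\<close> contT by (rule continuous_map_compose)
      then have "continuous_map (top_of_set ?N) (top_of_set ?N) (\<tau> \<circ> (?T \<circ> ?\<rho>))"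
        using cont\<tau> by (rule continuous_map_compose)
      then show "continuous_on ?N (\<tau> \<circ> (?T \<circ> ?\<rho>))" by simp
      fix v and t :: real assume v: "v \<in> ?N" and t: "0 \<le> t" "t \<le> 1"
      have v0: "0 < vnorm ?n v" using vnorm_pos[OF v] .
      let ?w = "\<lambda>i. (1 - t) * id v i + t * (\<tau> \<circ> (?T \<circ> ?\<rho>)) v i"
      define \<kappa> where "\<kappa> = (1 - t) + t * (R / vnorm ?n v)"
      have w: "?w = (\<lambda>i. \<kappa> * v i - t * y i)"
        by (simp add: \<tau>_def \<kappa>_def scale_def R ring_distribs fun_eq_iff)
      have wE: "?w \<in> ?E" unfolding w using v yE by (simp add: vectors_def nonzero_vectors_def)
      have "?w \<noteq> (\<lambda>_. 0)"
      proof
        assume "?w = (\<lambda>_. 0)"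
        then have "\<kappa> * v i = t * y i" for i unfolding w by (simp add: fun_eq_iff)
        then have "scale \<kappa> v = scale t y" by (simp add: scale_def)
        then have "vnorm ?n (scale \<kappa> v) = vnorm ?n (scale t y)" by simp
        then have "\<bar>\<kappa>\<bar> * vnorm ?n v = t * b" using t by (simp add: vnorm_scale b_def)
        moreover have "0 \<le> \<kappa>" using t v0 bR b by (simp add: \<kappa>_def)
        moreover have "\<kappa> * vnorm ?n v = (1 - t) * vnorm ?n v + t * R"
          using v0 by (simp add: \<kappa>_def ring_distribs)
        \<comment> \<open>Comparison of norms: if the segment met the origin, this combination would
          vanish, although \<open>R\<close> exceeds the norm \<open>b\<close> of
          \<open>y\<close>.\<close>
        ultimately have "(1 - t) * vnorm ?n v + t * (R - b) = 0" by (simp add: right_diff_distrib)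
        moreover have "0 < (1 - t) * vnorm ?n v + t * (R - b)"
          by (rule convex_combination_pos) (use v0 bR t in auto)
        ultimately show False by simp
      qed
      then show "?w \<in> ?N" using wE by (simp add: nonzero_vectors_eq)
    qed auto
    from homotopic_imp_homologous_rel_chain_maps[OF this ecyc]
    show ?thesis
      using ecyc by (simp add: chain_map_compose e' chain_map_ident[of m "top_of_set ?N"] singular_cycle)
  qed
  \<comment> \<open>By contrast, \<open>e'\<close> lies on the sphere of radius \<open>r\<close>,
    smaller than the norm of \<open>y\<close>, and bounds in the ball of that radius, which misses
    \<open>y\<close>.\<close>
  moreover have "homologous_rel m (top_of_set ?N) {} (chain_map m \<tau> (chain_map m ?T e')) (chain_map m \<tau> (chain_map m ?T e' - e'))"
  proof -
    define B where "B = {v \<in> ?E. vnorm ?n v \<le> r}"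
    have "contractible_space (top_of_set B)"
    proof (rule contractible_space_starlike[where a = "\<lambda>_. 0"])
      fix v and t :: real assume v: "v \<in> B" and t: "0 \<le> t" "t \<le> 1"
      have "(1 - t) * vnorm ?n v \<le> 1 * vnorm ?n v"
        by (rule mult_right_mono) (use t vnorm_nonneg in auto)
      then have "vnorm ?n (scale (1 - t) v) \<le> r" using v t by (simp add: B_def vnorm_scale)
      moreover have "scale (1 - t) v \<in> ?E" using v by (simp add: B_def vectors_def scale_def)
      ultimately show "(\<lambda>i. (1 - t) * v i + t * 0) \<in> B" by (simp add: B_def scale_def)
    qed
    then have triv: "trivial_group (homology_group (int m) (top_of_set B))"
      using m by (rule trivial_homology_contractible)
    have "Sr \<subseteq> B" using SrN nonzero_vectors_subset by (auto simp: B_def Sr_def)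
    then have "singular_relcycle m (top_of_set B) {} e'"
      using e'cyc by (auto simp: singular_cycle intro: singular_chain_superset)
    from trivial_homology_boundary[OF triv this]
    obtain f where f: "singular_chain (Suc m) (top_of_set B) f" "chain_boundary (Suc m) f = e'" by blast
    have "B \<subseteq> Ey" using rb by (auto simp: B_def Ey_def b_def)
    then have fEy: "singular_chain (Suc m) (top_of_set Ey) f" using f(1) singular_chain_superset by blast
    have "chain_boundary (Suc m) (chain_map (Suc m) \<tau> f) = chain_map m \<tau> e'"
      using chain_boundary_chain_map[OF fEy, of \<tau>] f(2) by simp
    moreover have "singular_chain (Suc m) (top_of_set ?N) (chain_map (Suc m) \<tau> f)"
      using fEy cont\<tau> by (rule singular_chain_chain_map)
    ultimately show ?thesis
      by (intro homologous_rel_boundary) (auto simp: chain_map_diff)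
  qed
  ultimately have "homologous_rel m (top_of_set ?N) {} e (chain_map m \<tau> (chain_map m ?T e' - e'))"
    by (meson homologous_rel_trans)
  with e have "generates m (top_of_set ?N) {} (chain_map m \<tau> (chain_map m ?T e' - e'))"
    by (rule generates_homologous)
  then have g: "generates m (top_of_set Ey) {} (chain_map m ?T e' - e')"
    using generates_hom_induced_iso[OF cont\<tau> _ homeomorphic_map_homology_iso[OF homeo] bccyc] by simp
  have sub: "subtopology (top_of_set ?E) Ey = top_of_set Ey"
    by (simp add: subtopology_subtopology Ey_def inf.absorb2)
  have cE: "singular_relcycle (Suc m) (top_of_set ?E) Ey c"
    using singular_chain_superset[OF c AE] bccyc by (simp add: singular_relcycle bc sub)
  have "topspace (top_of_set ?E) \<inter> Ey \<noteq> {}"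
    using \<rho>Sr[OF y] SrEy by (auto simp: Ey_def)
  from generates_boundary_absolute_iff[OF contractible_vectors this m cE] g
  have gE: "generates (Suc m) (top_of_set ?E) Ey c" by (simp add: bc sub)
  have AEy: "?A \<inter> Ey = ?A - {y}" using AE by (auto simp: Ey_def)
  have Tann: "?T v \<in> ?A - {y}" if "v \<in> Sr" for v
  proof -
    have "vnorm ?n (?T v) = R" using that by (simp add: Sr_def vnorm_scale R)
    moreover have "?T v \<in> ?N" using that SrN scale_nonzero[of "exp (2*pi)" v ?n] by auto
    ultimately show ?thesis using bR rb by (auto simp: ann b_def)
  qed
  have SrA: "Sr \<subseteq> ?A - {y}" using rb bR by (auto simp: ann Sr_def b_def)
  have "continuous_map (top_of_set Sr) (top_of_set (?A - {y})) ?T"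
    using continuous_map_nonzero_scale[of Sr "\<lambda>_. exp (2*pi)" ?n "?A - {y}"] SrN Tann by auto
  then have "singular_chain m (top_of_set (?A - {y})) (chain_map m ?T e')"
    using e'cyc by (intro singular_chain_chain_map) (auto simp: singular_cycle)
  moreover have "singular_chain m (top_of_set (?A - {y})) e'"
    using e'cyc SrA by (auto simp: singular_cycle intro: singular_chain_superset)
  ultimately have "singular_chain m (top_of_set (?A - {y})) (chain_boundary (Suc m) c)"
    unfolding bc by (rule singular_chain_diff)
  then have cA: "singular_relcycle (Suc m) (top_of_set ?A) (?A \<inter> Ey) c"
    using c unfolding AEy by (simp add: singular_relcycle subtopology_subtopology inf.absorb2)
  have cl: "closedin (top_of_set ?E) ({v \<in> ?E. vnorm ?n v \<le> r} \<union> {v \<in> ?E. R \<le> vnorm ?n v})"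
  proof -
    have "continuous_on UNIV (vnorm ?n)" by (intro continuous_intros)
    then have "closed {v. vnorm ?n v \<le> r}" "closed {v. R \<le> vnorm ?n v}"
      by (auto intro!: closed_Collect_le continuous_intros)
    then have "closed ({v. vnorm ?n v \<le> r} \<union> {v. R \<le> vnorm ?n v})" by (rule closed_Un)
    then have "closedin (top_of_set ?E) (?E \<inter> ({v. vnorm ?n v \<le> r} \<union> {v. R \<le> vnorm ?n v}))"
      by (rule closedin_closed_Int)
    moreover have "?E \<inter> ({v. vnorm ?n v \<le> r} \<union> {v. R \<le> vnorm ?n v}) = {v \<in> ?E. vnorm ?n v \<le> r} \<union> {v \<in> ?E. R \<le> vnorm ?n v}"
      by blast
    ultimately show ?thesis by simp
  qed
  have "generates (Suc m) (top_of_set ?E) Ey c \<longleftrightarrow> generates (Suc m) (top_of_set ?A) (?A \<inter> Ey) c"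
  proof (rule generates_excision_iff[OF AE _ _ cl _ cA])
    show "openin (top_of_set ?E) Ey" unfolding Ey_def by (rule openin_delete_point)
    show "?E - ?A \<subseteq> {v \<in> ?E. vnorm ?n v \<le> r} \<union> {v \<in> ?E. R \<le> vnorm ?n v}"
    proof
      fix v assume v: "v \<in> ?E - ?A"
      then have "v \<notin> ?N \<or> vnorm ?n v < r \<or> R < vnorm ?n v" unfolding ann by auto
      moreover have "vnorm ?n v \<le> 0" if "v \<notin> ?N" using vnorm_pos_iff[of v ?n] v that by auto
      ultimately show "v \<in> {v \<in> ?E. vnorm ?n v \<le> r} \<union> {v \<in> ?E. R \<le> vnorm ?n v}"
        using v r0 by fastforce
    qed
    show "{v \<in> ?E. vnorm ?n v \<le> r} \<union> {v \<in> ?E. R \<le> vnorm ?n v} \<subseteq> Ey"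
      using rb bR by (auto simp: Ey_def b_def)
  qed
  then show ?thesis using gE AEy by simp
qed

text \<open>Let \<open>e'\<close> be the radial projection of \<open>e\<close> to the inner sphere
  of an annulus around a lift of \<open>x\<close>, and \<open>c''\<close> a cylinder from
  \<open>e'\<close> to its dilate. Up to the dilate of a chain minus that chain, which
  \<open>hopf\<close> kills, \<open>c''\<close> and \<open>c\<close> differ by a cycle of degree m +
  1, and this bounds in the punctured space. So their images are homologous.\<close>

lemma generates_hopf:
  assumes m: "0 < m" and e: "generates m (top_of_set (nonzero_vectors (Suc m))) {} e"
    and c: "singular_chain (Suc m) (top_of_set (nonzero_vectors (Suc m))) c"
    and bc: "chain_boundary (Suc m) c = chain_map m (scale (exp (2 * pi))) e - e"
    and x: "x \<in> circle_sphere (Suc m)"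
  shows "generates (Suc m) (top_of_set (circle_sphere (Suc m))) (circle_sphere (Suc m) - {x})
    (chain_map (Suc m) (hopf (Suc m)) c)"
proof -
  let ?n = "Suc m"
  let ?N = "nonzero_vectors ?n" and ?X = "circle_sphere ?n" and ?T = "scale (exp (2 * pi))"
  obtain y where y: "y \<in> ?N" "hopf ?n y = x" using hopf_surj[OF x] by blast
  define a where "a = ln (vnorm ?n y)"
  let ?A = "closed_annulus ?n a"
  define r where "r = vnorm ?n y * exp (- pi)"
  have b0: "0 < vnorm ?n y" using vnorm_pos[OF y(1)] .
  have r0: "0 < r" using b0 by (simp add: r_def)
  have lnr: "ln r = a - pi" using b0 by (simp add: r_def a_def ln_mult)
  define \<rho> where "\<rho> = (\<lambda>v. scale (r / vnorm ?n v) v)"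
  define e' where "e' = chain_map m \<rho> e"
  define Sr where "Sr = {v \<in> ?N. vnorm ?n v = r}"
  have ecyc: "singular_relcycle m (top_of_set ?N) {} e" using e by (simp add: generates_def)
  have vn0: "vnorm ?n v \<noteq> 0" if "v \<in> ?N" for v using vnorm_pos[OF that] by simp
  have cont\<rho>: "continuous_on ?N (\<lambda>v. r / vnorm ?n v)"
    using vn0 by (intro continuous_intros) auto
  have \<rho>Sr: "\<rho> v \<in> Sr" if "v \<in> ?N" for v
    using that r0 vnorm_pos[OF that] by (simp add: Sr_def \<rho>_def scale_nonzero vnorm_scale)
  have "continuous_map (top_of_set ?N) (top_of_set Sr) \<rho>"
    unfolding \<rho>_def by (rule continuous_map_nonzero_scale[OF cont\<rho>]) (use \<rho>Sr \<rho>_def in auto)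
  then have e'cyc: "singular_relcycle m (top_of_set Sr) {} e'"
    unfolding e'_def by (intro singular_relcycle_chain_map[OF ecyc]) auto
  have SrN: "Sr \<subseteq> ?N" by (auto simp: Sr_def)
  have e'N: "singular_chain m (top_of_set ?N) e'"
    using e'cyc SrN by (auto simp: singular_cycle intro: singular_chain_superset)
  have TN: "?T v \<in> ?N" if "v \<in> ?N" for v using that by (simp add: scale_nonzero)
  have contT: "continuous_map (top_of_set ?N) (top_of_set ?N) ?T"
    using continuous_map_nonzero_scale[of ?N "\<lambda>_. exp (2*pi)" ?n ?N] TN by auto
  obtain b where b: "singular_chain ?n (top_of_set ?N) b" "chain_boundary ?n b = e' - e"
  proof -
    have "homotopic_with (\<lambda>_. True) (top_of_set ?N) (top_of_set ?N) (\<lambda>v. scale (r / vnorm ?n v) v) (\<lambda>v. scale 1 v)"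
    proof (rule homotopic_with_scale[OF cont\<rho> continuous_on_const])
      fix v and t :: real assume v: "v \<in> ?N" and t: "0 \<le> t" "t \<le> 1"
      have "0 < (1 - t) * (r / vnorm ?n v) + t * 1"
        by (rule convex_combination_pos) (use vnorm_pos[OF v] r0 t in auto)
      then show "scale ((1 - t) * (r / vnorm ?n v) + t * 1) v \<in> ?N"
        using v by (metis less_irrefl scale_nonzero)
    qed
    then have "homotopic_with (\<lambda>h. h \<in> {} \<rightarrow> {}) (top_of_set ?N) (top_of_set ?N) \<rho> id"
      by (simp add: \<rho>_def id_def)
    from homotopic_imp_homologous_rel_chain_maps[OF this ecyc]
    have "singular_relboundary m (top_of_set ?N) {} (e' - e)"
      using ecyc by (simp add: e'_def chain_map_ident[of m "top_of_set ?N"] singular_cycle homologous_rel_def)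
    then show ?thesis using that by (auto simp: singular_boundary)
  qed
  \<comment> \<open>During the radial homotopy from the identity to the dilation, the logarithmic
    radius stays between \<open>a - pi\<close> and \<open>a + pi\<close>, so the cylinder fits into
    the closed annulus.\<close>
  obtain c'' where c'': "singular_chain ?n (top_of_set ?A) c''" "chain_boundary ?n c'' = chain_map m ?T e' - e'"
  proof -
    have "homotopic_with (\<lambda>_. True) (top_of_set Sr) (top_of_set ?A) (\<lambda>v. scale (exp (2 * pi)) v) (\<lambda>v. scale 1 v)"
    proof (rule homotopic_with_scale[OF continuous_on_const continuous_on_const])
      fix v and t :: real assume v: "v \<in> Sr" and t: "0 \<le> t" "t \<le> 1"
      define s where "s = (1 - t) * exp (2 * pi) + t * 1"
      have s0: "0 < s" unfolding s_def by (rule convex_combination_pos) (use t in auto)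
      have e1: "1 \<le> exp (2 * pi)" by simp
      have "(1 - t) * 1 \<le> (1 - t) * exp (2 * pi)" "t * 1 \<le> t * exp (2 * pi)"
        by (rule mult_left_mono[OF e1]; use t in simp)+
      then have "1 \<le> s" "s \<le> exp (2 * pi)" unfolding s_def by (simp_all add: left_diff_distrib)
      then have "0 \<le> ln s" "ln s \<le> 2 * pi" using s0 ln_le_cancel_iff[of s "exp (2*pi)"] by simp_all
      moreover have "ln (vnorm ?n (scale s v)) = ln s + (a - pi)"
        using v s0 r0 by (simp add: Sr_def vnorm_scale ln_mult lnr)
      ultimately have "\<bar>ln (vnorm ?n (scale s v)) - a\<bar> \<le> pi" by linarith
      then show "scale ((1 - t) * exp (2 * pi) + t * 1) v \<in> ?A"
        unfolding s_def[symmetric] closed_annulus_def using v s0 by (simp add: Sr_def scale_nonzero)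
    qed
    then have "homotopic_with (\<lambda>h. h \<in> {} \<rightarrow> {}) (top_of_set Sr) (top_of_set ?A) ?T id"
      by (simp add: id_def)
    from homotopic_imp_homologous_rel_chain_maps[OF this e'cyc]
    have "singular_relboundary m (top_of_set ?A) {} (chain_map m ?T e' - e')"
      using e'cyc by (simp add: chain_map_ident[of m "top_of_set Sr"] singular_cycle homologous_rel_def)
    then show ?thesis using that by (auto simp: singular_boundary)
  qed
  have gA: "generates ?n (top_of_set ?A) (?A - {y}) c''"
    by (rule generates_hopf_annulus[OF m y(1) e r_def refl a_def c''(1) e'_def[unfolded \<rho>_def] c''(2)])
  then have "generates ?n (top_of_set ?X) (?X - {x}) (chain_map ?n (hopf ?n) c'')"
    using generates_hopf_iff[OF y(1) a_def, of ?n c''] y(2) by (simp add: generates_def)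
  moreover have "homologous_rel ?n (top_of_set ?X) (?X - {x}) (chain_map ?n (hopf ?n) c'') (chain_map ?n (hopf ?n) c)"
  proof -
    have AN: "?A \<subseteq> ?N" by (auto simp: closed_annulus_def)
    have c''N: "singular_chain ?n (top_of_set ?N) c''" using c''(1) AN by (rule singular_chain_superset)
    have Tb: "singular_chain ?n (top_of_set ?N) (chain_map ?n ?T b)" using b(1) contT by (rule singular_chain_chain_map)
    define d where "d = c'' - c - (chain_map ?n ?T b - b)"
    have "chain_boundary ?n (chain_map ?n ?T b) = chain_map m ?T e' - chain_map m ?T e"
      using chain_boundary_chain_map[OF b(1), of ?T] b(2) by (simp add: chain_map_diff)
    then have "chain_boundary ?n d = 0"
      by (simp add: d_def chain_boundary_diff c''(2) bc b(2))
    moreover have "singular_chain ?n (top_of_set ?N) d"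
      unfolding d_def by (intro singular_chain_diff c''N c Tb b(1))
    ultimately have "singular_relcycle ?n (top_of_set ?N) {} d" by (simp add: singular_cycle)
    from trivial_homology_boundary[OF trivial_homology_nonzero_vectors this]
    obtain w where w: "singular_chain (Suc ?n) (top_of_set ?N) w" "chain_boundary (Suc ?n) w = d" by auto
    have conth: "continuous_map (top_of_set ?N) (top_of_set ?X) (hopf ?n)"
      using continuous_on_hopf hopf_in by auto
    have "chain_map ?n (hopf ?n) (chain_map ?n ?T b) = chain_map ?n (hopf ?n \<circ> ?T) b"
      by (simp add: chain_map_compose)
    also have "\<dots> = chain_map ?n (hopf ?n) b"
      by (rule chain_map_eq[OF b(1)]) (simp add: hopf_periodic)
    finally have "chain_map ?n (hopf ?n) d = chain_map ?n (hopf ?n) c'' - chain_map ?n (hopf ?n) c"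
      by (simp add: d_def chain_map_diff)
    moreover have "chain_boundary (Suc ?n) (chain_map (Suc ?n) (hopf ?n) w) = chain_map ?n (hopf ?n) d"
      using chain_boundary_chain_map[OF w(1), of "hopf ?n"] w(2) by simp
    ultimately have "homologous_rel ?n (top_of_set ?X) {} (chain_map ?n (hopf ?n) c'') (chain_map ?n (hopf ?n) c)"
      using singular_chain_chain_map[OF w(1) conth] by (intro homologous_rel_boundary) auto
    then show ?thesis by (rule homologous_rel_mono) simp
  qed
  ultimately show ?thesis by (rule generates_homologous)
qed

section \<open>A fundamental cycle consisting of two simplices\<close>

text \<open>The affine function with value i at vertex i. Omitting vertex 0 renumbers the vertices
  and adds 1, because the coordinates sum to 1; omitting the last vertex changes nothing. After
  exponentiation this is the dilation by \<open>exp (2 * pi)\<close>.\<close>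

definition weight :: "nat \<Rightarrow> (nat \<Rightarrow> real) \<Rightarrow> real"
  where "weight p x = (\<Sum>i\<le>p. real i * x i)"

definition spiral :: "nat \<Rightarrow> (nat \<Rightarrow> real) \<Rightarrow> real"
  where "spiral p x = exp (2 * pi * weight p x)"

definition spiral_simplex :: "nat \<Rightarrow> ((nat \<Rightarrow> real) \<Rightarrow> nat \<Rightarrow> real) \<Rightarrow> (nat \<Rightarrow> real) \<Rightarrow> nat \<Rightarrow> real"
  where "spiral_simplex p g = restrict (\<lambda>x. scale (spiral p x) (g x)) (standard_simplex p)"

lemma continuous_on_spiral: "continuous_on S (spiral p)"
  unfolding spiral_def weight_def by (intro continuous_intros)

lemma weight_face_0:
  assumes "y \<in> standard_simplex m"
  shows "weight (Suc m) (simplical_face 0 y) = weight m y + 1"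
proof -
  have "weight (Suc m) (simplical_face 0 y) = (\<Sum>i\<le>m. real (Suc i) * y i)"
    unfolding weight_def by (subst sum.atMost_Suc_shift) (simp add: simplical_face_def)
  also have "\<dots> = weight m y + (\<Sum>i\<le>m. y i)"
    by (simp add: weight_def ring_distribs sum.distrib add.commute)
  finally show ?thesis using standard_simplexD(3)[OF assms] by simp
qed

lemma weight_face_last: "weight (Suc m) (simplical_face (Suc m) y) = weight m y"
  unfolding weight_def by (simp add: simplical_face_def)

lemma singular_face_spiral:
  assumes "k \<le> Suc m"
  shows "singular_face (Suc m) k (spiral_simplex (Suc m) g)
    = restrict (\<lambda>y. scale (spiral (Suc m) (simplical_face k y)) (g (simplical_face k y))) (standard_simplex m)"
  unfolding spiral_simplex_def using assms
  by (subst singular_face_restrict) (auto simp: singular_face_def fun_eq_iff)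

lemma sum_alternating_ends:
  fixes f :: "nat \<Rightarrow> 'a \<Rightarrow>\<^sub>0 int"
  assumes "\<And>k. \<lbrakk>0 < k; k < Suc m\<rbrakk> \<Longrightarrow> f k = 0"
  shows "(\<Sum>k\<le>Suc m. frag_cmul ((-1) ^ k) (f k)) = f 0 + frag_cmul ((-1) ^ Suc m) (f (Suc m))"
proof -
  have "(\<Sum>k\<in>{1..m}. frag_cmul ((-1) ^ k) (f k)) = 0"
    by (rule sum.neutral) (use assms in auto)
  moreover have "{..Suc m} = insert 0 (insert (Suc m) {1..m})" by auto
  ultimately show ?thesis by simp
qed

lemma frag_cmul_diff: "frag_cmul k (a - b) = frag_cmul k a - frag_cmul k b"
  by (rule poly_mapping_eqI) (simp add: lookup_minus right_diff_distrib)

text \<open>Face 0 yields the dilated bubble, and the faces strictly between first and last cancel.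
  The last face has sign (-1)^(m+1) but must contribute minus the bubble, so \<open>g\<close> and
  \<open>h\<close> exchange their roles there when \<open>Suc m\<close> is even.\<close>

lemma chain_boundary_spiral:
  assumes 0: "\<And>y. y \<in> standard_simplex m \<Longrightarrow> g (simplical_face 0 y) = collapse (Suc m) y"
    "\<And>y. y \<in> standard_simplex m \<Longrightarrow> h (simplical_face 0 y) = diag_vector (Suc m) (-1)"
    and mid: "\<And>k y. \<lbrakk>0 < k; k < Suc m; y \<in> standard_simplex m\<rbrakk> \<Longrightarrow> g (simplical_face k y) = h (simplical_face k y)"
    and last: "\<And>y. y \<in> standard_simplex m \<Longrightarrow>
      (if odd (Suc m) then g else h) (simplical_face (Suc m) y) = collapse (Suc m) y"
      "\<And>y. y \<in> standard_simplex m \<Longrightarrow>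
      (if odd (Suc m) then h else g) (simplical_face (Suc m) y) = diag_vector (Suc m) (-1)"
  shows "chain_boundary (Suc m) (frag_of (spiral_simplex (Suc m) g) - frag_of (spiral_simplex (Suc m) h))
    = chain_map m (scale (exp (2 * pi))) (bubble m (spiral m)) - bubble m (spiral m)"
proof -
  let ?F = "\<lambda>k f. frag_of (singular_face (Suc m) k (spiral_simplex (Suc m) f))"
  have "chain_boundary (Suc m) (frag_of (spiral_simplex (Suc m) g) - frag_of (spiral_simplex (Suc m) h))
     = (\<Sum>k\<le>Suc m. frag_cmul ((-1) ^ k) (?F k g - ?F k h))"
    by (simp only: chain_boundary_diff chain_boundary_of if_False nat.distinct frag_cmul_diff
        sum_subtractf simp_thms)
  also have "\<dots> = (?F 0 g - ?F 0 h) + frag_cmul ((-1) ^ Suc m) (?F (Suc m) g - ?F (Suc m) h)"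
  proof (rule sum_alternating_ends)
    fix k assume k: "0 < k" "k < Suc m"
    then have "singular_face (Suc m) k (spiral_simplex (Suc m) g) = singular_face (Suc m) k (spiral_simplex (Suc m) h)"
      using mid[OF k] by (simp add: singular_face_spiral cong: restrict_cong)
    then show "?F k g - ?F k h = 0" by simp
  qed
  also have "frag_cmul ((-1) ^ Suc m) (?F (Suc m) g - ?F (Suc m) h) = - bubble m (spiral m)"
  proof -
    have e: "singular_face (Suc m) (Suc m) (spiral_simplex (Suc m) f)
       = restrict (\<lambda>y. scale (spiral m y) (f (simplical_face (Suc m) y))) (standard_simplex m)" for f
      by (simp add: singular_face_spiral spiral_def weight_face_last)
    show ?thesis
    proof (cases "odd (Suc m)")
      case True
      then have "?F (Suc m) g - ?F (Suc m) h = bubble m (spiral m)"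
        unfolding e bubble_def using last by (simp cong: restrict_cong)
      then show ?thesis using True by simp
    next
      case False
      then have "?F (Suc m) h - ?F (Suc m) g = bubble m (spiral m)"
        unfolding e bubble_def using last by (simp cong: restrict_cong)
      then show ?thesis using False by (metis even_power minus_diff_eq frag_cmul_one neg_one_even_power)
    qed
  qed
  also have "?F 0 g - ?F 0 h = chain_map m (scale (exp (2 * pi))) (bubble m (spiral m))"
  proof -
    have "spiral (Suc m) (simplical_face 0 y) = exp (2 * pi) * spiral m y" if "y \<in> standard_simplex m" for y
      using that by (simp add: spiral_def weight_face_0 ring_distribs exp_add)
    then have e: "singular_face (Suc m) 0 (spiral_simplex (Suc m) f)
       = restrict (\<lambda>y. scale (exp (2 * pi)) (scale (spiral m y) (f (simplical_face 0 y)))) (standard_simplex m)" for f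
      by (simp add: singular_face_spiral scale_scale cong: restrict_cong)
    show ?thesis
      unfolding e bubble_def chain_map_diff chain_map_of simplex_map_restrict
      using 0 by (simp add: comp_def cong: restrict_cong)
  qed
  finally show ?thesis by simp
qed

text \<open>Merging the last vertex of an \<open>n\<close>-simplex into the \<open>a\<close>-th one identifies the faces opposite
  to these vertices up to the cyclic permutation \<open>cycle_from\<close> of the last \<open>n - a\<close> coordinates. When \<open>n - a\<close>
  is odd, the permutation matrix is joined to the identity by a segment of invertible matrices,
  along which \<open>twist\<close> interpolates.\<close>

definition merged :: "nat \<Rightarrow> nat \<Rightarrow> (nat \<Rightarrow> real) \<Rightarrow> nat \<Rightarrow> real"
  where "merged n a x k = x k + (if k = a then x n else 0)"

definition cycle_from :: "nat \<Rightarrow> nat \<Rightarrow> nat \<Rightarrow> nat"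
  where "cycle_from n a i = (if i < a then i else if Suc i < n then Suc i else a)"

definition twist :: "nat \<Rightarrow> nat \<Rightarrow> (nat \<Rightarrow> real) \<Rightarrow> nat \<Rightarrow> real"
  where "twist n a x = (let P = (\<Prod>j<n. merged n a x j); \<nu> = min P (x n) in
    (\<lambda>i. if i < n then (P - \<nu>) * (merged n a x i - 1 / n) + \<nu> * (merged n a x (cycle_from n a i) - 1 / n)
           + (2 * real n ^ n * P - 1) else 0))"

lemma bij_betw_cycle_from:
  assumes "a < n"
  shows "bij_betw (cycle_from n a) {..<n} {..<n}"
proof -
  have "inj_on (cycle_from n a) {..<n}"
    by (auto simp: inj_on_def cycle_from_def split: if_splits)
  moreover have "cycle_from n a ` {..<n} \<subseteq> {..<n}"
    using assms by (auto simp: cycle_from_def)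
  ultimately show ?thesis
    by (metis bij_betw_def endo_inj_surj finite_lessThan)
qed

lemma continuous_on_twist: "continuous_on S (twist n a)"
  unfolding continuous_on_coordinatewise_iff twist_def Let_def merged_def
  by (intro allI continuous_intros)

lemma merged_nonneg: "x \<in> standard_simplex n \<Longrightarrow> 0 \<le> merged n a x k"
  using standard_simplexD(1)[of x n] by (simp add: merged_def)

lemma prod_merged_nonneg: "x \<in> standard_simplex n \<Longrightarrow> 0 \<le> (\<Prod>j<n. merged n a x j)"
  by (simp add: prod_nonneg merged_nonneg)

lemma sum_merged:
  assumes "x \<in> standard_simplex n" "a < n"
  shows "(\<Sum>k<n. merged n a x k) = 1"
proof -
  have "(\<Sum>k<n. merged n a x k) = (\<Sum>k<n. x k) + x n"
    using assms(2) by (simp add: merged_def sum.distrib)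
  also have "\<dots> = (\<Sum>k\<le>n. x k)" by (simp add: lessThan_Suc_atMost[symmetric])
  finally show ?thesis using standard_simplexD(3)[OF assms(1)] by simp
qed

lemma twist_degenerate:
  assumes "0 \<le> x n" "(\<Prod>j<n. merged n a x j) = 0"
  shows "twist n a x = diag_vector n (-1)"
  unfolding twist_def Let_def assms(2) using assms(1) by (auto simp: diag_vector_def)

lemma twist_face_other:
  assumes "y \<in> standard_simplex m" "k < Suc m" "k \<noteq> a"
  shows "twist (Suc m) a (simplical_face k y) = diag_vector (Suc m) (-1)"
proof (rule twist_degenerate)
  have "simplical_face k y \<in> standard_simplex (Suc m)"
    using simplical_face_in_standard_simplex[of "Suc m" k y] assms by simp
  then show "0 \<le> simplical_face k y (Suc m)" using standard_simplexD(1) by blast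
  have "merged (Suc m) a (simplical_face k y) k = 0" using assms(3) by (simp add: merged_def simplical_face_def)
  then show "(\<Prod>j<Suc m. merged (Suc m) a (simplical_face k y) j) = 0"
    using assms(2) by (intro prod_zero) auto
qed

text \<open>On the last face the last coordinate vanishes. So the interpolation parameter is 0 and
  the coordinates appear in their original order.\<close>

lemma twist_face_last:
  assumes "y \<in> standard_simplex m"
  shows "twist (Suc m) a (simplical_face (Suc m) y) = collapse (Suc m) y"
proof -
  have g: "merged (Suc m) a (simplical_face (Suc m) y) j = y j" if "j < Suc m" for j
    using that by (simp add: merged_def simplical_face_def)
  have P: "(\<Prod>j<Suc m. merged (Suc m) a (simplical_face (Suc m) y) j) = (\<Prod>j<Suc m. y j)"
    by (rule prod.cong[OF refl]) (simp add: g)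
  have "0 \<le> (\<Prod>j<Suc m. y j)" by (intro prod_nonneg) (use standard_simplexD(1)[OF assms] in auto)
  then have \<nu>: "min (\<Prod>j<Suc m. y j) (simplical_face (Suc m) y (Suc m)) = 0"
    by (simp add: simplical_face_def)
  show ?thesis unfolding twist_def Let_def P \<nu> collapse_def using g by (simp add: fun_eq_iff)
qed

lemma twist_face_merged:
  assumes y: "y \<in> standard_simplex m" and a: "a < Suc m"
  shows "twist (Suc m) a (simplical_face a y) = collapse (Suc m) y"
proof -
  let ?x = "simplical_face a y"
  have g: "merged (Suc m) a ?x (cycle_from (Suc m) a i) = y i" if "i < Suc m" for i
    using that a by (auto simp: merged_def simplical_face_def cycle_from_def less_Suc_eq)
  have "(\<Prod>j<Suc m. merged (Suc m) a ?x j) = (\<Prod>j<Suc m. merged (Suc m) a ?x (cycle_from (Suc m) a j))"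
    using prod.reindex_bij_betw[OF bij_betw_cycle_from[OF a], of "merged (Suc m) a ?x"] by simp
  also have "\<dots> = (\<Prod>j<Suc m. y j)" by (rule prod.cong[OF refl]) (simp add: g)
  finally have P: "(\<Prod>j<Suc m. merged (Suc m) a ?x j) = (\<Prod>j<Suc m. y j)" .
  \<comment> \<open>The last coordinate on this face is \<open>y m\<close>, one of the factors of
    the product, and the other factors are at most 1. So the minimum is the product, and only the
    permuted offsets survive.\<close>
  have "(\<Prod>j<Suc m. y j) = (\<Prod>j<m. y j) * y m" by simp
  also have "\<dots> \<le> 1 * y m"
    by (intro mult_right_mono prod_le_1) (use standard_simplexD(1,2)[OF y] in auto)
  finally have \<nu>: "min (\<Prod>j<Suc m. y j) (?x (Suc m)) = (\<Prod>j<Suc m. y j)"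
    using a by (simp add: simplical_face_def)
  show ?thesis unfolding twist_def Let_def P \<nu> collapse_def using g by (simp add: fun_eq_iff)
qed

text \<open>For nonzero \<open>\<nu>\<close>, one step along the cycle multiplies \<open>u\<close>
  by the nonpositive number \<open>t\<close>. A full turn multiplies by t^(n-a), which is
  nonpositive since n - a is odd, hence not 1; so \<open>u\<close> vanishes on the cycle. Below
  \<open>a\<close> the permutation is the identity.\<close>

lemma cyclic_combination_zero:
  fixes u :: "nat \<Rightarrow> real"
  assumes "a < n" "odd (n - a)" "0 \<le> \<alpha>" "0 \<le> \<nu>" "0 < \<alpha> + \<nu>"
    and eq: "\<And>i. i < n \<Longrightarrow> \<alpha> * u i + \<nu> * u (cycle_from n a i) = 0"
    and i: "i < n"
  shows "u i = 0"
proof (cases "\<nu> = 0")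
  case True
  then show ?thesis using eq[OF i] assms(5) by simp
next
  case False
  define t where "t = - \<alpha> / \<nu>"
  have t: "t \<le> 0" using assms(3,4) by (simp add: t_def)
  have step: "u (cycle_from n a j) = t * u j" if "j < n" for j
    using eq[OF that] False by (simp add: t_def field_simps add_eq_0_iff2)
  have pow: "u (a + j) = t ^ j * u a" if "a + j < n" for j
    using that
  proof (induction j)
    case (Suc j)
    then show ?case using step[of "a + j"] by (simp add: cycle_from_def)
  qed simp
  have "n - 1 = a + (n - a - 1)" using assms(1) by simp
  then have "u (n - 1) = t ^ (n - a - 1) * u a" using pow[of "n - a - 1"] assms(1) by simp
  moreover have "cycle_from n a (n - 1) = a" using assms(1) by (auto simp: cycle_from_def)
  ultimately have "u a = t * (t ^ (n - a - 1) * u a)" using step[of "n - 1"] assms(1) by simp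
  also have "\<dots> = t ^ (n - a) * u a"
    using assms(1) by (simp add: mult.assoc[symmetric] power_Suc[symmetric] Suc_diff_Suc del: power_Suc)
  finally have "(1 - t ^ (n - a)) * u a = 0" by (simp add: left_diff_distrib)
  moreover have "t ^ (n - a) \<le> 0" using t assms(1,2) by (simp add: power_le_zero_eq)
  ultimately have ua: "u a = 0" by auto
  show ?thesis
  proof (cases "i < a")
    case True
    then have "(\<alpha> + \<nu>) * u i = 0" using eq[OF i] by (simp add: cycle_from_def distrib_right)
    then show ?thesis using assms(5) by simp
  next
    case False
    then show ?thesis using pow[of "i - a"] i ua by simp
  qed
qed

text \<open>The offsets sum to 0, so the coordinates sum to n times the diagonal part
  \<open>h\<close>. If the vector were 0, then \<open>h = 0\<close>, so the product \<open>P\<close>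
  would be positive and all offsets would vanish by the cyclic argument. But then n^n P = 1 and
  \<open>h = 1\<close>.\<close>

lemma twist_nonzero:
  assumes x: "x \<in> standard_simplex n" and a: "a < n" "odd (n - a)"
  shows "twist n a x \<in> nonzero_vectors n"
proof -
  define P where "P = (\<Prod>j<n. merged n a x j)"
  define \<nu> where "\<nu> = min P (x n)"
  define u where "u = (\<lambda>k. merged n a x k - 1 / n)"
  define h where "h = 2 * real n ^ n * P - 1"
  have n: "0 < n" using a by simp
  have tw: "twist n a x i = (P - \<nu>) * u i + \<nu> * u (cycle_from n a i) + h" if "i < n" for i
    using that by (simp add: twist_def Let_def P_def[symmetric] \<nu>_def[symmetric] u_def h_def)
  have P0: "0 \<le> P" unfolding P_def using x by (rule prod_merged_nonneg)
  have \<nu>: "0 \<le> \<nu>" "0 \<le> P - \<nu>" using P0 standard_simplexD(1)[OF x, of n] by (auto simp: \<nu>_def)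
  have su: "(\<Sum>i<n. u i) = 0" using sum_merged[OF x a(1)] n by (simp add: u_def sum_subtractf)
  then have su': "(\<Sum>i<n. u (cycle_from n a i)) = 0"
    using sum.reindex_bij_betw[OF bij_betw_cycle_from[OF a(1)], of u] by simp
  have "\<exists>i<n. twist n a x i \<noteq> 0"
  proof (rule ccontr)
    assume "\<not> ?thesis"
    then have z: "twist n a x i = 0" if "i < n" for i using that by blast
    have "0 = (\<Sum>i<n. twist n a x i)" by (simp add: z)
    also have "\<dots> = (\<Sum>i<n. (P - \<nu>) * u i + \<nu> * u (cycle_from n a i) + h)"
      by (rule sum.cong) (simp_all add: tw)
    also have "\<dots> = (P - \<nu>) * (\<Sum>i<n. u i) + \<nu> * (\<Sum>i<n. u (cycle_from n a i)) + n * h"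
      by (simp add: sum.distrib sum_distrib_left)
    finally have h0: "h = 0" using n su su' by simp
    then have "P > 0" using P0 by (cases "P = 0") (auto simp: h_def)
    have "u i = 0" if "i < n" for i
    proof (rule cyclic_combination_zero[OF a \<nu>(2,1) _ _ that])
      show "0 < P - \<nu> + \<nu>" using \<open>P > 0\<close> by simp
      show "(P - \<nu>) * u j + \<nu> * u (cycle_from n a j) = 0" if "j < n" for j
        using z[OF that] tw[OF that] h0 by simp
    qed
    then have "P = (\<Prod>j<n. 1 / real n)" unfolding P_def by (intro prod.cong) (auto simp: u_def)
    then have "real n ^ n * P = 1" using n by (simp add: power_divide)
    then show False using h0 by (simp add: h_def mult.assoc)
  qed
  moreover have "twist n a x \<in> vectors n" by (simp add: twist_def Let_def vectors_def)
  ultimately show ?thesis by (simp add: nonzero_vectors_def)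
qed

text \<open>The simplicial map identifying vertices 0 and 1. These are adjacent, so faces 0 and 1
  are both mapped by the identity, and no permutation has to be undone.\<close>

definition merge_first :: "nat \<Rightarrow> (nat \<Rightarrow> real) \<Rightarrow> nat \<Rightarrow> real"
  where "merge_first n x = (\<lambda>i. if i = 0 then x 0 + x 1 else if i < n then x (Suc i) else 0)"

lemma merge_first_in_standard_simplex:
  assumes "x \<in> standard_simplex (Suc m)"
  shows "merge_first (Suc m) x \<in> standard_simplex m"
proof -
  have s: "(\<Sum>i\<le>m. merge_first (Suc m) x i) = 1"
  proof -
    have "(\<Sum>i\<le>m. merge_first (Suc m) x i) = x 0 + x 1 + (\<Sum>i\<in>{1..m}. x (Suc i))"
      by (simp add: atMost_atLeast0 sum.atLeast_Suc_atMost merge_first_def)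
    also have "(\<Sum>i\<in>{1..m}. x (Suc i)) = (\<Sum>i\<in>{2..Suc m}. x i)"
      using sum.shift_bounds_cl_Suc_ivl[of x 1 m] by (simp add: numeral_2_eq_2)
    also have "x 0 + x 1 + (\<Sum>i\<in>{2..Suc m}. x i) = (\<Sum>i\<le>Suc m. x i)"
      by (simp add: atMost_atLeast0 sum.atLeast_Suc_atMost numeral_2_eq_2 del: sum.cl_ivl_Suc)
    finally show ?thesis using standard_simplexD(3)[OF assms] by simp
  qed
  have nn: "0 \<le> merge_first (Suc m) x i" for i
    using standard_simplexD(1)[OF assms] by (simp add: merge_first_def)
  have "merge_first (Suc m) x i \<le> 1" for i
  proof (cases "i \<le> m")
    case True
    then show ?thesis using member_le_sum[of i "{..m}" "merge_first (Suc m) x"] nn s by simp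
  qed (simp add: merge_first_def)
  then show ?thesis using s nn by (simp add: standard_simplex_def) (simp add: merge_first_def)
qed

lemma merge_first_face:
  assumes "y \<in> standard_simplex m" "k \<le> 1"
  shows "merge_first (Suc m) (simplical_face k y) = y"
  using assms(2) standard_simplexD(4)[OF assms(1)]
  by (auto simp: merge_first_def simplical_face_def vectors_def fun_eq_iff le_Suc_eq)

lemma collapse_merge_first_face:
  assumes "y \<in> standard_simplex m" "2 \<le> k" "k \<le> Suc m"
  shows "collapse (Suc m) (merge_first (Suc m) (simplical_face k y)) = diag_vector (Suc m) (-1)"
proof (rule collapse_boundary)
  have "merge_first (Suc m) (simplical_face k y) (k - 1) = 0"
    using assms by (auto simp: merge_first_def simplical_face_def)
  moreover have "simplical_face k y \<in> standard_simplex (Suc m)"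
    using simplical_face_in_standard_simplex[of "Suc m" k y] assms by simp
  ultimately show "merge_first (Suc m) (simplical_face k y) \<in> simplex_boundary m"
    using merge_first_in_standard_simplex assms(3) by (auto simp: simplex_boundary_def intro!: exI[of _ "k - 1"])
qed

text \<open>In odd dimension n, \<open>twist n 0\<close> has the collapse on faces 0 and n, and its
  partner is the constant map. In even dimension, the collapse after \<open>merge_first\<close> has
  it on faces 0 and 1, and \<open>twist n 1\<close> on faces 1 and n. Either way the merged index
  has the parity that \<open>twist_nonzero\<close> requires.\<close>

lemma spiral_simplices_exist:
  assumes "0 < m"
  obtains \<sigma> \<tau> where "singular_simplex (Suc m) (top_of_set (nonzero_vectors (Suc m))) \<sigma>"
    "singular_simplex (Suc m) (top_of_set (nonzero_vectors (Suc m))) \<tau>"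
    "chain_boundary (Suc m) (frag_of \<sigma> - frag_of \<tau>)
      = chain_map m (scale (exp (2 * pi))) (bubble m (spiral m)) - bubble m (spiral m)"
proof -
  let ?n = "Suc m" and ?\<Delta> = "standard_simplex (Suc m)"
  have spiral: "singular_simplex ?n (top_of_set (nonzero_vectors ?n)) (spiral_simplex ?n g)"
    if "continuous_on ?\<Delta> g" "\<And>x. x \<in> ?\<Delta> \<Longrightarrow> g x \<in> nonzero_vectors ?n" for g
    unfolding spiral_simplex_def
    by (intro singular_simplex_scaled continuous_on_spiral that) (simp add: spiral_def)
  show ?thesis
  proof (cases "odd ?n")
    case True
    define p where "p = (\<lambda>_::nat\<Rightarrow>real. diag_vector ?n (-1))"
    show ?thesis
    proof (rule that)
      show "singular_simplex ?n (top_of_set (nonzero_vectors ?n)) (spiral_simplex ?n (twist ?n 0))"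
        using True by (intro spiral continuous_on_twist twist_nonzero) auto
      show "singular_simplex ?n (top_of_set (nonzero_vectors ?n)) (spiral_simplex ?n p)"
        unfolding p_def by (intro spiral diag_vector_nonzero continuous_on_const) auto
      show "chain_boundary ?n (frag_of (spiral_simplex ?n (twist ?n 0)) - frag_of (spiral_simplex ?n p))
          = chain_map m (scale (exp (2 * pi))) (bubble m (spiral m)) - bubble m (spiral m)"
        using True by (intro chain_boundary_spiral)
          (simp_all add: twist_face_merged twist_face_other twist_face_last p_def)
    qed
  next
    case False
    define g where "g = collapse ?n \<circ> merge_first ?n"
    have "continuous_on UNIV (merge_first ?n)"
      unfolding continuous_on_coordinatewise_iff merge_first_def by (intro allI continuous_intros)
    then have cg: "continuous_on ?\<Delta> g"
      unfolding g_def by (metis continuous_on_compose continuous_on_collapse continuous_on_subset top_greatest)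
    have g01: "g (simplical_face k y) = collapse ?n y" if "y \<in> standard_simplex m" "k \<le> 1" for k y
      using that by (simp add: g_def merge_first_face)
    have g2: "g (simplical_face k y) = diag_vector ?n (-1)" if "y \<in> standard_simplex m" "2 \<le> k" "k \<le> ?n" for k y
      using that by (simp add: g_def collapse_merge_first_face)
    \<comment> \<open>Both simplices carry the collapse on face 1 and the constant on faces 2 to n -
      1.\<close>
    have mid: "g (simplical_face k y) = twist ?n 1 (simplical_face k y)"
      if "0 < k" "k < ?n" "y \<in> standard_simplex m" for k y
    proof (cases "k = 1")
      case True
      then show ?thesis using g01[of y k] twist_face_merged[of y m 1] that by simp
    next
      case False
      then show ?thesis using g2[of y k] twist_face_other[of y m k 1] that by simp
    qed
    show ?thesis
    proof (rule that)
      show "singular_simplex ?n (top_of_set (nonzero_vectors ?n)) (spiral_simplex ?n g)"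
        by (intro spiral cg) (simp add: g_def collapse_nonzero merge_first_in_standard_simplex)
      show "singular_simplex ?n (top_of_set (nonzero_vectors ?n)) (spiral_simplex ?n (twist ?n 1))"
        using False assms by (intro spiral continuous_on_twist twist_nonzero) auto
      show "chain_boundary ?n (frag_of (spiral_simplex ?n g) - frag_of (spiral_simplex ?n (twist ?n 1)))
          = chain_map m (scale (exp (2 * pi))) (bubble m (spiral m)) - bubble m (spiral m)"
        using False assms g01 g2 mid by (intro chain_boundary_spiral)
          (simp_all add: twist_face_other twist_face_last)
    qed
  qed
qed

section \<open>Simplices without boundary\<close>

lemma segment_in_standard_simplex:
  assumes "x \<in> standard_simplex p" "y \<in> standard_simplex p" "0 \<le> s" "s \<le> 1"
  shows "(\<lambda>i. (1 - s) * x i + s * y i) \<in> standard_simplex p"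
  using convex_standard_simplex[OF assms] .

text \<open>The simplex is starlike about vertex 0. By uniform continuity the segments from there
  can be cut into \<open>N\<close> steps along which \<open>F\<close> changes by less than 1; the
  ratio of consecutive values then has positive real part, where \<open>Arg\<close> is continuous.
  The sum of these small angles is the lift.\<close>

lemma continuous_argument_on_simplex:
  fixes F :: "(nat \<Rightarrow> real) \<Rightarrow> complex"
  assumes F: "continuous_on (standard_simplex p) F" and F1: "\<And>x. x \<in> standard_simplex p \<Longrightarrow> cmod (F x) = 1"
  obtains f where "continuous_on (standard_simplex p) f" "\<And>x. x \<in> standard_simplex p \<Longrightarrow> cis (f x) = F x"
proof -
  let ?\<Delta> = "standard_simplex p"
  define e where "e = (\<lambda>j::nat. if j = 0 then 1 else 0 :: real)"
  have e: "e \<in> ?\<Delta>" by (simp add: e_def)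
  define H where "H = (\<lambda>(s::real, x). F (\<lambda>i. (1 - s) * e i + s * x i))"
  have cH: "continuous_on ({0..1} \<times> ?\<Delta>) H"
    unfolding H_def case_prod_unfold
  proof (rule continuous_on_compose2[OF F])
    show "continuous_on ({0..1} \<times> ?\<Delta>) (\<lambda>q. \<lambda>i. (1 - fst q) * e i + fst q * snd q i)"
      unfolding continuous_on_coordinatewise_iff
      by (intro allI continuous_intros continuous_on_compose2[OF continuous_on_coordinate continuous_on_snd]) auto
    show "(\<lambda>q. \<lambda>i. (1 - fst q) * e i + fst q * snd q i) ` ({0..1} \<times> ?\<Delta>) \<subseteq> ?\<Delta>"
      using segment_in_standard_simplex[OF e] by auto
  qed
  have "compact ?\<Delta>"
    using compactin_standard_simplex[of p] by (simp add: euclidean_product_topology)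
  then have "compact ({0..1::real} \<times> ?\<Delta>)" by (intro compact_Times) auto
  with cH have "uniformly_continuous_on ({0..1} \<times> ?\<Delta>) H"
    by (rule compact_uniformly_continuous)
  then obtain \<delta> where \<delta>: "0 < \<delta>" "\<And>q q'. \<lbrakk>q \<in> {0..1} \<times> ?\<Delta>; q' \<in> {0..1} \<times> ?\<Delta>; dist q' q < \<delta>\<rbrakk> \<Longrightarrow> dist (H q') (H q) < 1"
    unfolding uniformly_continuous_on_def by (meson zero_less_one)
  obtain N :: nat where N: "0 < N" "1 / real N < \<delta>"
    using \<delta>(1) by (metis nat_approx_posE zero_less_Suc)
  define r where "r = (\<lambda>k x. H (real (Suc k) / N, x) / H (real k / N, x))"
  have H1: "cmod (H (s, x)) = 1" if "0 \<le> s" "s \<le> 1" "x \<in> ?\<Delta>" for s x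
    using F1 segment_in_standard_simplex[OF e that(3,1,2)] by (simp add: H_def)
  have r: "r k x \<notin> \<real>\<^sub>\<le>\<^sub>0" "cis (Arg (r k x)) = r k x" if k: "k < N" and x: "x \<in> ?\<Delta>" for k x
  proof -
    have k1: "0 \<le> real (Suc k) / N" "real (Suc k) / N \<le> 1" "0 \<le> real k / N" "real k / N \<le> 1"
      using k N by simp_all
    have "real (Suc k) / N - real k / N = 1 / N" by (simp add: add_divide_distrib)
    then have "dist (real (Suc k) / N, x) (real k / N, x) < \<delta>"
      using N by (simp add: dist_prod_def dist_real_def)
    then have "dist (H (real (Suc k) / N, x)) (H (real k / N, x)) < 1"
      using \<delta>(2)[of "(real k / N, x)" "(real (Suc k) / N, x)"] k1 x by simp
    moreover have n1: "cmod (H (real (Suc k) / N, x)) = 1" "cmod (H (real k / N, x)) = 1"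
      using H1 k1 x by blast+
    then have nz: "H (real k / N, x) \<noteq> 0" by force
    have "r k x - 1 = (H (real (Suc k) / N, x) - H (real k / N, x)) / H (real k / N, x)"
      unfolding r_def using nz by (simp add: diff_divide_distrib)
    ultimately have "cmod (r k x - 1) < 1" using n1 by (simp add: norm_divide dist_norm)
    then have "\<bar>Re (r k x - 1)\<bar> < 1" using abs_Re_le_cmod[of "r k x - 1"] by linarith
    then have "0 < Re (r k x)" by simp
    then show "r k x \<notin> \<real>\<^sub>\<le>\<^sub>0" by (auto simp: complex_nonpos_Reals_iff)
    have "cmod (r k x) = 1" using n1 by (simp add: r_def norm_divide)
    moreover from this have "r k x \<noteq> 0" by force
    ultimately show "cis (Arg (r k x)) = r k x" using cis_Arg[of "r k x"] by (simp add: sgn_eq)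
  qed
  define f where "f = (\<lambda>x. Arg (F e) + (\<Sum>k<N. Arg (r k x)))"
  have "continuous_on ?\<Delta> f"
  proof -
    have cHs: "continuous_on ?\<Delta> (\<lambda>x. H (s, x))" if "0 \<le> s" "s \<le> 1" for s
      by (rule continuous_on_compose2[OF cH]) (use that in \<open>auto intro!: continuous_intros\<close>)
    have "continuous_on ?\<Delta> (\<lambda>x. r k x)" if "k < N" for k
      unfolding r_def
    proof (rule continuous_on_divide)
      show "\<forall>x\<in>?\<Delta>. H (real k / N, x) \<noteq> 0"
      proof
        fix x assume "x \<in> ?\<Delta>"
        then have "cmod (H (real k / N, x)) = 1" using that by (intro H1) auto
        then show "H (real k / N, x) \<noteq> 0" by force
      qed
    qed (use that in \<open>auto intro!: cHs\<close>)
    then show ?thesis unfolding f_def using r(1) by (intro continuous_intros) auto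
  qed
  moreover have "cis (f x) = F x" if x: "x \<in> ?\<Delta>" for x
  proof -
    have "F e \<noteq> 0" using F1[OF e] by force
    then have Fe: "cis (Arg (F e)) = F e" using cis_Arg[of "F e"] F1[OF e] by (simp add: sgn_eq)
    \<comment> \<open>The product of the ratios telescopes.\<close>
    have "cis (Arg (F e) + (\<Sum>k<j. Arg (r k x))) = H (real j / N, x)" if "j \<le> N" for j
      using that
    proof (induction j)
      case 0
      then show ?case using Fe by (simp add: H_def)
    next
      case (Suc j)
      have "cmod (H (real j / N, x)) = 1" using Suc.prems x by (intro H1) auto
      then have "H (real j / N, x) \<noteq> 0" by force
      moreover have "cis (Arg (F e) + (\<Sum>k<Suc j. Arg (r k x))) = H (real j / N, x) * r j x"
        using Suc r(2)[of j x] x by (simp add: add.assoc[symmetric] cis_mult[symmetric] del: cis_mult)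
      ultimately show ?case by (simp add: r_def)
    qed
    from this[of N] show ?thesis using N by (simp add: f_def H_def)
  qed
  ultimately show ?thesis using that by blast
qed

section \<open>Comparing the lifts of faces at vertices\<close>

definition vertex :: "nat \<Rightarrow> nat \<Rightarrow> real"
  where "vertex k = (\<lambda>j. if j = k then 1 else 0)"

lemma vertex_in_standard_simplex: "vertex k \<in> standard_simplex p \<longleftrightarrow> k \<le> p"
  by (simp add: vertex_def)

lemma simplical_face_vertex: "simplical_face i (vertex k) = (if k < i then vertex k else vertex (Suc k))"
  by (auto simp: simplical_face_def vertex_def fun_eq_iff)

lemma continuous_on_simplical_face: "continuous_on S (simplical_face k :: (nat \<Rightarrow> real) \<Rightarrow> _)"
  unfolding continuous_on_coordinatewise_iff simplical_face_def by (intro allI continuous_intros)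

lemma integer_valued_constant:
  fixes \<phi> :: "'a::topological_space \<Rightarrow> real"
  assumes "connected S" "continuous_on S \<phi>" "\<And>x. x \<in> S \<Longrightarrow> \<phi> x \<in> \<int>" "x \<in> S" "y \<in> S"
  shows "\<phi> x = \<phi> y"
proof -
  have le: False if xy: "x \<in> S" "y \<in> S" "\<phi> x < \<phi> y" for x y
  proof -
    obtain a b :: int where ab: "\<phi> x = of_int a" "\<phi> y = of_int b"
      using assms(3) xy(1,2) by (metis Ints_cases)
    have "connected (\<phi> ` S)" using assms(1,2) connected_continuous_image by blast
    moreover have "\<phi> x \<le> of_int a + 1/2" "of_int a + 1/2 \<le> \<phi> y" using ab xy(3) by auto
    ultimately have "of_int a + 1/2 \<in> \<phi> ` S" using xy(1,2) unfolding connected_iff_interval by blast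
    then obtain z where "z \<in> S" "\<phi> z = of_int a + 1/2" by force
    then obtain c :: int where "of_int c = of_int a + (1/2 :: real)" using assms(3) by (metis Ints_cases)
    then have "of_int (2 * c) = (of_int (2 * a + 1) :: real)" by simp
    then have "2 * c = 2 * a + 1" by (simp only: of_int_eq_iff)
    then show False by presburger
  qed
  show ?thesis using le[of x y] le[of y x] assms(4,5) by argo
qed

text \<open>If two faces of a simplex agree in the circle, the lifts of these faces differ by a constant.
  Comparing vertices, this constant vanishes unless the faces are the first and the last one; in that
  case it is the increment along every edge from a vertex to the next one, and a further face which
  agrees with the second one makes one of these increments vanish.\<close>

lemma lifted_faces_agree:
  fixes f :: "(nat \<Rightarrow> real) \<Rightarrow> real"
  assumes m: "0 < m" and f: "continuous_on (standard_simplex (Suc m)) f"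
    and rel: "\<And>i j y. \<lbrakk>E i j; y \<in> standard_simplex m\<rbrakk> \<Longrightarrow> cis (f (simplical_face i y)) = cis (f (simplical_face j y))"
    and sym: "\<And>i j. E i j \<Longrightarrow> E j i"
    and E: "E i j" "i \<le> Suc m" "j \<le> Suc m"
    and partner: "E 1 k" "k \<noteq> 1" "k \<le> Suc m"
    and y: "y \<in> standard_simplex m"
  shows "f (simplical_face i y) = f (simplical_face j y)"
proof -
  define F where "F = (\<lambda>k. f (vertex k))"
  have const: "f (simplical_face i x) - f (simplical_face j x) = f (simplical_face i y) - f (simplical_face j y)"
    if ij: "E i j" "i \<le> Suc m" "j \<le> Suc m" and xy: "x \<in> standard_simplex m" "y \<in> standard_simplex m" for i j x y
  proof -
    define \<phi> where "\<phi> = (\<lambda>x. (f (simplical_face i x) - f (simplical_face j x)) / (2 * pi))"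
    have face: "continuous_on (standard_simplex m) (\<lambda>x. f (simplical_face i x))" if "i \<le> Suc m" for i
      by (rule continuous_on_compose2[OF f continuous_on_simplical_face])
        (use simplical_face_in_standard_simplex[of "Suc m" i] that in auto)
    have "continuous_on (standard_simplex m) \<phi>"
      unfolding \<phi>_def by (intro continuous_intros face ij) auto
    moreover have "\<phi> x \<in> \<int>" if x: "x \<in> standard_simplex m" for x
    proof -
      have "cis (f (simplical_face i x) - f (simplical_face j x)) = 1"
        using rel[OF ij(1) x] by (simp add: cis_divide[symmetric])
      then have "cos (f (simplical_face i x) - f (simplical_face j x)) = 1"
        by (metis cis.sel(1) one_complex.sel(1))
      then obtain l :: int where "f (simplical_face i x) - f (simplical_face j x) = of_int l * 2 * pi"
        by (auto simp: cos_one_2pi_int)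
      then show ?thesis by (simp add: \<phi>_def)
    qed
    moreover have "connected (standard_simplex m)"
      using connectedin_standard_simplex[of m] by (simp add: euclidean_product_topology)
    ultimately have "\<phi> x = \<phi> y" using integer_valued_constant xy by blast
    then show ?thesis by (simp add: \<phi>_def)
  qed
  have inner: "f (simplical_face i x) = f (simplical_face j x)"
    if ij: "E i j" "i < j" "j \<le> Suc m" "0 < i \<or> j < Suc m" and x: "x \<in> standard_simplex m" for i j x
  proof -
    \<comment> \<open>A vertex before \<open>i\<close> is fixed by both face maps, and one from
      \<open>j\<close> on is shifted by both. Such a vertex exists unless the faces are the first
      and the last.\<close>
    obtain l where l: "l \<le> m" "l < i \<or> j \<le> l" using ij(4) m by (metis less_Suc_eq_le order_refl zero_le)
    then have "simplical_face i (vertex l) = simplical_face j (vertex l)"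
      using ij(2) by (auto simp: simplical_face_vertex)
    then show ?thesis
      using const[OF ij(1) _ ij(3) x, of "vertex l"] ij(2,3) l(1) by (simp add: vertex_in_standard_simplex)
  qed
  \<comment> \<open>The face that agrees with face 1 provides an edge with increment 0: from vertex
    0 to 1 if it is face 0, otherwise from vertex 1 to 2.\<close>
  have vertex_eq: "\<exists>l\<le>m. F (Suc l) = F l"
  proof (cases "k = 0")
    case True
    then have "E 0 1" using sym partner(1) by blast
    then have "f (simplical_face 0 (vertex 0)) = f (simplical_face 1 (vertex 0))"
      using m by (intro inner) (auto simp: vertex_in_standard_simplex)
    then show ?thesis by (auto simp: simplical_face_vertex F_def)
  next
    case False
    then have "1 < k" using partner(2) by simp
    then have "f (simplical_face 1 (vertex 1)) = f (simplical_face k (vertex 1))"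
      using m partner by (intro inner) (auto simp: vertex_in_standard_simplex)
    then show ?thesis using m \<open>1 < k\<close> by (auto simp: simplical_face_vertex F_def intro!: exI[of _ 1])
  qed
  have ordered: "f (simplical_face i x) = f (simplical_face j x)"
    if ij: "E i j" "i < j" "j \<le> Suc m" and x: "x \<in> standard_simplex m" for i j x
  proof (cases "0 < i \<or> j < Suc m")
    case False
    then have ij': "i = 0" "j = Suc m" using ij(3) by auto
    \<comment> \<open>The first and the last face map send vertex \<open>l\<close> to the vertices
      \<open>l + 1\<close> and \<open>l\<close>, so the constant difference is the increment along
      any such edge.\<close>
    obtain l where l: "l \<le> m" "F (Suc l) = F l" using vertex_eq by blast
    then have "f (simplical_face i (vertex l)) = f (simplical_face j (vertex l))"
      by (simp add: simplical_face_vertex ij' F_def)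
    then show ?thesis
      using const[OF ij(1) _ ij(3) x, of "vertex l"] ij' l(1) by (simp add: vertex_in_standard_simplex)
  qed (use inner that in blast)
  show ?thesis
  proof (cases i j rule: linorder_cases)
    case less then show ?thesis using ordered E y by blast
  next
    case greater then show ?thesis using ordered[OF sym[OF E(1)]] E y by metis
  qed simp
qed

text \<open>Otherwise the coefficient of this face in the boundary would be (-1)^i.\<close>

lemma cancelling_face_exists:
  assumes "chain_boundary n (frag_of \<sigma>) = 0" "0 < n" "i \<le> n"
  shows "\<exists>k\<le>n. k \<noteq> i \<and> singular_face n k \<sigma> = singular_face n i \<sigma>"
proof (rule ccontr)
  assume "\<not> ?thesis"
  then have no: "singular_face n k \<sigma> \<noteq> singular_face n i \<sigma>" if "k \<le> n" "k \<noteq> i" for k using that by blast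
  have "0 = Poly_Mapping.lookup (\<Sum>k\<le>n. frag_cmul ((-1) ^ k) (frag_of (singular_face n k \<sigma>))) (singular_face n i \<sigma>)"
    using assms(1,2) by (simp add: chain_boundary_of)
  also have "\<dots> = (\<Sum>k\<le>n. if k = i then (-1) ^ i else (0::int))"
    unfolding lookup_sum
  proof (rule sum.cong[OF refl])
    fix k assume "k \<in> {..n}"
    then show "Poly_Mapping.lookup (frag_cmul ((-1) ^ k) (frag_of (singular_face n k \<sigma>))) (singular_face n i \<sigma>)
        = (if k = i then (-1) ^ i else 0)"
      using no[of k] by (cases "k = i") (simp_all add: lookup_single)
  qed
  also have "\<dots> = (-1) ^ i" using assms(3) by simp
  finally show False by simp
qed

lemma boundaryless_simplex_null_homologous:
  assumes m: "0 < m" and \<sigma>: "singular_simplex (Suc m) (top_of_set (circle_sphere (Suc m))) \<sigma>"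
    and cyc: "chain_boundary (Suc m) (frag_of \<sigma>) = 0"
  shows "singular_relboundary (Suc m) (top_of_set (circle_sphere (Suc m))) {} (frag_of \<sigma>)"
proof -
  let ?n = "Suc m" and ?\<Delta> = "standard_simplex (Suc m)" and ?N = "nonzero_vectors (Suc m)" and ?X = "circle_sphere (Suc m)"
  have \<sigma>c: "continuous_on ?\<Delta> \<sigma>" and \<sigma>X: "\<And>x. x \<in> ?\<Delta> \<Longrightarrow> \<sigma> x \<in> ?X" and \<sigma>e: "\<sigma> \<in> extensional ?\<Delta>"
    using \<sigma> by (auto simp: singular_simplex_top_of_set)
  have fs: "fst (\<sigma> x) \<in> unit_vectors 2" "snd (\<sigma> x) \<in> unit_vectors ?n" if "x \<in> ?\<Delta>" for x
    using \<sigma>X[OF that] by (auto simp: circle_sphere_def)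
  have "continuous_on ?\<Delta> (\<lambda>x. as_complex (fst (\<sigma> x)))"
    by (intro continuous_intros \<sigma>c)
  moreover have "cmod (as_complex (fst (\<sigma> x))) = 1" if "x \<in> ?\<Delta>" for x
    using cmod_as_complex fs(1)[OF that] by blast
  ultimately obtain f where f: "continuous_on ?\<Delta> f" "\<And>x. x \<in> ?\<Delta> \<Longrightarrow> cis (f x) = as_complex (fst (\<sigma> x))"
    using continuous_argument_on_simplex by blast
  define \<tau> where "\<tau> = restrict (\<lambda>x. scale (exp (f x)) (snd (\<sigma> x))) ?\<Delta>"
  have \<tau>: "singular_simplex ?n (top_of_set ?N) \<tau>"
    unfolding \<tau>_def
  proof (rule singular_simplex_scaled)
    show "snd (\<sigma> y) \<in> ?N" if "y \<in> ?\<Delta>" for y using fs(2)[OF that] unit_vectors_subset by blast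
  qed (use f(1) continuous_on_snd[OF \<sigma>c] in \<open>auto intro!: continuous_on_exp\<close>)
  have h\<tau>: "simplex_map ?n (hopf ?n) \<tau> = \<sigma>"
  proof
    fix x
    show "simplex_map ?n (hopf ?n) \<tau> x = \<sigma> x"
    proof (cases "x \<in> ?\<Delta>")
      case True
      have "plane_vector (cis (f x)) = fst (\<sigma> x)"
        using f(2)[OF True] fs(1)[OF True] plane_vector_as_complex by (simp add: unit_vectors_def)
      then show ?thesis
        using True hopf_scale_exp[OF fs(2)[OF True], of "f x"] by (simp add: simplex_map_def \<tau>_def)
    next
      case False
      then show ?thesis using \<sigma>e by (simp add: simplex_map_def extensional_def)
    qed
  qed
  define E where "E = (\<lambda>i j. i \<le> ?n \<and> j \<le> ?n \<and> singular_face ?n i \<sigma> = singular_face ?n j \<sigma>)"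
  have E\<sigma>: "\<sigma> (simplical_face i y) = \<sigma> (simplical_face j y)" if "E i j" "y \<in> standard_simplex m" for i j y
  proof -
    have "singular_face ?n i \<sigma> y = singular_face ?n j \<sigma> y" using that(1) by (simp add: E_def)
    then show ?thesis using that(2) by (simp add: singular_face_def)
  qed
  have face: "simplical_face i y \<in> ?\<Delta>" if "i \<le> ?n" "y \<in> standard_simplex m" for i y
    using simplical_face_in_standard_simplex[of ?n i y] that by simp
  \<comment> \<open>This partner of face 1 excludes that the lifts of the first and the last face
    differ by a nonzero period.\<close>
  obtain k where k: "k \<le> ?n" "k \<noteq> 1" "singular_face ?n k \<sigma> = singular_face ?n 1 \<sigma>"
    using cancelling_face_exists[OF cyc, of 1] by auto
  have E1: "E 1 k" using k by (simp add: E_def)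
  have \<tau>face: "singular_face ?n i \<tau> = singular_face ?n j \<tau>" if ij: "E i j" for i j
  proof
    fix y show "singular_face ?n i \<tau> y = singular_face ?n j \<tau> y"
    proof (cases "y \<in> standard_simplex m")
      case True
      have "f (simplical_face i y) = f (simplical_face j y)"
      proof (rule lifted_faces_agree[OF m f(1), where E = E and k = k])
        show "cis (f (simplical_face i y)) = cis (f (simplical_face j y))" if "E i j" "y \<in> standard_simplex m" for i j y
          using f(2) face[of i y] face[of j y] E\<sigma>[OF that] that by (simp add: E_def)
      qed (use ij True E1 k in \<open>auto simp: E_def\<close>)
      then show ?thesis
        using True E\<sigma>[OF ij True] face[of i y] face[of j y] ij by (simp add: singular_face_def \<tau>_def E_def)
    qed (simp add: singular_face_def)
  qed
  \<comment> \<open>Assigns to each face of \<open>\<sigma>\<close> its lift, consistently because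
    equal faces have equal lifts. Extended linearly, it carries the boundary of
    \<open>\<sigma>\<close>, which is 0, to the boundary of \<open>\<tau>\<close>.\<close>
  define \<xi> where "\<xi> = (\<lambda>\<rho>. singular_face ?n (SOME i. i \<le> ?n \<and> singular_face ?n i \<sigma> = \<rho>) \<tau>)"
  have \<xi>: "\<xi> (singular_face ?n i \<sigma>) = singular_face ?n i \<tau>" if "i \<le> ?n" for i
  proof -
    let ?j = "SOME j. j \<le> ?n \<and> singular_face ?n j \<sigma> = singular_face ?n i \<sigma>"
    have "?j \<le> ?n \<and> singular_face ?n ?j \<sigma> = singular_face ?n i \<sigma>"
      by (rule someI[of _ i]) (use that in simp)
    then have "E ?j i" using that by (simp add: E_def)
    then show ?thesis unfolding \<xi>_def by (rule \<tau>face)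
  qed
  have "0 = frag_extend (frag_of \<circ> \<xi>) (chain_boundary ?n (frag_of \<sigma>))" by (simp add: cyc)
  also have "\<dots> = (\<Sum>i\<le>?n. frag_cmul ((-1) ^ i) (frag_of (\<xi> (singular_face ?n i \<sigma>))))"
    unfolding chain_boundary_of if_not_P[OF nat.distinct(2)]
    by (subst frag_extend_sum) (simp_all add: frag_extend_cmul comp_def del: sum.atMost_Suc)
  also have "\<dots> = chain_boundary ?n (frag_of \<tau>)"
    unfolding chain_boundary_of if_not_P[OF nat.distinct(2)] using \<xi> by (intro sum.cong) auto
  finally have "singular_relcycle ?n (top_of_set ?N) {} (frag_of \<tau>)"
    using \<tau> by (simp add: singular_cycle singular_chain_of)
  from trivial_homology_boundary[OF trivial_homology_nonzero_vectors this]
  obtain w where w: "singular_chain (Suc ?n) (top_of_set ?N) w" "chain_boundary (Suc ?n) w = frag_of \<tau>" by auto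
  have conth: "continuous_map (top_of_set ?N) (top_of_set ?X) (hopf ?n)"
    using continuous_on_hopf hopf_in by auto
  have "chain_boundary (Suc ?n) (chain_map (Suc ?n) (hopf ?n) w) = frag_of \<sigma>"
    using chain_boundary_chain_map[OF w(1), of "hopf ?n"] w(2) by (simp add: h\<tau>)
  then show ?thesis
    unfolding singular_boundary using singular_chain_chain_map[OF w(1) conth] by blast
qed

section \<open>The volumes of the product and of the spheres\<close>

lemma integral_simplicial_volume_circle_sphere:
  assumes m: "0 < m" and \<omega>: "orientation (Suc m) (prod_topology (nsphere 1) (nsphere m)) \<omega>"
  shows "integral_simplicial_volume (Suc m) (prod_topology (nsphere 1) (nsphere m)) \<omega> = 2"
proof -
  let ?n = "Suc m" and ?X = "circle_sphere (Suc m)" and ?N = "nonzero_vectors (Suc m)"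
  obtain \<sigma> \<tau> where st: "singular_simplex ?n (top_of_set ?N) \<sigma>" "singular_simplex ?n (top_of_set ?N) \<tau>"
    and bd: "chain_boundary ?n (frag_of \<sigma> - frag_of \<tau>)
      = chain_map m (scale (exp (2 * pi))) (bubble m (spiral m)) - bubble m (spiral m)"
    using spiral_simplices_exist[OF m] by blast
  define z where "z = chain_map ?n (hopf ?n) (frag_of \<sigma> - frag_of \<tau>)"
  have ch: "singular_chain ?n (top_of_set ?N) (frag_of \<sigma> - frag_of \<tau>)"
    using st by (intro singular_chain_diff) (auto simp: singular_chain_of)
  have bub: "generates m (top_of_set ?N) {} (bubble m (spiral m))"
    by (intro generates_bubble m continuous_on_spiral) (simp add: spiral_def)
  have gen: "generates ?n (top_of_set ?X) (?X - {x}) z" if "x \<in> ?X" for x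
    unfolding z_def by (rule generates_hopf[OF m bub ch bd that])
  have conth: "continuous_map (top_of_set ?N) (top_of_set ?X) (hopf ?n)"
    using continuous_on_hopf hopf_in by auto
  have "chain_boundary ?n z = chain_map m (hopf ?n) (chain_map m (scale (exp (2 * pi))) (bubble m (spiral m)) - bubble m (spiral m))"
    unfolding z_def using chain_boundary_chain_map[OF ch, of "hopf ?n"] bd by simp
  also have "\<dots> = chain_map m (hopf ?n \<circ> scale (exp (2 * pi))) (bubble m (spiral m)) - chain_map m (hopf ?n) (bubble m (spiral m))"
    by (simp add: chain_map_diff chain_map_compose)
  also have "\<dots> = 0"
    using chain_map_eq[of m "top_of_set ?N" "bubble m (spiral m)" "hopf ?n \<circ> scale (exp (2 * pi))" "hopf ?n"]
      bub hopf_periodic by (simp add: generates_def singular_cycle)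
  finally have z: "singular_relcycle ?n (top_of_set ?X) {} z"
    unfolding z_def using singular_chain_chain_map[OF ch conth] by (simp add: singular_cycle)
  have "connected ?X"
    unfolding circle_sphere_def using m by (intro connected_Times connected_unit_vectors) auto
  then have conn: "connected_space (top_of_set ?X)"
    using connectedin_iff_connected[of ?X] unfolding connectedin_def by blast
  have ne: "?X \<noteq> {}"
    using hopf_in[OF diag_vector_nonzero[of ?n 1]] by auto
  have norm: "chain_norm z \<le> 2"
    unfolding z_def chain_map_diff chain_map_of by (rule chain_norm_frag_of_diff)
  show ?thesis
    unfolding prod_nsphere_eq
  proof (rule integral_simplicial_volume_eq[OF _ conn _ _ z _ norm])
    show "Hausdorff_space (top_of_set ?X)" by (simp add: Hausdorff_space_subtopology)
    show "orientation ?n (top_of_set ?X) \<omega>" using \<omega> unfolding prod_nsphere_eq .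
  qed (use ne gen boundaryless_simplex_null_homologous[OF m] in auto)
qed

lemma integral_simplicial_volume_nsphere:
  assumes m: "0 < m" and \<omega>: "orientation m (nsphere m) \<omega>"
  shows "integral_simplicial_volume m (nsphere m) \<omega> = (if odd m then 1 else 2)"
proof -
  let ?n = "Suc m" and ?S = "unit_vectors (Suc m)" and ?N = "nonzero_vectors (Suc m)"
  let ?Q = "restrict (\<lambda>y. scale 1 (collapse ?n y)) (standard_simplex m)"
  let ?P = "restrict (\<lambda>y. scale 1 (diag_vector ?n (-1))) (standard_simplex m)"
  define q where "q = simplex_map m (normalize_vector ?n) ?Q"
  define p where "p = simplex_map m (normalize_vector ?n) ?P"
  have "generates m (top_of_set ?N) {} (bubble m (\<lambda>_. 1))"
    by (intro generates_bubble m continuous_on_const) simp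
  then have "generates m (top_of_set ?S) {} (chain_map m (normalize_vector ?n) (bubble m (\<lambda>_. 1)))"
    by (rule generates_normalize)
  then have qp: "generates m (nsphere m) {} (frag_of q - frag_of p)"
    by (simp add: bubble_def chain_map_diff q_def p_def nsphere_eq)
  define z where "z = (if odd m then frag_of q else frag_of q - frag_of p)"
  have gz: "generates m (nsphere m) {} z"
  proof (cases "odd m")
    case True
    define c where "c = normalize_vector ?n (diag_vector ?n (-1))"
    have c: "c \<in> ?S" unfolding c_def by (intro normalize_vector_unit diag_vector_nonzero) auto
    have "p = restrict (\<lambda>_. c) (standard_simplex m)"
      unfolding p_def simplex_map_restrict by (simp add: comp_def c_def)
    then have "singular_chain m (top_of_set {c}) (frag_of p)"
      using singular_simplex_singleton[of "top_of_set {c}" c m p] by (simp add: singular_chain_of)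
    \<comment> \<open>The constant simplex of degree m + 1 has an odd number of equal faces with
      alternating signs, so its boundary is the constant simplex of degree m.\<close>
    then have "singular_relboundary m (top_of_set {c}) {} (frag_of p)"
      using singular_boundary_singleton[of "top_of_set {c}" c m] True by simp
    then have "singular_relboundary m (nsphere m) {} (frag_of p)"
      unfolding singular_boundary nsphere_eq using c singular_chain_superset[of "Suc m" "{c}" _ ?S] by blast
    then have "homologous_rel m (nsphere m) {} (frag_of q - frag_of p) (frag_of q)"
      by (simp add: homologous_rel_def singular_relboundary_minus)
    then show ?thesis using generates_homologous[OF qp] True by (simp add: z_def)
  qed (use qp in \<open>simp add: z_def\<close>)
  have "connected ?S" using m by (intro connected_unit_vectors) auto
  then have conn: "connected_space (nsphere m)"
    using connectedin_iff_connected[of ?S] unfolding connectedin_def nsphere_eq by blast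
  show ?thesis
  proof (rule integral_simplicial_volume_eq[OF _ conn _ \<omega>])
    show "Hausdorff_space (nsphere m)" by (simp add: nsphere_eq Hausdorff_space_subtopology)
    show "singular_relcycle m (nsphere m) {} z" using gz by (simp add: generates_def)
    show "generates m (nsphere m) (topspace (nsphere m) - {x}) z" if "x \<in> topspace (nsphere m)" for x
      by (rule generates_punctured_sphere[OF m gz that])
    show "chain_norm z \<le> (if odd m then 1 else 2)"
      using chain_norm_frag_of_diff[of q p] by (simp add: z_def)
    show "singular_relboundary m (nsphere m) {} (frag_of \<sigma>)"
      if "(if odd m then 1 else 2) = (2::nat)" "chain_boundary m (frag_of \<sigma>) = 0" for \<sigma>
      using that chain_boundary_even_simplex[OF _ m, of \<sigma>] by (simp split: if_splits)
  qed (use in_topspace_nsphere[of m] in auto)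
qed

theorem proposition4p6:
  fixes n :: nat
    and \<omega> :: "(nat \<Rightarrow> real) \<times> (nat \<Rightarrow> real) \<Rightarrow> ((nat \<Rightarrow> real) \<times> (nat \<Rightarrow> real)) chain set"
    and \<omega>\<^sub>1 \<omega>\<^sub>2 :: "(nat \<Rightarrow> real) \<Rightarrow> (nat \<Rightarrow> real) chain set"
  assumes "n > 1"
    and "orientation n (prod_topology (nsphere 1) (nsphere (n - 1))) \<omega>"
    and "orientation 1 (nsphere 1) \<omega>\<^sub>1"
    and "orientation (n - 1) (nsphere (n - 1)) \<omega>\<^sub>2"
  shows "integral_simplicial_volume n (prod_topology (nsphere 1) (nsphere (n - 1))) \<omega> = 2
    \<and> 2 = (if odd n
           then integral_simplicial_volume 1 (nsphere 1) \<omega>\<^sub>1 *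
                integral_simplicial_volume (n - 1) (nsphere (n - 1)) \<omega>\<^sub>2
           else 2 * integral_simplicial_volume 1 (nsphere 1) \<omega>\<^sub>1 *
                integral_simplicial_volume (n - 1) (nsphere (n - 1)) \<omega>\<^sub>2)"
proof -
  obtain m where m: "n = Suc m" "0 < m" using assms(1) by (metis Suc_lessE One_nat_def)
  \<comment> \<open>The sphere has dimension \<open>m = n - 1\<close>, of parity opposite to
    \<open>n\<close>: its volume is 2 for odd \<open>n\<close> and 1 for even \<open>n\<close>,
    while the circle has volume 1.\<close>
  show ?thesis
    using integral_simplicial_volume_circle_sphere[OF m(2), of \<omega>] integral_simplicial_volume_nsphere[of 1 \<omega>\<^sub>1]
      integral_simplicial_volume_nsphere[OF m(2), of \<omega>\<^sub>2] assms(2-4)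
    by (simp add: m(1))
qed

end
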